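(* Fix $i\in\{1,2\}$, $x^0\in\mathbb R^d$, $y_i\in\mathbb R^d$ and $C_i>0$. Assume that $\mathcal F(C_i)\neq\emptyset$ and that $\mathcal S_i(\mathcal F(C_i))\subset\mathcal F(C_i)$. Then there exist a constant $K_i>0$, depending only on system data and $C_i$, and some $p_i\in(0,1)$ such that the positive sequence $(\varrho_m)_{m\ge1}$, $\varrho_m:=K_i^m\gamma_m(p_i)$, with $\gamma_m(p_i)\to0$ as $m\to\infty$, satisfies $$\|\mathcal S_i^{\,m}(u)-\mathcal S_i^{\,m}(v)\|_\infty\le\varrho_m\|u-v\|_\infty\qquad\forall\,u,v\in\mathcal F(y_i),\ \forall m\ge1.$$ Furthermore, if there exists $m_i\ge1$ such that $\varrho_{m_i}<1$, then $\mathcal S_i$ admits a unique fixed point $u_i\in\mathcal F(y_i)$, and the Picard iteration $u^{(n+1)}=\mathcal S_i(u^{(n)})$ converges to $u_i$ for any $u^{(0)}\in\mathcal F(y_i)$.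
   Context: Setting. Fix $t_0<T$, $\Delta t_0:=T-t_0$; $|\cdot|$ is the Euclidean norm and $\|\cdot\|$ the spectral norm of matrices (operator norm for multilinear maps). $N_t:[t_0,T]\times\mathbb R^d\to\mathbb R^d$ satisfies: $t\mapsto N_t(x)$ is in $L^\infty(t_0,T)$ for each $x$; $x\mapsto N_t(x)$ is $C^2$ for each $t$; there are $\Lambda_1,\Lambda_2>0$ with $\|DN_t(x)\|\le\Lambda_1$ and $\|D^2N_t(x)\|\le\Lambda_2$ for all $(t,x)$. $\Phi_{s,t}$, $(s,t)\in[t_0,T]^2$, is the flow: $\frac{d}{dt}\Phi_{s,t}(x)=N_t(\Phi_{s,t}(x))$, $\Phi_{s,s}(x)=x$; $D\Phi_{s,t}$ is its derivative in $x$. $B\in L^\infty((t_0,T)\times\mathbb R^d;\mathbb R^{d\times k})$, $x\mapsto B(t,x)$ is $C^1$ with $\|D_xB(t,x)\|\le L_B$ for all $(t,x)$, for some $L_B\ge0$ ($L_B=0$ if $B$ does not depend on $x$); $\|B\|_\infty$ is the essential supremum of the spectral norm. For $x^0\in\mathbb R^d$ and $u\in L^\infty((t_0,T);\mathbb R^k)$, $x_u$ is the absolutely continuous solution of $\dot x(t)=N_t(x(t))+B(t,x(t))u(t)$, $x(t_0)=x^0$, on $[t_0,T]$. Set $\tau_1:=t_0$, $\tau_2:=T$, and $$\mathcal N_{\tau_i}(u)=\int_{t_0}^TD\Phi_{t,\tau_i}(x_u(t))B(t,x_u(t))B(t,x_u(t))^\top D\Phi_{t,\tau_i}(x_u(t))^\top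 dt.$$ The feasible coercivity class is $\mathcal F(C_i):=\{u\in L^\infty((t_0,T);\mathbb R^k):\lambda_{\min}(\mathcal N_{\tau_i}(u))\ge C_i^{-1}\}$, where $\lambda_{\min}$ is the smallest eigenvalue. The synthesis map $\mathcal S_i:L^\infty((t_0,T);\mathbb R^k)\to L^\infty((t_0,T);\mathbb R^k)$ is $$\mathcal S_i(u)(t)=B(t,x_u(t))^\top D\Phi_{t,\tau_i}(x_u(t))^\top\mathcal N_{\tau_i}(u)^\dagger y_i,$$ with $\dagger$ the Moore–Penrose pseudoinverse (the inverse when $u\in\mathcal F(C_i)$). With $\zeta_i:=C_i\|B\|_\infty e^{\Lambda_1\Delta t_0}|y_i|$, set $\mathcal F(y_i):=\mathcal F(C_i)\cap\{u\in L^\infty((t_0,T);\mathbb R^k):\|u\|_\infty\le\zeta_i\}$. "System data" refers to constants such as $\|B\|_\infty$, $L_B$, $\Lambda_1$, $\Lambda_2$, $\Delta t_0$ and possibly $x^0$; the vector $y_i$ is fixed throughout. For $p\in(0,1)$, $\gamma_m(p):=z_m(1)$, where $z_0\equiv1$ on $[0,1]$ and $z_{m+1}(y)=(1-p)\int_0^yz_m(r)\,dr+p\int_0^1(1-r)z_m(r)\,dr$ for $y\in[0,1]$. *)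

theory Defs
  imports "HOL-Analysis.Analysis" "HOL-Probability.Essential_Supremum"
begin

section \<open>Derivatives and spectral norm\<close>

text \<open>
  The derivative is a bounded linear map, so that \<^term>\<open>norm\<close> is the operator norm, and the
  norm of a second derivative is the norm of the corresponding bilinear map.
\<close>

definition fderiv :: "('a::real_normed_vector \<Rightarrow> 'b::real_normed_vector) \<Rightarrow> 'a \<Rightarrow> 'a \<Rightarrow>\<^sub>L 'b" where
  "fderiv f x = Blinfun (frechet_derivative f (at x))"

definition C1 :: "('a::real_normed_vector \<Rightarrow> 'b::real_normed_vector) \<Rightarrow> bool" where
  "C1 f \<longleftrightarrow> (\<forall>x. f differentiable (at x)) \<and> continuous_on UNIV (fderiv f)"

definition C2 :: "('a::real_normed_vector \<Rightarrow> 'b::real_normed_vector) \<Rightarrow> bool" where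
  "C2 f \<longleftrightarrow> C1 f \<and> C1 (fderiv f)"

text \<open>
  The library norm on \<^typ>\<open>real^'n^'m\<close> is the Frobenius norm. The spectral norm of a matrix is
  the operator norm of the linear map it represents.
\<close>

definition mat_op :: "real^'n^'m \<Rightarrow> (real^'n) \<Rightarrow>\<^sub>L (real^'m)" where
  "mat_op A = Blinfun ((*v) A)"

definition spectral_norm :: "real^'n^'m \<Rightarrow> real" where
  "spectral_norm A = norm (mat_op A)"

section \<open>Essentially bounded functions\<close>

text \<open>
  Elements of \<open>L\<^sup>\<infinity>(S)\<close> are represented by functions; identification almost everywhere is
  made explicit by \<open>ae_eq\<close>. \<open>ess_sup\<close> is only meaningful for essentially bounded functions
  (it is 0 if the essential supremum is infinite).
\<close>

definition Linf :: "'a::euclidean_space set \<Rightarrow> ('a \<Rightarrow> 'b::real_normed_vector) set" where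
  "Linf S = {f. f \<in> borel_measurable (lebesgue_on S) \<and>
                (\<exists>c. AE x in lebesgue_on S. norm (f x) \<le> c)}"

definition ess_sup :: "'a::euclidean_space set \<Rightarrow> ('a \<Rightarrow> real) \<Rightarrow> real" where
  "ess_sup S g = real_of_ereal (esssup (lebesgue_on S) (\<lambda>x. ereal (g x)))"

definition Linf_norm :: "'a::euclidean_space set \<Rightarrow> ('a \<Rightarrow> 'b::real_normed_vector) \<Rightarrow> real" where
  "Linf_norm S f = ess_sup S (\<lambda>x. norm (f x))"

definition ae_eq :: "'a::euclidean_space set \<Rightarrow> ('a \<Rightarrow> 'b) \<Rightarrow> ('a \<Rightarrow> 'b) \<Rightarrow> bool" where
  "ae_eq S f g \<longleftrightarrow> (AE x in lebesgue_on S. f x = g x)"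

section \<open>Absolutely continuous solutions of differential equations\<close>

text \<open>
  A \<open>division_of\<close> is a finite set of non-overlapping compact intervals; the supremum and the
  infimum of such an interval are its end points.
\<close>

definition abs_cont_on :: "real \<Rightarrow> real \<Rightarrow> (real \<Rightarrow> 'a::real_normed_vector) \<Rightarrow> bool" where
  "abs_cont_on a b f \<longleftrightarrow>
     (\<forall>\<epsilon>>0. \<exists>\<delta>>0. \<forall>D. D division_of (\<Union>D) \<and> \<Union>D \<subseteq> {a..b} \<and> (\<Sum>I\<in>D. Sup I - Inf I) < \<delta> \<longrightarrow>
        (\<Sum>I\<in>D. norm (f (Sup I) - f (Inf I))) < \<epsilon>)"

text \<open>\<open>x\<close> solves \<open>x'(t) = f t (x t)\<close> on \<open>[a,b]\<close> with \<open>x s = \<xi>\<close>.\<close>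

definition ode_solution ::
  "real \<Rightarrow> real \<Rightarrow> (real \<Rightarrow> 'a::real_normed_vector \<Rightarrow> 'a) \<Rightarrow> real \<Rightarrow> 'a \<Rightarrow> (real \<Rightarrow> 'a) \<Rightarrow> bool" where
  "ode_solution a b f s \<xi> x \<longleftrightarrow>
     abs_cont_on a b x \<and> x s = \<xi> \<and>
     (AE t in lebesgue_on {a<..<b}. (x has_vector_derivative f t (x t)) (at t))"

text \<open>The value at time \<open>t\<close> of the solution that starts from \<open>\<xi>\<close> at time \<open>s\<close>.\<close>

definition ode_flow ::
  "real \<Rightarrow> real \<Rightarrow> (real \<Rightarrow> 'a::real_normed_vector \<Rightarrow> 'a) \<Rightarrow> real \<Rightarrow> real \<Rightarrow> 'a \<Rightarrow> 'a" where
  "ode_flow a b f s t \<xi> = (THE z. \<exists>x. ode_solution a b f s \<xi> x \<and> x t = z)"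

section \<open>Smallest eigenvalue and Moore--Penrose pseudoinverse\<close>

text \<open>
  Used for symmetric matrices only, where the set of real eigenvalues is nonempty (and finite)
  and contains all eigenvalues.
\<close>

definition lambda_min :: "real^'n^'n \<Rightarrow> real" where
  "lambda_min A = Min {l. \<exists>v. v \<noteq> 0 \<and> A *v v = l *\<^sub>R v}"

definition pseudo_inverse :: "real^'n^'m \<Rightarrow> real^'m^'n" where
  "pseudo_inverse A = (THE X.
      A ** X ** A = A \<and> X ** A ** X = X \<and>
      transpose (A ** X) = A ** X \<and> transpose (X ** A) = X ** A)"

section \<open>The control system\<close>

definition admissible_drift ::
  "real \<Rightarrow> real \<Rightarrow> real \<Rightarrow> real \<Rightarrow> (real \<Rightarrow> real^'d \<Rightarrow> real^'d) \<Rightarrow> bool" where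
  "admissible_drift t0 T \<Lambda>1 \<Lambda>2 N \<longleftrightarrow>
     (\<forall>x. (\<lambda>t. N t x) \<in> Linf {t0<..<T}) \<and>
     (\<forall>t\<in>{t0..T}. C2 (N t)) \<and>
     (\<forall>t\<in>{t0..T}. \<forall>x. norm (fderiv (N t) x) \<le> \<Lambda>1 \<and> norm (fderiv (fderiv (N t)) x) \<le> \<Lambda>2)"

text \<open>
  The derivative of \<open>B(t,\<cdot>)\<close> is taken after passing to linear maps, so that its norm is the
  operator norm of the bilinear map \<open>(h, w) \<mapsto> (D\<^sub>xB(t,x) h) w\<close>.
\<close>

definition admissible_control_matrix ::
  "real \<Rightarrow> real \<Rightarrow> real \<Rightarrow> (real \<Rightarrow> real^'d \<Rightarrow> real^'k^'d) \<Rightarrow> bool" where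
  "admissible_control_matrix t0 T L B \<longleftrightarrow>
     (\<lambda>(t, x). B t x) \<in> Linf ({t0<..<T} \<times> UNIV) \<and>
     (\<forall>t\<in>{t0<..<T}. C1 (\<lambda>x. mat_op (B t x))) \<and>
     (\<forall>t\<in>{t0<..<T}. \<forall>x. norm (fderiv (\<lambda>x. mat_op (B t x)) x) \<le> L)"

definition control_matrix_norm ::
  "real \<Rightarrow> real \<Rightarrow> (real \<Rightarrow> real^'d \<Rightarrow> real^'k^'d) \<Rightarrow> real" where
  "control_matrix_norm t0 T B = ess_sup ({t0<..<T} \<times> UNIV) (\<lambda>(t, x). spectral_norm (B t x))"

definition trajectory ::
  "real \<Rightarrow> real \<Rightarrow> (real \<Rightarrow> real^'d \<Rightarrow> real^'d) \<Rightarrow> (real \<Rightarrow> real^'d \<Rightarrow> real^'k^'d) \<Rightarrow> real^'d \<Rightarrow>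
   (real \<Rightarrow> real^'k) \<Rightarrow> real \<Rightarrow> real^'d" where
  "trajectory t0 T N B x0 u t = ode_flow t0 T (\<lambda>t x. N t x + B t x *v u t) t0 t x0"

definition flow_deriv ::
  "real \<Rightarrow> real \<Rightarrow> (real \<Rightarrow> real^'d \<Rightarrow> real^'d) \<Rightarrow> real \<Rightarrow> real \<Rightarrow> real^'d \<Rightarrow> real^'d^'d" where
  "flow_deriv t0 T N s t x = matrix (frechet_derivative (ode_flow t0 T N s t) (at x))"

definition gramian ::
  "real \<Rightarrow> real \<Rightarrow> (real \<Rightarrow> real^'d \<Rightarrow> real^'d) \<Rightarrow> (real \<Rightarrow> real^'d \<Rightarrow> real^'k^'d) \<Rightarrow> real^'d \<Rightarrow>
   real \<Rightarrow> (real \<Rightarrow> real^'k) \<Rightarrow> real^'d^'d" where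
  "gramian t0 T N B x0 \<tau> u =
     (LINT t:{t0..T}|lebesgue.
        (let x = trajectory t0 T N B x0 u t; D = flow_deriv t0 T N t \<tau> x
         in D ** B t x ** transpose (B t x) ** transpose D))"

definition coercivity_class ::
  "real \<Rightarrow> real \<Rightarrow> (real \<Rightarrow> real^'d \<Rightarrow> real^'d) \<Rightarrow> (real \<Rightarrow> real^'d \<Rightarrow> real^'k^'d) \<Rightarrow> real^'d \<Rightarrow>
   real \<Rightarrow> real \<Rightarrow> (real \<Rightarrow> real^'k) set" where
  "coercivity_class t0 T N B x0 \<tau> C =
     {u \<in> Linf {t0<..<T}. lambda_min (gramian t0 T N B x0 \<tau> u) \<ge> inverse C}"

definition synthesis ::
  "real \<Rightarrow> real \<Rightarrow> (real \<Rightarrow> real^'d \<Rightarrow> real^'d) \<Rightarrow> (real \<Rightarrow> real^'d \<Rightarrow> real^'k^'d) \<Rightarrow> real^'d \<Rightarrow>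
   real \<Rightarrow> real^'d \<Rightarrow> (real \<Rightarrow> real^'k) \<Rightarrow> real \<Rightarrow> real^'k" where
  "synthesis t0 T N B x0 \<tau> y u t =
     (let x = trajectory t0 T N B x0 u t
      in (transpose (B t x) ** transpose (flow_deriv t0 T N t \<tau> x)
            ** pseudo_inverse (gramian t0 T N B x0 \<tau> u)) *v y)"

definition feasible_set ::
  "real \<Rightarrow> real \<Rightarrow> (real \<Rightarrow> real^'d \<Rightarrow> real^'d) \<Rightarrow> (real \<Rightarrow> real^'d \<Rightarrow> real^'k^'d) \<Rightarrow> real \<Rightarrow> real^'d \<Rightarrow>
   real \<Rightarrow> real \<Rightarrow> real^'d \<Rightarrow> (real \<Rightarrow> real^'k) set" where
  "feasible_set t0 T N B \<Lambda>1 x0 \<tau> C y =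
     coercivity_class t0 T N B x0 \<tau> C \<inter>
     {u \<in> Linf {t0<..<T}.
        Linf_norm {t0<..<T} u \<le> C * control_matrix_norm t0 T B * exp (\<Lambda>1 * (T - t0)) * norm y}"

definition endpoint :: "real \<Rightarrow> real \<Rightarrow> nat \<Rightarrow> real" where
  "endpoint t0 T i = (if i = 1 then t0 else T)"

section \<open>The coefficients \<open>\<gamma>\<^sub>m(p)\<close>\<close>

primrec zseq :: "real \<Rightarrow> nat \<Rightarrow> real \<Rightarrow> real" where
  "zseq p 0 = (\<lambda>y. 1)"
| "zseq p (Suc m) = (\<lambda>y. (1 - p) * integral {0..y} (zseq p m)
                         + p * integral {0..1} (\<lambda>r. (1 - r) * zseq p m r))"

definition gam :: "real \<Rightarrow> nat \<Rightarrow> real" where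
  "gam p m = zseq p m 1"

end

theory Submission
  imports Defs
begin

text \<open>
  The value \<open>S u t\<close> of the synthesis map depends on the control \<open>u\<close> only through the state
  \<open>x\<^sub>u t\<close> and the Gramian of \<open>u\<close>. If \<open>P u t\<close> denotes the derivative of the flow from time \<open>t\<close> to
  time \<open>\<tau>\<close>, taken at \<open>x\<^sub>u t\<close>, times \<open>B t (x\<^sub>u t)\<close>, then the Gramian is \<open>G u = \<integral> P u P u\<^sup>T\<close> and
  \<open>S u t = (P u t)\<^sup>T G(u)\<^sup>-\<^sup>1 y\<close>. The map \<open>u \<mapsto> P u t\<close> is Lipschitz in \<open>x\<^sub>u t\<close>, Gronwall's
  inequality bounds \<open>x\<^sub>u t - x\<^sub>v t\<close> by the integral of \<open>\<bar>u - v\<bar>\<close> over \<open>[t0,t]\<close>, and coercivity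
  bounds the inverse Gramians by \<open>C\<close>. So \<open>\<bar>S u t - S v t\<bar>\<close> is at most a constant times the
  integral of \<open>\<bar>u - v\<bar>\<close> over \<open>[t0,t]\<close> (from the state at time \<open>t\<close>) plus a constant times the integral
  over \<open>t\<close> of these integrals (from the Gramian), which after rescaling time to \<open>[0,1]\<close> and an
  integration by parts carries the weight \<open>1 - r\<close>. This is the recursion that defines \<open>z\<^sub>m\<close>, and
  induction gives the estimate for the iterates, with \<open>p = 1/2\<close> and a constant \<open>K\<close> that dominates
  twice each of the two constants (\<open>contraction_step\<close>, \<open>iterates_lipschitz\<close>). One step of the
  recursion multiplies the supremum of \<open>z\<^sub>m\<close> by at most \<open>1 - p/2\<close> (\<open>zseq_bounds\<close>), so that
  \<open>\<gamma>\<^sub>m(p) \<rightarrow> 0\<close>.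

  Two analytic facts carry the Lipschitz bound for \<open>P\<close>. Equations with a right-hand side that is
  only measurable in time have unique solutions, characterised by an integral equation
  (\<open>integral_solution_exists\<close>, \<open>ode_solution_imp_integral_solution\<close>). Their flow is
  differentiable in the initial value with a Lipschitz derivative: the second differences of the
  flow satisfy a Gronwall estimate, and any Lipschitz map whose second differences are bounded in
  this way has a Lipschitz derivative (\<open>ode_flow_second_difference\<close>,
  \<open>second_differences_imp_derivative\<close>).

  If some \<open>\<rho>\<^sub>m\<close> is below 1, the iterates of any two feasible controls approach each other at a
  uniform rate, so Picard sequences are Cauchy in \<open>L\<^sup>\<infinity>\<close> (\<open>contractive_iterate_fixed_point\<close>). The
  limit is again feasible, because the Gramian is continuous along such sequences by dominated
  convergence and coercivity is a closed condition (\<open>feasible_closed\<close>).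
\<close>

section \<open>Differentiation and integration on the line\<close>

text \<open>
  Gauge integrals ignore negligible sets, so exceptional sets of the data are carried along
  explicitly in the estimates.
\<close>

lemma AE_lebesgue_on_iff_negligible:
  assumes "S \<in> sets lebesgue"
  shows "(AE t in lebesgue_on S. P t) \<longleftrightarrow> (\<exists>Z. negligible Z \<and> (\<forall>t\<in>S - Z. P t))"
proof -
  have "(AE t in lebesgue_on S. P t) \<longleftrightarrow> (AE t in lebesgue. t \<in> S \<longrightarrow> P t)"
    using assms by (subst AE_restrict_space_iff) auto
  also have "\<dots> \<longleftrightarrow> (\<exists>Z\<in>null_sets lebesgue. {t. \<not> (t \<in> S \<longrightarrow> P t)} \<subseteq> Z)"
    by (simp add: eventually_ae_filter)
  also have "\<dots> \<longleftrightarrow> (\<exists>Z. negligible Z \<and> (\<forall>t\<in>S - Z. P t))"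
    unfolding negligible_iff_null_sets by blast
  finally show ?thesis .
qed

text \<open>
  Lebesgue's differentiation theorem. Averages over small cubes with lower corner \<open>x\<close>
  converge almost everywhere; in dimension one this is a statement about right derivatives, and the
  left derivatives follow by reflection.
\<close>

lemma indefinite_integral_has_vector_derivative_ae:
  fixes f :: "real \<Rightarrow> 'a::euclidean_space"
  assumes "f integrable_on {a..b}"
  obtains Z where "negligible Z"
    "\<And>t. t \<in> {a<..<b} - Z \<Longrightarrow> ((\<lambda>t. integral {a..t} f) has_vector_derivative f t) (at t)"
proof -
  define g where "g = (\<lambda>t. if t \<in> {a..b} then f t else 0)"
  have g: "g integrable_on UNIV"
    unfolding g_def integrable_restrict_UNIV by (rule assms)
  have gi: "g integrable_on cbox c d" for c d
    using g by (rule integrable_on_subcbox) auto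
  have gr: "(\<lambda>t. g (- t)) integrable_on cbox c d" for c d
    using gi[of "-d" "-c"] Henstock_Kurzweil_Integration.integrable_reflect_real[of g "-c" "-d"] by simp
  obtain Z1 where Z1: "negligible Z1" and
    R: "\<And>x e. x \<notin> Z1 \<Longrightarrow> 0 < e \<Longrightarrow> \<exists>d>0. \<forall>h. 0 < h \<and> h < d \<longrightarrow>
      norm (integral (cbox x (x + h *\<^sub>R One)) g /\<^sub>R h ^ DIM(real) - g x) < e"
    using integrable_ccontinuous_explicit[OF gi] by blast
  obtain Z2 where Z2: "negligible Z2" and
    L: "\<And>x e. x \<notin> Z2 \<Longrightarrow> 0 < e \<Longrightarrow> \<exists>d>0. \<forall>h. 0 < h \<and> h < d \<longrightarrow>
      norm (integral (cbox x (x + h *\<^sub>R One)) (\<lambda>t. g (- t)) /\<^sub>R h ^ DIM(real) - g (- x)) < e"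
    using integrable_ccontinuous_explicit[OF gr] by blast
  have scale: "norm (I - h *\<^sub>R y) \<le> e * h" if "norm (I /\<^sub>R h - y) < e" "0 < h" for I y :: 'a and h e :: real
  proof -
    have "I - h *\<^sub>R y = h *\<^sub>R (I /\<^sub>R h - y)" using that by (simp add: algebra_simps)
    then have "norm (I - h *\<^sub>R y) = h * norm (I /\<^sub>R h - y)" using that by simp
    then show ?thesis using that by (simp add: mult.commute)
  qed
  show thesis
  proof
    show "negligible (Z1 \<union> uminus ` Z2)"
      using Z1 Z2 by (auto intro!: negligible_differentiable_image_negligible differentiable_on_minus differentiable_on_ident)
    fix t assume t: "t \<in> {a<..<b} - (Z1 \<union> uminus ` Z2)"
    then have t1: "t \<notin> Z1" and t2: "- t \<notin> Z2" by (auto simp: image_iff)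
    have incr: "integral {a..d} f - integral {a..c} f = integral {c..d} g" if "a \<le> c" "c \<le> d" "d \<le> b" for c d
    proof -
      have "integral {a..c} f + integral {c..d} f = integral {a..d} f"
        using that assms by (intro Henstock_Kurzweil_Integration.integral_combine)
          (auto intro: integrable_subinterval_real)
      moreover have "integral {c..d} f = integral {c..d} g"
        by (rule integral_cong) (use that in \<open>auto simp: g_def\<close>)
      ultimately show ?thesis by (simp add: algebra_simps flip: \<open>_ = integral {a..d} f\<close>)
    qed
    have gt: "g t = f t" using t by (auto simp: g_def)
    show "((\<lambda>t. integral {a..t} f) has_vector_derivative f t) (at t)"
      unfolding has_vector_derivative_def has_derivative_at_alt
    proof (intro conjI allI impI)
      fix e :: real assume "e > 0"
      obtain d1 where d1: "d1 > 0" "\<And>h. 0 < h \<Longrightarrow> h < d1 \<Longrightarrow> norm (integral {t..t + h} g /\<^sub>R h - f t) < e"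
        using R[OF t1 \<open>e > 0\<close>] by (auto simp: gt)
      obtain d2 where d2: "d2 > 0"
        "\<And>h. 0 < h \<Longrightarrow> h < d2 \<Longrightarrow> norm (integral {-t..-t + h} (\<lambda>t. g (- t)) /\<^sub>R h - f t) < e"
        using L[OF t2 \<open>e > 0\<close>] by (auto simp: gt)
      define d where "d = min (min d1 d2) (min (t - a) (b - t))"
      have "norm (integral {a..y} f - integral {a..t} f - (y - t) *\<^sub>R f t) \<le> e * norm (y - t)"
        if "norm (y - t) < d" for y
      proof -
        consider "y = t" | "y > t" | "y < t" by linarith
        then show ?thesis
        proof cases
          case 2
          then have "norm (integral {t..t + (y - t)} g /\<^sub>R (y - t) - f t) < e"
            using that by (intro d1) (auto simp: d_def)
          from scale[OF this] 2 show ?thesis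
            using that t by (subst incr) (auto simp: d_def)
        next
          case 3
          then have "norm (integral {-t..-t + (t - y)} (\<lambda>t. g (- t)) /\<^sub>R (t - y) - f t) < e"
            using that by (intro d2) (auto simp: d_def)
          then have "norm (integral {y..t} g /\<^sub>R (t - y) - f t) < e"
            using Henstock_Kurzweil_Integration.integral_reflect_real[of t y g] by simp
          from scale[OF this] 3 have *: "norm (integral {y..t} g - (t - y) *\<^sub>R f t) \<le> e * (t - y)" by simp
          have "integral {a..t} f - integral {a..y} f = integral {y..t} g"
            using that t 3 by (intro incr) (auto simp: d_def)
          then have "integral {a..y} f - integral {a..t} f - (y - t) *\<^sub>R f t
            = - (integral {y..t} g - (t - y) *\<^sub>R f t)"
            by (simp add: algebra_simps flip: \<open>_ = integral {y..t} g\<close>)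
          moreover have "norm (y - t) = t - y" using 3 by simp
          ultimately show ?thesis using * by (simp only: norm_minus_cancel)
        qed auto
      qed
      moreover have "d > 0" using d1 d2 t by (auto simp: d_def)
      ultimately show "\<exists>d>0. \<forall>y. norm (y - t) < d \<longrightarrow>
         norm (integral {a..y} f - integral {a..t} f - (y - t) *\<^sub>R f t) \<le> e * norm (y - t)"
        by blast
    qed (rule bounded_linear_scaleR_left)
  qed
qed

text \<open>
  The fundamental theorem of calculus for absolutely continuous functions. At a tag where the
  derivative exists, the gauge makes the increment over the interval agree with
  \<open>(v - u) f x\<close> up to a small multiple of the length. The intervals tagged in the exceptional set
  lie in an open set of small measure, where absolute continuity makes the increments small.
\<close>

lemma abs_cont_on_has_integral:
  fixes w :: "real \<Rightarrow> 'a::banach"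
  assumes ac: "abs_cont_on a b w" and ab: "a \<le> b" and Z: "negligible Z"
    and der: "\<And>t. t \<in> {a<..<b} - Z \<Longrightarrow> (w has_vector_derivative f t) (at t)"
  shows "(f has_integral (w b - w a)) {a..b}"
proof -
  define N where "N = Z \<union> {a, b}"
  define g where "g = (\<lambda>t. if t \<in> N then 0 else f t)"
  have N: "negligible N" unfolding N_def using Z by (simp add: negligible_Un)
  have "(g has_integral (w b - w a)) (cbox a b)"
    unfolding has_integral
  proof (intro allI impI)
    fix e :: real assume e: "e > 0"
    obtain \<delta> where \<delta>: "\<delta> > 0" and small: "\<And>D. D division_of (\<Union>D) \<Longrightarrow> \<Union>D \<subseteq> {a..b} \<Longrightarrow>
        (\<Sum>I\<in>D. Sup I - Inf I) < \<delta> \<Longrightarrow> (\<Sum>I\<in>D. norm (w (Sup I) - w (Inf I))) < e / 2"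
      using ac e unfolding abs_cont_on_def by (meson half_gt_zero)
    obtain U where U: "open U" "N \<subseteq> U" "U \<in> lmeasurable" "measure lebesgue U < \<delta>"
    proof -
      have "N \<in> null_sets lebesgue" using N by (simp add: negligible_iff_null_sets)
      then obtain U where "open U" "N \<subseteq> U" "U - N \<in> lmeasurable" "emeasure lebesgue (U - N) < ennreal \<delta>"
        using sets_lebesgue_outer_open[of N \<delta>] \<delta> by blast
      moreover from this have "U = (U - N) \<union> N" by auto
      then have "U \<in> lmeasurable"
        using \<open>U - N \<in> lmeasurable\<close> N by (metis fmeasurable.Un negligible_imp_measurable)
      moreover have "emeasure lebesgue U = emeasure lebesgue (U - N)"
        using \<open>N \<in> null_sets lebesgue\<close> \<open>U \<in> lmeasurable\<close> by (simp add: emeasure_Diff_null_set fmeasurableD)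
      ultimately show ?thesis using that[of U] \<delta>
        by (simp add: emeasure_eq_measure2 ennreal_less_iff)
    qed
    \<comment> \<open>The denominator \<open>b - a + 1\<close> avoids a division by zero for \<open>a = b\<close>.\<close>
    define \<epsilon> where "\<epsilon> = e / (2 * (b - a + 1))"
    have \<epsilon>: "\<epsilon> > 0" "\<epsilon> * (b - a) < e / 2" using e ab by (auto simp: \<epsilon>_def field_simps)
    have "\<exists>d>0. \<forall>y. norm (y - t) < d \<longrightarrow> norm (w y - w t - (y - t) *\<^sub>R f t) \<le> \<epsilon> * norm (y - t)"
      if "t \<in> {a..b} - N" for t
    proof -
      have "(w has_vector_derivative f t) (at t)" using that by (intro der) (auto simp: N_def)
      then show ?thesis using \<epsilon>(1) unfolding has_vector_derivative_def has_derivative_at_alt by blast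
    qed
    then obtain d where d: "\<And>t. t \<in> {a..b} - N \<Longrightarrow> d t > 0"
      "\<And>t y. t \<in> {a..b} - N \<Longrightarrow> norm (y - t) < d t \<Longrightarrow>
         norm (w y - w t - (y - t) *\<^sub>R f t) \<le> \<epsilon> * norm (y - t)" by metis
    define \<gamma> where "\<gamma> = (\<lambda>t. if t \<in> N then U else ball t (if t \<in> {a..b} then d t else 1))"
    have gauge: "gauge \<gamma>" unfolding gauge_def \<gamma>_def using U d(1) by auto
    have riemann: "norm ((\<Sum>(x,k)\<in>D. measure lborel k *\<^sub>R g x) - (w b - w a)) < e"
      if D: "D tagged_division_of cbox a b" and fine: "\<gamma> fine D" for D
    proof -
      let ?h = "\<lambda>(x,k). measure lborel k *\<^sub>R g x - (w (Sup k) - w (Inf k))"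
      have fin: "finite D" using D by auto
      have ivl: "\<exists>u v. k = {u..v} \<and> u \<le> x \<and> x \<le> v \<and> a \<le> u \<and> v \<le> b" if "(x,k) \<in> D" for x k
      proof -
        obtain u v where "k = cbox u v" using D \<open>(x,k) \<in> D\<close> by blast
        then show ?thesis using tagged_division_ofD(2,3)[OF D that] by (auto)
      qed
      have eq: "(\<Sum>(x,k)\<in>D. measure lborel k *\<^sub>R g x) - (w b - w a) = (\<Sum>p\<in>D. ?h p)"
        using additive_tagged_division_1[OF ab, of D w] D by (simp add: case_prod_unfold sum_subtractf)
      define E where "E = {p \<in> D. fst p \<in> N}"
      have ED: "E \<subseteq> D" by (auto simp: E_def)
      have split: "(\<Sum>p\<in>D. ?h p) = sum ?h (D - E) + sum ?h E"
        using fin ED by (rule sum.subset_diff[rotated])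
      have "norm (sum ?h (D - E)) \<le> (\<Sum>(x,k)\<in>D - E. \<epsilon> * measure lborel k)"
      proof (rule sum_norm_le, clarify)
        fix x k assume xk: "(x,k) \<in> D" "(x,k) \<notin> E"
        obtain u v where uv: "k = {u..v}" "u \<le> x" "x \<le> v" "a \<le> u" "v \<le> b" using ivl[OF xk(1)] by blast
        have xN: "x \<in> {a..b} - N" using xk uv by (auto simp: E_def)
        have "k \<subseteq> ball x (d x)" using fine xk xN unfolding fine_def \<gamma>_def by fastforce
        moreover have "u \<in> k" "v \<in> k" using uv by auto
        ultimately have "u \<in> ball x (d x)" "v \<in> ball x (d x)" by blast+
        then have "norm (u - x) < d x" "norm (v - x) < d x" by (simp_all add: dist_norm norm_minus_commute)
        from this[THEN d(2)[OF xN]]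
        have 1: "norm (w u - w x - (u - x) *\<^sub>R f x) \<le> \<epsilon> * (x - u)"
          and 2: "norm (w v - w x - (v - x) *\<^sub>R f x) \<le> \<epsilon> * (v - x)" using uv by auto
        have "(v - u) *\<^sub>R f x - (w v - w u)
           = (w u - w x - (u - x) *\<^sub>R f x) - (w v - w x - (v - x) *\<^sub>R f x)"
          by (simp add: algebra_simps)
        also have "norm \<dots> \<le> \<epsilon> * (x - u) + \<epsilon> * (v - x)"
          by (rule order_trans[OF norm_triangle_ineq4 add_mono[OF 1 2]])
        finally show "norm (measure lborel k *\<^sub>R g x - (w (Sup k) - w (Inf k))) \<le> \<epsilon> * measure lborel k"
          using uv xN by (simp add: g_def algebra_simps)
      qed
      also have "\<dots> \<le> (\<Sum>(x,k)\<in>D. \<epsilon> * measure lborel k)"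
        using fin \<epsilon> by (intro sum_mono2) auto
      also have "\<dots> = \<epsilon> * (b - a)"
        using additive_content_tagged_division[OF D] ab
        by (simp add: case_prod_unfold flip: sum_distrib_left)
      finally have A: "norm (sum ?h (D - E)) < e / 2" using \<epsilon> by simp
      have Ep: "E tagged_division_of \<Union>(snd ` E)"
        by (rule tagged_partial_division_of_Union_self
            [OF tagged_partial_division_subset[OF D[unfolded tagged_division_of_def, THEN conjunct1] ED]])
      then have Ed: "snd ` E division_of \<Union>(snd ` E)" by (rule division_of_tagged_division)
      \<comment> \<open>The supremum and the infimum of the empty set are unspecified, hence the case distinction.\<close>
      define q where "q = (\<lambda>k. if k = {} then 0 else norm (w (Sup k) - w (Inf k)))"
      have ivlE: "\<exists>u v. k = {u..v} \<and> u \<le> v \<and> a \<le> u \<and> v \<le> b \<and> k \<subseteq> U" if k: "k \<in> snd ` E" for k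
      proof -
        obtain x where x: "(x,k) \<in> D" "x \<in> N" using k by (fastforce simp: E_def)
        then have "k \<subseteq> U" using fine unfolding fine_def \<gamma>_def by fastforce
        with ivl[OF x(1)] show ?thesis by fastforce
      qed
      have "norm (sum ?h E) \<le> (\<Sum>(x,k)\<in>E. q k)"
      proof (rule sum_norm_le, clarify)
        fix x k assume "(x,k) \<in> E"
        then have "x \<in> N" "k \<noteq> {}" using ivlE[of k] by (force simp: E_def)+
        then show "norm (measure lborel k *\<^sub>R g x - (w (Sup k) - w (Inf k))) \<le> q k"
          by (simp add: g_def q_def norm_minus_commute)
      qed
      also have "\<dots> = sum q (snd ` E)"
      proof (rule sum.over_tagged_division_lemma[OF Ep])
        fix u v :: real assume "box u v = {}"
        then have "v \<le> u" by simp
        then show "q (cbox u v) = 0" by (cases "u = v") (auto simp: q_def)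
      qed
      also have "\<dots> = (\<Sum>I\<in>snd ` E. norm (w (Sup I) - w (Inf I)))"
        by (rule sum.cong[OF refl]) (use ivlE in \<open>force simp: q_def\<close>)
      also have "\<dots> < e / 2"
      proof (rule small[OF Ed])
        show "\<Union>(snd ` E) \<subseteq> {a..b}" using ivlE by fastforce
        have "(\<Sum>I\<in>snd ` E. Sup I - Inf I) = (\<Sum>I\<in>snd ` E. measure lebesgue I)"
          by (rule sum.cong[OF refl]) (use ivlE in force)
        also have "\<dots> = measure lebesgue (\<Union>(snd ` E))" by (rule content_division[OF Ed])
        also have "\<dots> \<le> measure lebesgue U"
        proof (rule measure_mono_fmeasurable)
          show "\<Union>(snd ` E) \<subseteq> U" using ivlE by blast
          show "\<Union>(snd ` E) \<in> sets lebesgue"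
            using Ed ivlE by (intro sets.finite_Union) (force dest: division_of_finite)+
        qed (rule U)
        finally show "(\<Sum>I\<in>snd ` E. Sup I - Inf I) < \<delta>" using U by simp
      qed
      finally have "norm (sum ?h E) < e / 2" .
      with A have "norm (sum ?h (D - E) + sum ?h E) < e"
        by (intro norm_triangle_lt) linarith
      then show ?thesis unfolding eq split .
    qed
    show "\<exists>\<gamma>. gauge \<gamma> \<and> (\<forall>D. D tagged_division_of cbox a b \<and> \<gamma> fine D \<longrightarrow>
        norm ((\<Sum>(x,k)\<in>D. measure lborel k *\<^sub>R g x) - (w b - w a)) < e)"
      by (intro exI[of _ \<gamma>] conjI gauge allI impI; elim conjE) (rule riemann)
  qed
  then have "(g has_integral (w b - w a)) {a..b}" unfolding box_real .
  then show ?thesis by (rule has_integral_spike[OF N, rotated]) (simp add: g_def)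
qed

lemma abs_cont_on_subset:
  assumes "abs_cont_on a b w" "{c..d} \<subseteq> {a..b}"
  shows "abs_cont_on c d w"
  using assms unfolding abs_cont_on_def by (meson subset_trans)

lemma lipschitz_imp_abs_cont_on:
  assumes lip: "\<And>s t. s \<in> {a..b} \<Longrightarrow> t \<in> {a..b} \<Longrightarrow> norm (w t - w s) \<le> M * \<bar>t - s\<bar>"
  shows "abs_cont_on a b w"
  unfolding abs_cont_on_def
proof (intro allI impI)
  fix e :: real assume "e > 0"
  define \<delta> where "\<delta> = e / (\<bar>M\<bar> + 1)"
  have "(\<Sum>I\<in>D. norm (w (Sup I) - w (Inf I))) < e"
    if D: "D division_of \<Union>D" "\<Union>D \<subseteq> {a..b}" "(\<Sum>I\<in>D. Sup I - Inf I) < \<delta>" for D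
  proof -
    have ivl: "\<exists>u v. I = {u..v} \<and> u \<le> v \<and> a \<le> u \<and> v \<le> b" if "I \<in> D" for I
    proof -
      obtain u v where uv: "I = cbox u v" using D(1) \<open>I \<in> D\<close> by (meson division_ofD(4))
      moreover have "I \<noteq> {}" using D(1) that by (rule division_ofD(3))
      moreover have "I \<subseteq> {a..b}" using D(2) that by blast
      ultimately show ?thesis by auto
    qed
    have "(\<Sum>I\<in>D. norm (w (Sup I) - w (Inf I))) \<le> (\<Sum>I\<in>D. (\<bar>M\<bar> + 1) * (Sup I - Inf I))"
    proof (rule sum_mono)
      fix I assume "I \<in> D"
      then obtain u v where uv: "I = {u..v}" "u \<le> v" "a \<le> u" "v \<le> b" using ivl by blast
      then have "norm (w v - w u) \<le> M * \<bar>v - u\<bar>" by (intro lip) auto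
      also have "\<dots> \<le> (\<bar>M\<bar> + 1) * \<bar>v - u\<bar>" by (intro mult_right_mono) auto
      finally show "norm (w (Sup I) - w (Inf I)) \<le> (\<bar>M\<bar> + 1) * (Sup I - Inf I)" using uv by simp
    qed
    also have "\<dots> = (\<bar>M\<bar> + 1) * (\<Sum>I\<in>D. Sup I - Inf I)" by (simp only: sum_distrib_left)
    also have "\<dots> < e"
      using D(3) mult_strict_left_mono[OF D(3), of "\<bar>M\<bar> + 1"] by (simp add: \<delta>_def)
    finally show ?thesis .
  qed
  moreover have "\<delta> > 0" using \<open>e > 0\<close> by (simp add: \<delta>_def)
  ultimately show "\<exists>\<delta>>0. \<forall>D. D division_of \<Union>D \<and> \<Union>D \<subseteq> {a..b} \<and> (\<Sum>I\<in>D. Sup I - Inf I) < \<delta> \<longrightarrow>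
      (\<Sum>I\<in>D. norm (w (Sup I) - w (Inf I))) < e" by blast
qed

section \<open>Gronwall's inequality\<close>

text \<open>
  With \<open>U r\<close> the right-hand side of the assumption, \<open>U r exp (- \<Lambda> (r - s))\<close> has a nonpositive
  derivative.
\<close>

lemma gronwall_forward:
  fixes g :: "real \<Rightarrow> real"
  assumes cont: "continuous_on {s..t} g" and "0 \<le> \<Lambda>" and st: "s \<le> t"
    and le: "\<And>r. r \<in> {s..t} \<Longrightarrow> g r \<le> c + \<Lambda> * integral {s..r} g"
  shows "g t \<le> c * exp (\<Lambda> * (t - s))"
proof (cases "s = t")
  case True
  then show ?thesis using le[of t] by simp
next
  case False
  define U where "U = (\<lambda>r. c + \<Lambda> * integral {s..r} g)"
  define V where "V = (\<lambda>r. U r * exp (- (\<Lambda> * (r - s))))"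
  have "V t \<le> V s"
  proof (rule DERIV_nonpos_imp_decreasing_open[where f = V and a = s and b = t])
    fix r assume r: "s < r" "r < t"
    have "((\<lambda>u. integral {s..u} g) has_vector_derivative g r) (at r within {s..t})"
      using cont r by (intro integral_has_vector_derivative) auto
    then have "((\<lambda>u. integral {s..u} g) has_real_derivative g r) (at r)"
      using r at_within_interior[of r "{s..t}"] by (simp add: has_real_derivative_iff_has_vector_derivative)
    then have "(V has_real_derivative (\<Lambda> * g r) * exp (- (\<Lambda> * (r - s))) + (exp (- (\<Lambda> * (r - s))) * - \<Lambda>) * U r) (at r)"
      unfolding V_def U_def by (auto intro!: derivative_eq_intros)
    moreover have "(\<Lambda> * g r) * exp (- (\<Lambda> * (r - s))) + (exp (- (\<Lambda> * (r - s))) * - \<Lambda>) * U r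
        = \<Lambda> * exp (- (\<Lambda> * (r - s))) * (g r - U r)" by (simp add: algebra_simps)
    moreover have "\<dots> \<le> 0"
      using le[of r] r \<open>0 \<le> \<Lambda>\<close> by (intro mult_nonneg_nonpos) (auto simp: U_def)
    ultimately show "\<exists>y. (V has_real_derivative y) (at r) \<and> y \<le> 0" by metis
  next
    show "continuous_on {s..t} V"
      unfolding V_def U_def
      by (intro continuous_intros indefinite_integral_continuous_1 integrable_continuous_interval cont)
  qed (use False st in auto)
  then have "U t * exp (- (\<Lambda> * (t - s))) * exp (\<Lambda> * (t - s)) \<le> c * exp (\<Lambda> * (t - s))"
    by (intro mult_right_mono) (simp_all add: V_def U_def)
  then have "U t \<le> c * exp (\<Lambda> * (t - s))"
    by (simp add: mult.assoc flip: exp_add)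
  then show ?thesis using le[of t] st by (simp add: U_def)
qed

text \<open>
  Flows are followed forwards and backwards in time; the backward case is the forward one for the
  reflected function.
\<close>

lemma gronwall_between:
  fixes g :: "real \<Rightarrow> real"
  assumes cont: "continuous_on {min s t..max s t} g" and \<Lambda>: "0 \<le> \<Lambda>"
    and le: "\<And>r. r \<in> {min s t..max s t} \<Longrightarrow> g r \<le> c + \<Lambda> * integral {min s r..max s r} g"
  shows "g t \<le> c * exp (\<Lambda> * \<bar>t - s\<bar>)"
proof (cases "s \<le> t")
  case True
  then have "g t \<le> c * exp (\<Lambda> * (t - s))"
    using assms by (intro gronwall_forward) (auto simp: max_absorb2 min_absorb1)
  with True show ?thesis by simp
next
  case False
  have "g (- (- t)) \<le> c * exp (\<Lambda> * (- t - (- s)))"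
  proof (rule gronwall_forward[where g = "\<lambda>r. g (- r)"])
    show "continuous_on {- s..- t} (\<lambda>r. g (- r))"
      using False by (intro continuous_on_compose2[OF cont]) (auto intro!: continuous_intros)
    fix r assume r: "r \<in> {- s..- t}"
    have "g (- r) \<le> c + \<Lambda> * integral {min s (-r)..max s (-r)} g" using r False by (intro le) auto
    also have "{min s (-r)..max s (-r)} = {-r..s}" using r by auto
    also have "integral {-r..s} g = integral {-s..r} (\<lambda>r. g (- r))"
      using Henstock_Kurzweil_Integration.integral_reflect_real[of s "-r" g] by simp
    finally show "g (- r) \<le> c + \<Lambda> * integral {-s..r} (\<lambda>r. g (- r))" .
  qed (use False \<Lambda> in auto)
  with False show ?thesis by simp
qed

lemma integral_norm_bound_integral_ae:
  fixes f :: "real \<Rightarrow> 'a::euclidean_space"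
  assumes f: "f integrable_on {c..d}" and g: "g integrable_on {c..d}" and Z: "negligible Z"
    and le: "\<And>r. r \<in> {c<..<d} - Z \<Longrightarrow> norm (f r) \<le> g r"
  shows "norm (integral {c..d} f) \<le> integral {c..d} g"
proof -
  let ?Z = "Z \<union> {c,d}"
  have Z': "negligible ?Z" using Z by (simp add: negligible_Un)
  have 1: "integral {c..d} f = integral {c..d} (\<lambda>r. if r \<in> ?Z then 0 else f r)"
    by (rule integral_spike[OF Z']) auto
  have 2: "integral {c..d} g = integral {c..d} (\<lambda>r. if r \<in> ?Z then 0 else g r)"
    by (rule integral_spike[OF Z']) auto
  show ?thesis
    unfolding 1 2
  proof (rule Henstock_Kurzweil_Integration.integral_norm_bound_integral)
    show "(\<lambda>r. if r \<in> ?Z then 0 else f r) integrable_on {c..d}" by (rule integrable_spike[OF f Z']) simp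
    show "(\<lambda>r. if r \<in> ?Z then 0 else g r) integrable_on {c..d}" by (rule integrable_spike[OF g Z']) simp
  qed (use le in auto)
qed

lemma integral_increment:
  fixes f :: "real \<Rightarrow> 'a::euclidean_space"
  assumes "f integrable_on {a..b}" "a \<le> s" "s \<le> t" "t \<le> b"
  shows "integral {a..t} f - integral {a..s} f = integral {s..t} f"
  using Henstock_Kurzweil_Integration.integral_combine[of a s t f] assms integrable_subinterval_real[OF assms(1), of a t]
  by (simp add: algebra_simps)

lemma integral_increment_bound:
  fixes f :: "real \<Rightarrow> 'a::euclidean_space"
  assumes f: "f integrable_on {a..b}" and g: "g integrable_on {a..b}" and Z: "negligible Z"
    and le: "\<And>r. r \<in> {a<..<b} - Z \<Longrightarrow> norm (f r) \<le> g r"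
    and st: "s \<in> {a..b}" "t \<in> {a..b}"
  shows "norm (integral {a..t} f - integral {a..s} f) \<le> integral {min s t..max s t} g"
proof -
  have *: "norm (integral {c..d} f) \<le> integral {c..d} g" if "a \<le> c" "c \<le> d" "d \<le> b" for c d
    using that by (intro integral_norm_bound_integral_ae[OF _ _ Z] le
      integrable_subinterval_real[OF f] integrable_subinterval_real[OF g]) auto
  show ?thesis
  proof (cases "s \<le> t")
    case True
    then show ?thesis
      using st *[of s t] by (simp add: integral_increment[OF f] max_absorb2 min_absorb1)
  next
    case False
    then have "norm (integral {a..s} f - integral {a..t} f) \<le> integral {t..s} g"
      using st *[of t s] by (simp add: integral_increment[OF f])
    with False show ?thesis by (simp add: norm_minus_commute max_absorb1 min_absorb2)
  qed
qed

text \<open>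
  The form in which Gronwall's inequality is applied. Here \<open>E\<close> is a linear combination of solutions,
  \<open>g\<close> the corresponding combination of right-hand sides, and \<open>k\<close> the part of \<open>g\<close> that is not
  controlled by \<open>E\<close> itself. Differences of integrals from \<open>a\<close> serve as signed integrals from \<open>s\<close>,
  so that \<open>t\<close> may lie on either side of \<open>s\<close>.
\<close>

lemma gronwall_increment:
  fixes E g :: "real \<Rightarrow> 'a::euclidean_space"
  assumes E: "continuous_on {a..b} E" and g: "g integrable_on {a..b}"
    and k: "k integrable_on {a..b}" and k0: "\<And>r. r \<in> {a..b} \<Longrightarrow> 0 \<le> k r"
    and \<Lambda>: "0 \<le> \<Lambda>" and Z: "negligible Z" and st: "s \<in> {a..b}" "t \<in> {a..b}"
    and eq: "\<And>r. r \<in> {a..b} \<Longrightarrow> E r = e0 + (integral {a..r} g - integral {a..s} g)"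
    and le: "\<And>r. r \<in> {a<..<b} - Z \<Longrightarrow> norm (g r) \<le> \<Lambda> * norm (E r) + k r"
  shows "norm (E t) \<le> (norm e0 + integral {min s t..max s t} k) * exp (\<Lambda> * \<bar>t - s\<bar>)"
proof (rule gronwall_between[OF _ \<Lambda>])
  have sub: "{min s t..max s t} \<subseteq> {a..b}" using st by auto
  show "continuous_on {min s t..max s t} (\<lambda>r. norm (E r))"
    using sub by (intro continuous_intros continuous_on_subset[OF E])
  fix r assume r: "r \<in> {min s t..max s t}"
  let ?J = "{min s r..max s r}"
  have sub': "?J \<subseteq> {min s t..max s t}" "?J \<subseteq> {a..b}" and rab: "r \<in> {a..b}" using r st by auto
  have iE: "(\<lambda>r. norm (E r)) integrable_on {a..b}"
    by (intro integrable_continuous_interval continuous_intros E)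
  have "norm (E r) \<le> norm e0 + norm (integral {a..r} g - integral {a..s} g)"
    using eq[OF rab] norm_triangle_ineq by metis
  also have "norm (integral {a..r} g - integral {a..s} g) \<le> integral ?J (\<lambda>r. \<Lambda> * norm (E r) + k r)"
    by (rule integral_increment_bound[OF g _ Z le st(1) rab])
      (auto intro!: integrable_add integrable_on_mult_right iE k)
  also have "\<dots> = \<Lambda> * integral ?J (\<lambda>r. norm (E r)) + integral ?J k"
    using integrable_subinterval_real[OF iE sub'(2)] integrable_subinterval_real[OF k sub'(2)]
    by (subst integral_add) (auto intro!: integrable_on_mult_right)
  also have "integral ?J k \<le> integral {min s t..max s t} k"
    using sub' sub k0 by (intro integral_subset_le integrable_subinterval_real[OF k] ballI) blast+
  finally show "norm (E r) \<le> norm e0 + integral {min s t..max s t} k + \<Lambda> * integral ?J (\<lambda>r. norm (E r))"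
    by simp
qed

section \<open>Caratheodory equations with a Lipschitz right-hand side\<close>

text \<open>
  For a simple function \<open>x\<close> the composition is a countable choice between measurable functions; in
  general \<open>x\<close> is a pointwise limit of simple functions.
\<close>

lemma measurable_compose_continuous:
  fixes f :: "'c \<Rightarrow> 'a::{metric_space,second_countable_topology} \<Rightarrow> 'b::metric_space"
  assumes f: "\<And>x. (\<lambda>t. f t x) \<in> borel_measurable M" and x: "x \<in> borel_measurable M"
    and cont: "\<And>t. t \<in> space M \<Longrightarrow> continuous_on UNIV (f t)"
  shows "(\<lambda>t. f t (x t)) \<in> borel_measurable M"
proof -
  obtain F where F: "\<And>i. simple_function M (F i)" "\<And>t. t \<in> space M \<Longrightarrow> (\<lambda>i. F i t) \<longlonglongrightarrow> x t"
    using borel_measurable_implies_sequence_metric[OF x, of undefined] by blast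
  show ?thesis
  proof (rule borel_measurable_LIMSEQ_metric)
    fix i
    have fin: "finite (F i ` space M)" by (rule simple_functionD[OF F(1)])
    have "F i \<in> M \<rightarrow>\<^sub>M count_space (F i ` space M)"
      using fin simple_functionD(2)[OF F(1)] by (auto simp: measurable_count_space_eq2)
    from measurable_compose_countable'[OF f this] fin
    show "(\<lambda>t. f t (F i t)) \<in> borel_measurable M" by (simp add: countable_finite)
  next
    fix t assume t: "t \<in> space M"
    then show "(\<lambda>i. f t (F i t)) \<longlonglongrightarrow> f t (x t)"
      using continuous_on_tendsto_compose[OF cont[OF t] F(2)[OF t]] by simp
  qed
qed

text \<open>
  Controls and right-hand sides are only essentially bounded in time, which is why the pointwise
  conditions are required outside a negligible set of times. The bound at 0 and the Lipschitz
  condition together give linear growth.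
\<close>

definition caratheodory :: "real \<Rightarrow> real \<Rightarrow> real \<Rightarrow> (real \<Rightarrow> 'a::euclidean_space \<Rightarrow> 'a) \<Rightarrow> bool" where
  "caratheodory a b \<Lambda> f \<longleftrightarrow>
     (\<forall>x. (\<lambda>t. f t x) \<in> borel_measurable (lebesgue_on {a<..<b})) \<and>
     (\<exists>Z M. negligible Z \<and> (\<forall>t\<in>{a<..<b} - Z. norm (f t 0) \<le> M \<and>
        (\<forall>x y. norm (f t x - f t y) \<le> \<Lambda> * norm (x - y))))"

lemma caratheodory_lipschitz:
  assumes "caratheodory a b \<Lambda> f"
  obtains Z where "negligible Z"
    "\<And>t x y. t \<in> {a<..<b} - Z \<Longrightarrow> norm (f t x - f t y) \<le> \<Lambda> * norm (x - y)"
  using assms unfolding caratheodory_def by metis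

text \<open>
  On the bounded range of a continuous \<open>x\<close>, linear growth becomes a uniform bound.
\<close>

lemma caratheodory_compose:
  fixes f :: "real \<Rightarrow> 'a::euclidean_space \<Rightarrow> 'a"
  assumes f: "caratheodory a b \<Lambda> f" and x: "continuous_on {a..b} x"
  obtains M Z where "negligible Z" "\<And>t. t \<in> {a<..<b} - Z \<Longrightarrow> norm (f t (x t)) \<le> M"
    "(\<lambda>t. f t (x t)) integrable_on {a..b}"
proof -
  obtain Z M where Z: "negligible Z" and M: "\<And>t. t \<in> {a<..<b} - Z \<Longrightarrow> norm (f t 0) \<le> M"
    and lip: "\<And>t x y. t \<in> {a<..<b} - Z \<Longrightarrow> norm (f t x - f t y) \<le> \<Lambda> * norm (x - y)"
    using f unfolding caratheodory_def by metis
  obtain X where X: "\<And>t. t \<in> {a..b} \<Longrightarrow> norm (x t) \<le> X"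
    using compact_imp_bounded[OF compact_continuous_image[OF x compact_Icc]] unfolding bounded_iff by blast
  define S where "S = {a<..<b} - Z"
  have S: "S \<in> lmeasurable"
    unfolding S_def using Z by (intro fmeasurable.Diff) (auto simp: negligible_imp_measurable)
  have bound: "norm (f t (x t)) \<le> M + \<bar>\<Lambda>\<bar> * X" if "t \<in> S" for t
  proof -
    have "norm (f t (x t) - f t 0) \<le> \<Lambda> * norm (x t - 0)" using that by (intro lip) (simp add: S_def)
    also have "\<dots> \<le> \<bar>\<Lambda>\<bar> * X" using X[of t] that by (intro mult_mono) (auto simp: S_def)
    finally have "norm (f t (x t)) \<le> norm (f t 0) + \<bar>\<Lambda>\<bar> * X"
      using norm_triangle_sub[of "f t (x t)" "f t 0"] by linarith
    then show ?thesis using M[of t] that by (simp add: S_def)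
  qed
  have "(\<lambda>t. f t (x t)) \<in> borel_measurable (lebesgue_on S)"
  proof (rule measurable_compose_continuous[where f = f and x = x])
    show "(\<lambda>t. f t z) \<in> borel_measurable (lebesgue_on S)" for z
      by (rule measurable_restrict_mono[of _ _ "{a<..<b}"])
        (use f in \<open>auto simp: caratheodory_def S_def\<close>)
    show "x \<in> borel_measurable (lebesgue_on S)"
      by (rule continuous_imp_measurable_on_sets_lebesgue)
        (use S in \<open>auto intro: continuous_on_subset[OF x] simp: S_def\<close>)
    fix t assume "t \<in> space (lebesgue_on S)"
    then have "\<And>x y. norm (f t x - f t y) \<le> \<bar>\<Lambda>\<bar> * norm (x - y)"
      by (intro order_trans[OF lip]) (auto simp: S_def intro!: mult_right_mono)
    then show "continuous_on UNIV (f t)"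
      by (intro lipschitz_on_continuous_on[of "\<bar>\<Lambda>\<bar>"] lipschitz_onI) (auto simp: dist_norm)
  qed
  then have "(\<lambda>t. f t (x t)) integrable_on S"
    by (rule measurable_bounded_by_integrable_imp_integrable[where g = "\<lambda>_. M + \<bar>\<Lambda>\<bar> * X"])
      (use S bound in \<open>auto intro: integrable_on_const\<close>)
  then have "(\<lambda>t. f t (x t)) integrable_on {a..b}"
  proof (rule integrable_spike_set)
    show "negligible {t \<in> S - {a..b}. f t (x t) \<noteq> 0}" by (rule negligible_subset[of "{}"]) (auto simp: S_def)
    show "negligible {t \<in> {a..b} - S. f t (x t) \<noteq> 0}"
      by (rule negligible_subset[of "Z \<union> {a,b}"]) (use Z in \<open>auto simp: S_def negligible_Un\<close>)
  qed
  then show ?thesis using that[OF Z, of "M + \<bar>\<Lambda>\<bar> * X"] bound by (auto simp: S_def)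
qed

lemma caratheodory_integrable:
  assumes "caratheodory a b \<Lambda> f" "continuous_on {a..b} x"
  shows "(\<lambda>t. f t (x t)) integrable_on {a..b}"
  using assms by (rule caratheodory_compose)

definition integral_solution ::
  "real \<Rightarrow> real \<Rightarrow> (real \<Rightarrow> 'a::euclidean_space \<Rightarrow> 'a) \<Rightarrow> real \<Rightarrow> 'a \<Rightarrow> (real \<Rightarrow> 'a) \<Rightarrow> bool" where
  "integral_solution a b f s \<xi> x \<longleftrightarrow> continuous_on {a..b} x \<and>
     (\<forall>t\<in>{a..b}. x t = \<xi> + (integral {a..t} (\<lambda>r. f r (x r)) - integral {a..s} (\<lambda>r. f r (x r))))"

lemma ode_solution_imp_integral_solution:
  assumes f: "caratheodory a b \<Lambda> f" and s: "s \<in> {a..b}" and x: "ode_solution a b f s \<xi> x"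
  shows "integral_solution a b f s \<xi> x"
proof -
  obtain Z where Z: "negligible Z"
    "\<And>t. t \<in> {a<..<b} - Z \<Longrightarrow> (x has_vector_derivative f t (x t)) (at t)"
    using x unfolding ode_solution_def by (subst (asm) AE_lebesgue_on_iff_negligible) auto
  have I: "((\<lambda>r. f r (x r)) has_integral (x t - x a)) {a..t}" if "t \<in> {a..b}" for t
    by (rule abs_cont_on_has_integral[OF _ _ Z(1) Z(2)])
      (use that x in \<open>auto simp: ode_solution_def intro: abs_cont_on_subset\<close>)
  then have eq: "x t = x a + integral {a..t} (\<lambda>r. f r (x r))" if "t \<in> {a..b}" for t
    using integral_unique[OF I[OF that]] by simp
  have "(\<lambda>r. f r (x r)) integrable_on {a..b}" using I[of b] s by auto
  then have "continuous_on {a..b} (\<lambda>t. x a + integral {a..t} (\<lambda>r. f r (x r)))"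
    by (intro continuous_intros indefinite_integral_continuous_1)
  then have "continuous_on {a..b} x"
    by (rule continuous_on_eq) (rule eq[symmetric])
  moreover have "x t = \<xi> + (integral {a..t} (\<lambda>r. f r (x r)) - integral {a..s} (\<lambda>r. f r (x r)))"
    if "t \<in> {a..b}" for t
  proof -
    have "\<xi> = x a + integral {a..s} (\<lambda>r. f r (x r))"
      using eq[OF s] x unfolding ode_solution_def by argo
    then show ?thesis using eq[OF that] by (simp only: add_diff_eq) simp
  qed
  ultimately show ?thesis unfolding integral_solution_def by blast
qed

lemma integral_solution_imp_ode_solution:
  assumes f: "caratheodory a b \<Lambda> f" and s: "s \<in> {a..b}" and x: "integral_solution a b f s \<xi> x"
  shows "ode_solution a b f s \<xi> x"
proof -
  define F where "F = (\<lambda>r. f r (x r))"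
  have cont: "continuous_on {a..b} x"
    and eq: "\<And>t. t \<in> {a..b} \<Longrightarrow> x t = \<xi> + (integral {a..t} F - integral {a..s} F)"
    using x unfolding integral_solution_def F_def by blast+
  obtain M Z where Z: "negligible Z" and M': "\<And>t. t \<in> {a<..<b} - Z \<Longrightarrow> norm (f t (x t)) \<le> M"
    by (rule caratheodory_compose[OF f cont]) (rule that)
  then have M: "\<And>t. t \<in> {a<..<b} - Z \<Longrightarrow> norm (F t) \<le> M" by (simp add: F_def)
  have F: "F integrable_on {a..b}"
    unfolding F_def by (rule caratheodory_integrable[OF f cont])
  have "abs_cont_on a b x"
  proof (rule lipschitz_imp_abs_cont_on)
    fix p q assume pq: "p \<in> {a..b}" "q \<in> {a..b}"
    have "norm (x q - x p) = norm (integral {a..q} F - integral {a..p} F)"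
      unfolding eq[OF pq(1)] eq[OF pq(2)] by simp
    also have "\<dots> \<le> integral {min p q..max p q} (\<lambda>_. M)"
      by (rule integral_increment_bound[OF F _ Z M pq]) auto
    also have "\<dots> = (max p q - min p q) * M" by (subst integral_const_real) simp
    also have "max p q - min p q = \<bar>q - p\<bar>" by auto
    finally show "norm (x q - x p) \<le> M * \<bar>q - p\<bar>" by (simp add: mult.commute)
  qed
  moreover obtain Y where Y: "negligible Y"
    "\<And>t. t \<in> {a<..<b} - Y \<Longrightarrow> ((\<lambda>t. integral {a..t} F) has_vector_derivative F t) (at t)"
    using indefinite_integral_has_vector_derivative_ae[OF F] by blast
  have "(x has_vector_derivative F t) (at t)" if t: "t \<in> {a<..<b} - Y" for t
  proof (rule has_vector_derivative_transform_within_open[of _ _ _ "{a<..<b}"])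
    show "((\<lambda>t. (\<xi> - integral {a..s} F) + integral {a..t} F) has_vector_derivative F t) (at t)"
      using has_vector_derivative_add[OF has_vector_derivative_const Y(2)[OF t]] by simp
    show "(\<xi> - integral {a..s} F) + integral {a..t} F = x t" if "t \<in> {a<..<b}" for t
      using eq[of t] that by simp
  qed (use t in auto)
  then have "AE t in lebesgue_on {a<..<b}. (x has_vector_derivative F t) (at t)"
    using Y(1) by (subst AE_lebesgue_on_iff_negligible) auto
  ultimately show ?thesis using eq[OF s] by (simp add: ode_solution_def F_def)
qed

lemma integral_solution_unique:
  assumes f: "caratheodory a b \<Lambda> f" and s: "s \<in> {a..b}" and t: "t \<in> {a..b}"
    and x: "integral_solution a b f s \<xi> x" and y: "integral_solution a b f s \<xi> y"
  shows "x t = y t"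
proof -
  obtain Z where Z: "negligible Z"
    "\<And>t x y. t \<in> {a<..<b} - Z \<Longrightarrow> norm (f t x - f t y) \<le> \<Lambda> * norm (x - y)"
    using caratheodory_lipschitz[OF f] by blast
  have cx: "continuous_on {a..b} x" and cy: "continuous_on {a..b} y"
    using x y by (auto simp: integral_solution_def)
  note ix = caratheodory_integrable[OF f cx] and iy = caratheodory_integrable[OF f cy]
  have sub: "integral {a..r} (\<lambda>r. f r (x r) - f r (y r)) = integral {a..r} (\<lambda>r. f r (x r)) - integral {a..r} (\<lambda>r. f r (y r))"
    if "r \<in> {a..b}" for r
    using that by (intro Henstock_Kurzweil_Integration.integral_diff integrable_subinterval_real[OF ix] integrable_subinterval_real[OF iy]) auto
  have "norm (x t - y t) \<le> (norm (0::'a) + integral {min s t..max s t} (\<lambda>_. 0)) * exp (\<bar>\<Lambda>\<bar> * \<bar>t - s\<bar>)"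
  proof (rule gronwall_increment[where E = "\<lambda>r. x r - y r" and g = "\<lambda>r. f r (x r) - f r (y r)", OF _ _ _ _ _ Z(1) s t])
    show "x r - y r = 0 + (integral {a..r} (\<lambda>r. f r (x r) - f r (y r)) - integral {a..s} (\<lambda>r. f r (x r) - f r (y r)))"
      if r: "r \<in> {a..b}" for r
    proof -
      have "x r = \<xi> + (integral {a..r} (\<lambda>r. f r (x r)) - integral {a..s} (\<lambda>r. f r (x r)))"
        "y r = \<xi> + (integral {a..r} (\<lambda>r. f r (y r)) - integral {a..s} (\<lambda>r. f r (y r)))"
        using x y r by (auto simp: integral_solution_def)
      then show ?thesis unfolding sub[OF r] sub[OF s] by (simp only: add_diff_cancel_left diff_diff_eq) simp
    qed
    show "norm (f r (x r) - f r (y r)) \<le> \<bar>\<Lambda>\<bar> * norm (x r - y r) + 0" if "r \<in> {a<..<b} - Z" for r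
      using Z(2)[OF that, of "x r" "y r"] mult_right_mono[OF abs_ge_self[of \<Lambda>], of "norm (x r - y r)"] by simp
    show "continuous_on {a..b} (\<lambda>r. x r - y r)" by (intro continuous_intros cx cy)
    show "(\<lambda>r. f r (x r) - f r (y r)) integrable_on {a..b}" by (intro integrable_diff ix iy)
  qed auto
  then show ?thesis by simp
qed

text \<open>
  The weight \<open>exp (2 l \<bar>r - s\<bar>)\<close> of the following existence proof grows so fast that integrating
  \<open>l\<close> times it gains a factor of one half.
\<close>

lemma integral_exp_abs:
  fixes l :: real
  assumes "0 < l"
  shows "integral {min s t..max s t} (\<lambda>r. l * exp (2 * l * \<bar>r - s\<bar>)) = (exp (2 * l * \<bar>t - s\<bar>) - 1) / 2"
proof (cases "s \<le> t")
  case True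
  have "((\<lambda>r. l * exp (2 * l * (r - s))) has_integral exp (2 * l * (t - s)) / 2 - exp (2 * l * (s - s)) / 2) {s..t}"
    using assms by (intro fundamental_theorem_of_calculus[OF True])
      (auto intro!: derivative_eq_intros simp flip: has_real_derivative_iff_has_vector_derivative)
  then have "((\<lambda>r. l * exp (2 * l * \<bar>r - s\<bar>)) has_integral exp (2 * l * (t - s)) / 2 - exp (2 * l * (s - s)) / 2) {s..t}"
    by (rule has_integral_eq[rotated]) auto
  from integral_unique[OF this] True show ?thesis
    by (simp add: min_absorb1 max_absorb2 diff_divide_distrib)
next
  case False
  then have ts: "t \<le> s" by simp
  have "((\<lambda>r. l * exp (2 * l * (s - r))) has_integral (- (exp (2 * l * (s - s)) / 2) - - (exp (2 * l * (s - t)) / 2))) {t..s}"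
    using assms by (intro fundamental_theorem_of_calculus[OF ts])
      (auto intro!: derivative_eq_intros simp flip: has_real_derivative_iff_has_vector_derivative)
  then have "((\<lambda>r. l * exp (2 * l * \<bar>r - s\<bar>)) has_integral (- (exp (2 * l * (s - s)) / 2) - - (exp (2 * l * (s - t)) / 2))) {t..s}"
    by (rule has_integral_eq[rotated]) auto
  from integral_unique[OF this] False show ?thesis
    by (simp add: min_absorb2 max_absorb1 diff_divide_distrib)
qed

text \<open>
  Banach's fixed point theorem for \<open>y t = x t exp (- 2 l \<bar>t - s\<bar>)\<close> instead of \<open>x\<close>. In the
  weighted supremum norm the Picard operator contracts with factor \<open>1/2\<close> on the whole interval, so
  no gluing of short time intervals is necessary.
\<close>

lemma integral_solution_exists:
  fixes f :: "real \<Rightarrow> 'a::euclidean_space \<Rightarrow> 'a"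
  assumes f: "caratheodory a b \<Lambda> f" and s: "s \<in> {a..b}"
  obtains x where "integral_solution a b f s \<xi> x"
proof -
  define l where "l = \<bar>\<Lambda>\<bar> + 1"
  have l: "l > 0" by (simp add: l_def)
  obtain Z where Z: "negligible Z"
    and lip: "\<And>t x y. t \<in> {a<..<b} - Z \<Longrightarrow> norm (f t x - f t y) \<le> \<Lambda> * norm (x - y)"
    using caratheodory_lipschitz[OF f] by blast
  \<comment> \<open>Bounded continuous functions live on the whole line; functions on \<open>{a..b}\<close> are extended by
      clamping the argument.\<close>
  define c where "c = (\<lambda>t. max a (min b t))"
  have c: "c t \<in> {a..b}" "t \<in> {a..b} \<Longrightarrow> c t = t" for t using s by (auto simp: c_def)
  define wt where "wt = (\<lambda>r. exp (2 * l * \<bar>r - s\<bar>))"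
  have wt: "continuous_on A wt" "wt r > 0" for A r unfolding wt_def by (auto intro!: continuous_intros)
  define h where "h = (\<lambda>(y :: real \<Rightarrow>\<^sub>C 'a) r. f r (wt r *\<^sub>R apply_bcontfun y r))"
  have h: "h y integrable_on {a..b}" for y
    unfolding h_def by (rule caratheodory_integrable[OF f]) (intro continuous_intros wt continuous_on_apply_bcontfun)
  define I where "I = (\<lambda>y t. integral {a..t} (h y))"
  have contI: "continuous_on {a..b} (I y)" for y
    unfolding I_def by (rule indefinite_integral_continuous_1[OF h])
  define q where "q = (\<lambda>y t. inverse (wt t) *\<^sub>R (\<xi> + (I y t - I y s)))"
  have contq: "continuous_on {a..b} (q y)" for y
    unfolding q_def using wt(2) by (intro continuous_intros contI wt(1)) (simp add: less_imp_neq[symmetric])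
  have qc: "(\<lambda>t. q y (c t)) \<in> bcontfun" for y
    unfolding bcontfun_def
  proof (intro CollectI conjI)
    show "continuous_on UNIV (\<lambda>t. q y (c t))"
      by (rule continuous_on_compose2[OF contq]) (use c(1) in \<open>auto simp: c_def intro!: continuous_intros\<close>)
    have "range (\<lambda>t. q y (c t)) \<subseteq> q y ` {a..b}" using c(1) by blast
    then show "bounded (range (\<lambda>t. q y (c t)))"
      using bounded_subset compact_imp_bounded[OF compact_continuous_image[OF contq compact_Icc]] by blast
  qed
  define G where "G = (\<lambda>y. Bcontfun (\<lambda>t. q y (c t)))"
  have G: "apply_bcontfun (G y) t = q y (c t)" for y t
    unfolding G_def by (simp add: Bcontfun_inverse[OF qc])
  have "dist (G y) (G z) \<le> 1/2 * dist y z" for y z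
  proof (rule dist_bound)
    fix t
    define \<tau> where "\<tau> = c t"
    have \<tau>: "\<tau> \<in> {a..b}" using c by (simp add: \<tau>_def)
    have "norm (h y r - h z r) \<le> l * wt r * dist y z" if "r \<in> {a<..<b} - Z" for r
    proof -
      have "norm (h y r - h z r) \<le> \<Lambda> * norm (wt r *\<^sub>R apply_bcontfun y r - wt r *\<^sub>R apply_bcontfun z r)"
        unfolding h_def by (rule lip[OF that])
      also have "\<dots> = \<Lambda> * (wt r * dist (apply_bcontfun y r) (apply_bcontfun z r))"
        using wt(2)[of r] by (simp add: dist_norm flip: scaleR_diff_right)
      also have "\<dots> \<le> l * (wt r * dist y z)"
        using wt(2)[of r] by (intro mult_mono mult_left_mono dist_bounded) (auto simp: l_def)
      finally show ?thesis by simp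
    qed
    then have "norm (integral {a..\<tau>} (\<lambda>r. h y r - h z r) - integral {a..s} (\<lambda>r. h y r - h z r))
        \<le> integral {min s \<tau>..max s \<tau>} (\<lambda>r. l * wt r * dist y z)"
      by (intro integral_increment_bound[OF _ _ Z _ s \<tau>] integrable_diff h integrable_continuous_interval
          continuous_intros wt) auto
    also have "\<dots> = integral {min s \<tau>..max s \<tau>} (\<lambda>r. l * wt r) * dist y z"
      by simp
    also have "integral {min s \<tau>..max s \<tau>} (\<lambda>r. l * wt r) = (wt \<tau> - 1) / 2"
      unfolding wt_def by (rule integral_exp_abs[OF l])
    also have "(wt \<tau> - 1) / 2 * dist y z \<le> wt \<tau> * (1/2 * dist y z)"
      using zero_le_dist[of y z] by (simp add: field_simps)
    finally have *: "norm (integral {a..\<tau>} (\<lambda>r. h y r - h z r) - integral {a..s} (\<lambda>r. h y r - h z r))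
        \<le> wt \<tau> * (1/2 * dist y z)" .
    have sub: "integral {a..r} (\<lambda>r. h y r - h z r) = I y r - I z r" if "r \<in> {a..b}" for r
      unfolding I_def using that
      by (intro Henstock_Kurzweil_Integration.integral_diff integrable_subinterval_real[OF h]) auto
    have "q y \<tau> - q z \<tau> = inverse (wt \<tau>) *\<^sub>R (integral {a..\<tau>} (\<lambda>r. h y r - h z r) - integral {a..s} (\<lambda>r. h y r - h z r))"
      unfolding sub[OF \<tau>] sub[OF s] q_def by (simp add: algebra_simps)
    then have "norm (q y \<tau> - q z \<tau>) \<le> inverse (wt \<tau>) * (wt \<tau> * (1/2 * dist y z))"
      using * wt(2)[of \<tau>] by (simp add: mult_left_mono)
    also have "\<dots> = 1/2 * dist y z" using wt(2)[of \<tau>] by (simp add: field_simps)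
    finally show "dist (apply_bcontfun (G y) t) (apply_bcontfun (G z) t) \<le> 1/2 * dist y z"
      unfolding G \<tau>_def[symmetric] by (simp add: dist_norm)
  qed
  then obtain y where y: "G y = y"
    using banach_fix_type[of "1/2" G] by auto
  define x where "x = (\<lambda>t. wt t *\<^sub>R apply_bcontfun y t)"
  have hx: "h y = (\<lambda>r. f r (x r))" by (simp add: h_def x_def)
  show thesis
  proof (rule that[of x], unfold integral_solution_def, intro conjI ballI)
    show "continuous_on {a..b} x" unfolding x_def by (intro continuous_intros wt continuous_on_apply_bcontfun)
    fix t assume t: "t \<in> {a..b}"
    have "apply_bcontfun y t = q y t" using G[of y t] c(2)[OF t] by (simp add: y)
    then have "x t = \<xi> + (I y t - I y s)" using wt(2)[of t] by (simp add: x_def q_def)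
    then show "x t = \<xi> + (integral {a..t} (\<lambda>r. f r (x r)) - integral {a..s} (\<lambda>r. f r (x r)))"
      by (simp add: I_def hx)
  qed
qed

lemma ode_flow_eq:
  assumes f: "caratheodory a b \<Lambda> f" and s: "s \<in> {a..b}" and t: "t \<in> {a..b}"
    and x: "integral_solution a b f s \<xi> x"
  shows "ode_flow a b f s t \<xi> = x t"
  unfolding ode_flow_def
proof (rule the_equality)
  show "\<exists>y. ode_solution a b f s \<xi> y \<and> y t = x t"
    using integral_solution_imp_ode_solution[OF f s x] by blast
  show "z = x t" if "\<exists>y. ode_solution a b f s \<xi> y \<and> y t = z" for z
    using that integral_solution_unique[OF f s t _ x] ode_solution_imp_integral_solution[OF f s] by blast
qed

lemma integral_solution_ode_flow:
  assumes f: "caratheodory a b \<Lambda> f" and s: "s \<in> {a..b}"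
  shows "integral_solution a b f s \<xi> (\<lambda>t. ode_flow a b f s t \<xi>)"
proof -
  obtain x where x: "integral_solution a b f s \<xi> x"
    using integral_solution_exists[OF f s] by blast
  have eq: "ode_flow a b f s t \<xi> = x t" if "t \<in> {a..b}" for t
    by (rule ode_flow_eq[OF f s that x])
  have int: "integral {a..t} (\<lambda>r. f r (ode_flow a b f s r \<xi>)) = integral {a..t} (\<lambda>r. f r (x r))"
    if "t \<in> {a..b}" for t
    by (rule integral_cong) (use that eq in auto)
  have "continuous_on {a..b} (\<lambda>t. ode_flow a b f s t \<xi>)"
    by (rule continuous_on_eq[of _ x]) (use x eq in \<open>auto simp: integral_solution_def\<close>)
  then show ?thesis
    using x unfolding integral_solution_def by (simp add: eq int s[unfolded atLeastAtMost_iff])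
qed

section \<open>Differentiability from second differences\<close>

text \<open>
  The defect \<open>k r = g (r h) - r g h\<close> is additive and vanishes at the integers. So \<open>n k r\<close> equals
  \<open>k\<close> at the fractional part of \<open>n r\<close>, which is bounded uniformly in \<open>n\<close>.
\<close>

lemma additive_bounded_imp_linear:
  fixes g :: "'a::real_normed_vector \<Rightarrow> 'b::real_normed_vector"
  assumes add: "\<And>x y. g (x + y) = g x + g y" and bound: "\<And>x. norm (g x) \<le> M * norm x"
  shows "linear g"
proof (rule linearI)
  fix r :: real and h :: 'a
  define k where "k = (\<lambda>r. g (r *\<^sub>R h) - r *\<^sub>R g h)"
  define c where "c = M * norm h + norm (g h)"
  have k_add: "k (p + q) = k p + k q" for p q
    by (simp add: k_def scaleR_left_distrib add)
  have k_nat: "k (real n * p) = real n *\<^sub>R k p" for n p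
  proof (induction n)
    case 0
    then show ?case using k_add[of 0 0] by simp
  next
    case (Suc n)
    then show ?case by (simp add: k_add scaleR_left_distrib algebra_simps)
  qed
  have k_minus: "k (- p) = - k p" for p
    using k_add[of p "- p"] k_nat[of 0] by (simp add: eq_neg_iff_add_eq_0 add.commute)
  have k1: "k 1 = 0" by (simp add: k_def)
  have k_int: "k (of_int m) = 0" for m
  proof (cases m)
    case (nonneg n)
    then show ?thesis using k_nat[of n 1] k1 by simp
  next
    case (neg n)
    then have "k (of_int m) = - k (real (Suc n))" using k_minus[of "real (Suc n)"] by simp
    then show ?thesis using k_nat[of "Suc n" 1] k1 by simp
  qed
  have k_bound: "norm (k p) \<le> c" if "0 \<le> p" "p \<le> 1" for p
  proof -
    have "norm (k p) \<le> norm (g (p *\<^sub>R h)) + norm (p *\<^sub>R g h)"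
      unfolding k_def by (rule norm_triangle_ineq4)
    also have "\<dots> \<le> p * (M * norm h) + p * norm (g h)"
      using bound[of "p *\<^sub>R h"] that by (simp add: mult.left_commute)
    also have "\<dots> = p * c" by (simp add: c_def algebra_simps)
    also have "0 \<le> c"
      using order_trans[OF norm_ge_zero bound[of h]] by (simp add: c_def)
    then have "p * c \<le> c" using that by (simp add: mult_left_le_one_le)
    finally show ?thesis .
  qed
  have "real n * norm (k r) \<le> c" for n
  proof -
    define m where "m = \<lfloor>real n * r\<rfloor>"
    have "k (real n * r) = k (real n * r - of_int m) + k (of_int m)"
      by (simp flip: k_add)
    then have "real n *\<^sub>R k r = k (real n * r - of_int m)" by (simp add: k_nat k_int)
    then have "norm (real n *\<^sub>R k r) \<le> c"
      using k_bound[of "real n * r - of_int m"] unfolding m_def by (simp; linarith)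
    then show ?thesis by simp
  qed
  then have "norm (k r) = 0"
    by (metis norm_ge_zero less_eq_real_def not_less reals_Archimedean3)
  then show "g (r *\<^sub>R h) = r *\<^sub>R g h" by (simp add: k_def)
qed (rule add)

lemma geometric_increments_convergent:
  fixes s :: "nat \<Rightarrow> 'a::banach"
  assumes "\<And>n. norm (s (Suc n) - s n) \<le> c * (1/2) ^ n"
  obtains l where "s \<longlonglongrightarrow> l" "norm (l - s 0) \<le> 2 * c"
proof -
  have geo: "(\<lambda>n. c * (1/2) ^ n) sums (c * 2)"
    using sums_mult[OF geometric_sums[of "1/2 :: real"], of c] by simp
  have sm: "summable (\<lambda>n. s (Suc n) - s n)"
    by (rule summable_comparison_test'[OF sums_summable[OF geo]]) (rule assms)
  have "(\<lambda>n. (\<Sum>i<n. s (Suc i) - s i) + s 0) \<longlonglongrightarrow> (\<Sum>i. s (Suc i) - s i) + s 0"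
    by (intro tendsto_intros summable_LIMSEQ sm)
  then have "s \<longlonglongrightarrow> (\<Sum>i. s (Suc i) - s i) + s 0" by (simp add: sum_lessThan_telescope)
  moreover have "norm (\<Sum>i. s (Suc i) - s i) \<le> (\<Sum>n. c * (1/2) ^ n)"
    by (rule norm_suminf_le[OF assms sums_summable[OF geo]])
  ultimately show ?thesis
    using that[of "(\<Sum>i. s (Suc i) - s i) + s 0"] sums_unique[OF geo] by (simp add: mult.commute)
qed

text \<open>
  Write \<open>\<delta> x h = f (x + h) - f x\<close>. The assumption says that \<open>\<delta> x\<close> is additive up to
  \<open>K \<bar>h\<bar> \<bar>k\<bar>\<close>. Hence \<open>2\<^sup>n \<delta> x (h / 2\<^sup>n)\<close> converges geometrically, the limit \<open>D x h\<close> differs from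
  \<open>\<delta> x h\<close> by \<open>O(\<bar>h\<bar>\<^sup>2)\<close>, and the defect of additivity disappears in the limit. The bounds on \<open>D\<close>
  are inherited from \<open>\<delta>\<close>.
\<close>

lemma second_differences_imp_derivative:
  fixes f :: "'a::real_normed_vector \<Rightarrow> 'b::banach"
  assumes lip: "\<And>x h. norm (f (x + h) - f x) \<le> M * norm h"
    and second: "\<And>x y h. norm ((f (x + h) - f x) - (f (y + h) - f y)) \<le> K * norm h * norm (x - y)"
  obtains D where "\<And>x. (f has_derivative D x) (at x)" "\<And>x h. norm (D x h) \<le> M * norm h"
    "\<And>x y h. norm (D x h - D y h) \<le> K * norm h * norm (x - y)"
proof -
  define \<delta> where "\<delta> = (\<lambda>x h. f (x + h) - f x)"
  define s where "s = (\<lambda>x h n. 2 ^ n *\<^sub>R \<delta> x (h /\<^sub>R 2 ^ n))"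
  have defect: "norm (\<delta> x (h + k) - \<delta> x h - \<delta> x k) \<le> K * norm h * norm k" for x h k
    using second[of "x + h" k x] by (simp add: \<delta>_def algebra_simps)
  have incr: "norm (s x h (Suc n) - s x h n) \<le> (K * norm h ^ 2 / 4) * (1/2) ^ n" for x h n
  proof -
    define k where "k = h /\<^sub>R 2 ^ Suc n"
    have kk: "h /\<^sub>R 2 ^ n = k + k" by (simp add: k_def flip: scaleR_left_distrib)
    have "s x h (Suc n) - s x h n = - (2 ^ n *\<^sub>R (\<delta> x (k + k) - \<delta> x k - \<delta> x k))"
      unfolding s_def kk k_def[symmetric] by (simp add: algebra_simps scaleR_2 flip: scaleR_scaleR)
    then have "norm (s x h (Suc n) - s x h n) = 2 ^ n * norm (\<delta> x (k + k) - \<delta> x k - \<delta> x k)"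
      by (simp del: minus_diff_eq)
    also have "\<dots> \<le> 2 ^ n * (K * norm k * norm k)" by (intro mult_left_mono defect) simp
    also have "\<dots> = (K * norm h ^ 2 / 4) * (1/2) ^ n"
      by (simp add: k_def power2_eq_square field_simps power_add)
    finally show ?thesis .
  qed
  have "\<exists>l. s x h \<longlonglongrightarrow> l \<and> norm (l - s x h 0) \<le> 2 * (K * norm h ^ 2 / 4)" for x h
    using geometric_increments_convergent[OF incr[of x h]] by metis
  then obtain D where D: "\<And>x h. s x h \<longlonglongrightarrow> D x h"
    and D0: "\<And>x h. norm (D x h - s x h 0) \<le> 2 * (K * norm h ^ 2 / 4)" by metis
  have bound: "norm (D x h) \<le> M * norm h" for x h
  proof (rule Lim_norm_ubound[OF _ D])
    have "norm (s x h n) \<le> M * norm h" for n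
    proof -
      have "norm (s x h n) = 2 ^ n * norm (f (x + h /\<^sub>R 2 ^ n) - f x)" unfolding s_def \<delta>_def by simp
      also have "\<dots> \<le> 2 ^ n * (M * norm (h /\<^sub>R 2 ^ n))" by (intro mult_left_mono lip) simp
      finally have "norm (s x h n) \<le> 2 ^ n * (M * norm (h /\<^sub>R 2 ^ n))" .
      then show ?thesis by (simp add: field_simps)
    qed
    then show "\<forall>\<^sub>F n in sequentially. norm (s x h n) \<le> M * norm h" by simp
  qed simp
  have D_lip: "norm (D x h - D y h) \<le> K * norm h * norm (x - y)" for x y h
  proof (rule Lim_norm_ubound[OF _ tendsto_diff[OF D D]])
    have "norm (s x h n - s y h n) \<le> K * norm h * norm (x - y)" for n
    proof -
      have "norm (s x h n - s y h n) = 2 ^ n * norm (\<delta> x (h /\<^sub>R 2 ^ n) - \<delta> y (h /\<^sub>R 2 ^ n))"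
        unfolding s_def by (simp flip: scaleR_diff_right)
      also have "\<dots> \<le> 2 ^ n * (K * norm (h /\<^sub>R 2 ^ n) * norm (x - y))"
        unfolding \<delta>_def by (intro mult_left_mono second) simp
      finally show ?thesis by (simp add: field_simps)
    qed
    then show "\<forall>\<^sub>F n in sequentially. norm (s x h n - s y h n) \<le> K * norm h * norm (x - y)" by simp
  qed simp
  have D_add: "D x (h + k) = D x h + D x k" for x h k
  proof -
    have "(\<lambda>n. s x (h + k) n - s x h n - s x k n) \<longlonglongrightarrow> D x (h + k) - D x h - D x k"
      by (intro tendsto_intros D)
    moreover have "(\<lambda>n. s x (h + k) n - s x h n - s x k n) \<longlonglongrightarrow> 0"
    proof (rule Lim_null_comparison)
      have "norm (s x (h + k) n - s x h n - s x k n) \<le> K * norm h * norm k * (1/2) ^ n" for n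
      proof -
        have "s x (h + k) n - s x h n - s x k n =
            2 ^ n *\<^sub>R (\<delta> x (h /\<^sub>R 2 ^ n + k /\<^sub>R 2 ^ n) - \<delta> x (h /\<^sub>R 2 ^ n) - \<delta> x (k /\<^sub>R 2 ^ n))"
          unfolding s_def by (simp add: scaleR_diff_right scaleR_right_distrib)
        then have "norm (s x (h + k) n - s x h n - s x k n)
            \<le> 2 ^ n * (K * norm (h /\<^sub>R 2 ^ n) * norm (k /\<^sub>R 2 ^ n))"
          using mult_left_mono[OF defect[of x "h /\<^sub>R 2 ^ n" "k /\<^sub>R 2 ^ n"], of "2 ^ n"] by (simp only: norm_scaleR) simp
        then show ?thesis by (simp add: field_simps)
      qed
      then show "\<forall>\<^sub>F n in sequentially. norm (s x (h + k) n - s x h n - s x k n) \<le> K * norm h * norm k * (1/2) ^ n"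
        by simp
      show "(\<lambda>n. K * norm h * norm k * (1/2) ^ n) \<longlonglongrightarrow> 0"
        by (rule tendsto_mult_right_zero) (rule LIMSEQ_power_zero, simp)
    qed
    ultimately have "D x (h + k) - D x h - D x k = 0" by (rule LIMSEQ_unique)
    then show ?thesis by (simp add: algebra_simps)
  qed
  have "(f has_derivative D x) (at x)" for x
    unfolding has_derivative_at_alt
  proof (intro conjI allI impI)
    show "bounded_linear (D x)"
      using additive_bounded_imp_linear[of "D x", OF D_add bound] bound[of x]
      by (intro bounded_linear.intro bounded_linear_axioms.intro) (auto simp: mult.commute)
    fix e :: real assume "e > 0"
    define d where "d = e / (\<bar>K\<bar> + 1)"
    have "norm (f y - f x - D x (y - x)) \<le> e * norm (y - x)" if "norm (y - x) < d" for y
    proof -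
      have "norm (f y - f x - D x (y - x)) \<le> (K * norm (y - x) / 2) * norm (y - x)"
        using D0[of x "y - x"] by (simp add: s_def \<delta>_def norm_minus_commute power2_eq_square)
      also have "K * norm (y - x) / 2 \<le> (\<bar>K\<bar> + 1) * d"
      proof -
        have "K * norm (y - x) \<le> (\<bar>K\<bar> + 1) * norm (y - x)" by (intro mult_right_mono) auto
        also have "\<dots> \<le> (\<bar>K\<bar> + 1) * d" using that by (intro mult_left_mono) auto
        finally have "K * norm (y - x) \<le> (\<bar>K\<bar> + 1) * d" .
        moreover have "0 \<le> (\<bar>K\<bar> + 1) * d" using \<open>e > 0\<close> by (simp add: d_def)
        ultimately show ?thesis by linarith
      qed
      also have "(\<bar>K\<bar> + 1) * d = e" by (simp add: d_def)
      finally show ?thesis by (simp add: mult_right_mono)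
    qed
    moreover have "d > 0" using \<open>e > 0\<close> by (simp add: d_def)
    ultimately show "\<exists>d>0. \<forall>y. norm (y - x) < d \<longrightarrow> norm (f y - f x - D x (y - x)) \<le> e * norm (y - x)"
      by blast
  qed
  then show thesis using that bound D_lip by blast
qed

lemma fderiv_has_derivative:
  assumes "f differentiable (at x)"
  shows "(f has_derivative blinfun_apply (fderiv f x)) (at x)"
proof -
  have "(f has_derivative frechet_derivative f (at x)) (at x)"
    using assms frechet_derivative_works by blast
  then show ?thesis
    unfolding fderiv_def by (subst bounded_linear_Blinfun_apply) (auto dest: has_derivative_bounded_linear)
qed

lemma fderiv_bound_imp_lipschitz:
  fixes f :: "'a::real_normed_vector \<Rightarrow> 'b::real_normed_vector"
  assumes "\<And>x. f differentiable (at x)" "\<And>x. norm (fderiv f x) \<le> L"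
  shows "norm (f x - f y) \<le> L * norm (x - y)"
proof (rule differentiable_bound[of UNIV])
  show "(f has_derivative blinfun_apply (fderiv f z)) (at z within UNIV)" for z
    using fderiv_has_derivative[OF assms(1)] by simp
  show "onorm (blinfun_apply (fderiv f z)) \<le> L" for z
    using assms(2)[of z] by (simp add: norm_blinfun.rep_eq)
qed auto

text \<open>
  The difference is split at \<open>x + (y' - y)\<close>. The first part compares two points directly; with
  \<open>k = y' - y\<close>, the second one is an increment of \<open>z \<mapsto> f (z + k) - f z\<close>, whose derivative is bounded
  by \<open>\<Lambda>2 \<bar>k\<bar>\<close>.
\<close>

lemma C2_second_difference:
  fixes f :: "'a::real_normed_vector \<Rightarrow> 'b::real_normed_vector"
  assumes C2: "C2 f" and b1: "\<And>x. norm (fderiv f x) \<le> \<Lambda>1" and b2: "\<And>x. norm (fderiv (fderiv f) x) \<le> \<Lambda>2"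
  shows "norm ((f x' - f x) - (f y' - f y))
    \<le> \<Lambda>1 * norm ((x' - x) - (y' - y)) + \<Lambda>2 * norm (y' - y) * norm (x - y)"
proof -
  have d: "f differentiable (at x)" "fderiv f differentiable (at x)" for x
    using C2 by (auto simp: C2_def C1_def)
  define k where "k = y' - y"
  have "norm ((f (x + k) - f x) - (f (y + k) - f y)) \<le> (\<Lambda>2 * norm k) * norm (x - y)"
  proof (rule differentiable_bound[of UNIV])
    show "((\<lambda>z. f (z + k) - f z) has_derivative blinfun_apply (fderiv f (z + k) - fderiv f z)) (at z within UNIV)" for z
    proof -
      have "((\<lambda>z. f (z + k)) has_derivative (\<lambda>h. fderiv f (z + k) h)) (at z)"
        by (rule has_derivative_compose[where f = "\<lambda>z. z + k" and f' = "\<lambda>h. h"])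
          (auto intro!: derivative_eq_intros fderiv_has_derivative d)
      from has_derivative_diff[OF this fderiv_has_derivative[OF d(1)]] show ?thesis
        unfolding minus_blinfun.rep_eq .
    qed
    show "onorm (blinfun_apply (fderiv f (z + k) - fderiv f z)) \<le> \<Lambda>2 * norm k" for z
      using fderiv_bound_imp_lipschitz[OF d(2) b2, of "z + k" z] by (simp add: norm_blinfun.rep_eq)
  qed auto
  moreover have "norm (f x' - f (x + k)) \<le> \<Lambda>1 * norm (x' - (x + k))"
    by (rule fderiv_bound_imp_lipschitz[OF d(1) b1])
  moreover have "(f x' - f x) - (f y' - f y) = (f x' - f (x + k)) + ((f (x + k) - f x) - (f (y + k) - f y))"
    by (simp add: k_def)
  ultimately show ?thesis
    by (metis (no_types, lifting) add_mono norm_triangle_le diff_diff_eq k_def)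
qed

section \<open>Dependence of the flow on the initial value\<close>

lemma ode_flow_integral_equation:
  assumes f: "caratheodory a b \<Lambda> f" and s: "s \<in> {a..b}"
  shows "continuous_on {a..b} (\<lambda>r. ode_flow a b f s r x)"
    "(\<lambda>r. f r (ode_flow a b f s r x)) integrable_on {a..b}"
    "t \<in> {a..b} \<Longrightarrow> ode_flow a b f s t x = x + (integral {a..t} (\<lambda>r. f r (ode_flow a b f s r x))
       - integral {a..s} (\<lambda>r. f r (ode_flow a b f s r x)))"
  using integral_solution_ode_flow[OF f s, of x] caratheodory_integrable[OF f]
  unfolding integral_solution_def by blast+

lemma ode_flow_lipschitz:
  fixes f :: "real \<Rightarrow> 'a::euclidean_space \<Rightarrow> 'a"
  assumes f: "caratheodory a b \<Lambda> f" and \<Lambda>: "0 \<le> \<Lambda>" and s: "s \<in> {a..b}" and t: "t \<in> {a..b}"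
  shows "norm (ode_flow a b f s t x - ode_flow a b f s t y) \<le> exp (\<Lambda> * \<bar>t - s\<bar>) * norm (x - y)"
proof -
  obtain Z where Z: "negligible Z"
    and lip: "\<And>t x y. t \<in> {a<..<b} - Z \<Longrightarrow> norm (f t x - f t y) \<le> \<Lambda> * norm (x - y)"
    using caratheodory_lipschitz[OF f] by blast
  define \<phi> where "\<phi> = (\<lambda>x r. ode_flow a b f s r x)"
  define F where "F = (\<lambda>x r. f r (\<phi> x r))"
  have cont: "continuous_on {a..b} (\<phi> x)" and int: "F x integrable_on {a..b}"
    and eq: "r \<in> {a..b} \<Longrightarrow> \<phi> x r = x + (integral {a..r} (F x) - integral {a..s} (F x))" for x r
    unfolding F_def \<phi>_def using ode_flow_integral_equation[OF f s] by blast+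
  have sub: "integral {a..r} (\<lambda>r. F x r - F y r) = integral {a..r} (F x) - integral {a..r} (F y)"
    if "r \<in> {a..b}" for r
    using that by (intro Henstock_Kurzweil_Integration.integral_diff integrable_subinterval_real[OF int]) auto
  have "norm (\<phi> x t - \<phi> y t) \<le> (norm (x - y) + integral {min s t..max s t} (\<lambda>_. 0)) * exp (\<Lambda> * \<bar>t - s\<bar>)"
  proof (rule gronwall_increment[where E = "\<lambda>r. \<phi> x r - \<phi> y r" and g = "\<lambda>r. F x r - F y r", OF _ _ _ _ \<Lambda> Z s t])
    show "\<phi> x r - \<phi> y r = (x - y) + (integral {a..r} (\<lambda>r. F x r - F y r) - integral {a..s} (\<lambda>r. F x r - F y r))"
      if r: "r \<in> {a..b}" for r
      unfolding sub[OF r] sub[OF s] eq[OF r] by simp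
    show "norm (F x r - F y r) \<le> \<Lambda> * norm (\<phi> x r - \<phi> y r) + 0" if "r \<in> {a<..<b} - Z" for r
      using lip[OF that] by (simp add: F_def)
    show "continuous_on {a..b} (\<lambda>r. \<phi> x r - \<phi> y r)" by (intro continuous_intros cont)
    show "(\<lambda>r. F x r - F y r) integrable_on {a..b}" by (intro integrable_diff int)
  qed auto
  then show ?thesis by (simp add: \<phi>_def mult.commute)
qed

text \<open>
  The second difference of the flow vanishes at time \<open>s\<close> and solves a linear integral inequality
  with a forcing term of size \<open>\<Lambda>2\<close> times two first differences. Each first difference contributes
  one exponential factor and Gronwall's inequality the third.
\<close>

lemma ode_flow_second_difference:
  fixes f :: "real \<Rightarrow> 'a::euclidean_space \<Rightarrow> 'a"
  assumes f: "caratheodory a b \<Lambda>1 f" and \<Lambda>1: "0 \<le> \<Lambda>1" and \<Lambda>2: "0 \<le> \<Lambda>2"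
    and s: "s \<in> {a..b}" and t: "t \<in> {a..b}"
    and second: "\<And>t x' x y' y. t \<in> {a<..<b} \<Longrightarrow> norm ((f t x' - f t x) - (f t y' - f t y))
       \<le> \<Lambda>1 * norm ((x' - x) - (y' - y)) + \<Lambda>2 * norm (y' - y) * norm (x - y)"
  shows "norm ((ode_flow a b f s t (x + h) - ode_flow a b f s t x)
      - (ode_flow a b f s t (y + h) - ode_flow a b f s t y))
    \<le> (b - a) * \<Lambda>2 * exp (3 * \<Lambda>1 * (b - a)) * norm h * norm (x - y)"
proof -
  define \<phi> where "\<phi> = (\<lambda>x r. ode_flow a b f s r x)"
  define F where "F = (\<lambda>x r. f r (\<phi> x r))"
  have cont: "continuous_on {a..b} (\<phi> x)" and int: "F x integrable_on {a..b}"
    and eq: "r \<in> {a..b} \<Longrightarrow> \<phi> x r = x + (integral {a..r} (F x) - integral {a..s} (F x))" for x r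
    unfolding F_def \<phi>_def using ode_flow_integral_equation[OF f s] by blast+
  define e where "e = exp (\<Lambda>1 * (b - a))"
  have e: "exp (\<Lambda>1 * \<bar>r - s\<bar>) \<le> e" if "r \<in> {a..b}" for r
    unfolding e_def using that s \<Lambda>1 by (auto intro!: mult_left_mono)
  have lip: "norm (\<phi> x r - \<phi> y r) \<le> e * norm (x - y)" if "r \<in> {a..b}" for r x y
    using ode_flow_lipschitz[OF f \<Lambda>1 s that, of x y] mult_right_mono[OF e[OF that], of "norm (x - y)"]
    by (simp add: \<phi>_def)
  define G where "G = (\<lambda>r. (F (x + h) r - F x r) - (F (y + h) r - F y r))"
  define E where "E = (\<lambda>r. (\<phi> (x + h) r - \<phi> x r) - (\<phi> (y + h) r - \<phi> y r))"
  define k where "k = \<Lambda>2 * (e * norm h) * (e * norm (x - y))"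
  have k: "0 \<le> k" using \<Lambda>2 by (simp add: k_def e_def)
  have IG: "integral {a..r} G = (integral {a..r} (F (x + h)) - integral {a..r} (F x))
      - (integral {a..r} (F (y + h)) - integral {a..r} (F y))" if "r \<in> {a..b}" for r
  proof -
    have i: "F x integrable_on {a..r}" for x using that by (intro integrable_subinterval_real[OF int]) auto
    show ?thesis unfolding G_def
      by (simp add: Henstock_Kurzweil_Integration.integral_diff integrable_diff i)
  qed
  have "norm (E t) \<le> (norm (0 :: 'a) + integral {min s t..max s t} (\<lambda>_. k)) * exp (\<Lambda>1 * \<bar>t - s\<bar>)"
  proof (rule gronwall_increment[where E = E and g = G and Z = "{}", OF _ _ _ _ \<Lambda>1 _ s t])
    show "E r = 0 + (integral {a..r} G - integral {a..s} G)" if r: "r \<in> {a..b}" for r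
      unfolding IG[OF r] IG[OF s] E_def eq[OF r] by simp
    show "norm (G r) \<le> \<Lambda>1 * norm (E r) + k" if "r \<in> {a<..<b} - {}" for r
    proof -
      have r: "r \<in> {a<..<b}" "r \<in> {a..b}" using that by auto
      have "norm (G r) \<le> \<Lambda>1 * norm (E r) + \<Lambda>2 * norm (\<phi> (y + h) r - \<phi> y r) * norm (\<phi> x r - \<phi> y r)"
        unfolding G_def F_def E_def by (rule second[OF r(1)])
      also have "\<Lambda>2 * norm (\<phi> (y + h) r - \<phi> y r) * norm (\<phi> x r - \<phi> y r) \<le> k"
        unfolding k_def using lip[OF r(2), of "y + h" y] lip[OF r(2), of x y] \<Lambda>2
        by (intro mult_mono) (auto simp: e_def)
      finally show ?thesis by simp
    qed
    show "continuous_on {a..b} E" unfolding E_def by (intro continuous_intros cont)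
    show "G integrable_on {a..b}" unfolding G_def by (intro integrable_diff int)
  qed (use k in auto)
  also have "integral {min s t..max s t} (\<lambda>_. k) = (max s t - min s t) * k"
    by (subst integral_const_real) simp
  also have "(norm (0 :: 'a) + (max s t - min s t) * k) * exp (\<Lambda>1 * \<bar>t - s\<bar>) \<le> ((b - a) * k) * e"
    using s t k e[OF t] by (intro mult_mono) (auto intro!: mult_right_mono)
  also have "\<dots> = (b - a) * \<Lambda>2 * (e * e * e) * norm h * norm (x - y)" by (simp add: k_def)
  also have "e * e * e = exp (3 * \<Lambda>1 * (b - a))"
    by (simp add: e_def algebra_simps flip: exp_add)
  finally show ?thesis by (simp add: E_def \<phi>_def)
qed

lemma admissible_drift_lipschitz:
  assumes "admissible_drift t0 T \<Lambda>1 \<Lambda>2 N" "t \<in> {t0..T}"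
  shows "norm (N t x - N t y) \<le> \<Lambda>1 * norm (x - y)"
  using assms by (intro fderiv_bound_imp_lipschitz) (auto simp: admissible_drift_def C2_def C1_def)

lemma admissible_drift_caratheodory:
  assumes N: "admissible_drift t0 T \<Lambda>1 \<Lambda>2 N"
  shows "caratheodory t0 T \<Lambda>1 N"
proof -
  have Linf: "(\<lambda>t. N t x) \<in> Linf {t0<..<T}" for x using N by (simp add: admissible_drift_def)
  then obtain M where "AE t in lebesgue_on {t0<..<T}. norm (N t 0) \<le> M"
    unfolding Linf_def by blast
  then obtain Z where "negligible Z" "\<And>t. t \<in> {t0<..<T} - Z \<Longrightarrow> norm (N t 0) \<le> M"
    by (subst (asm) AE_lebesgue_on_iff_negligible) auto
  then show ?thesis
    unfolding caratheodory_def using Linf admissible_drift_lipschitz[OF N]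
    by (intro conjI exI[of _ Z] exI[of _ M]) (auto simp: Linf_def)
qed

lemma flow_deriv_bounds:
  fixes N :: "real \<Rightarrow> real^'d \<Rightarrow> real^'d"
  assumes N: "admissible_drift t0 T \<Lambda>1 \<Lambda>2 N" and \<Lambda>: "0 \<le> \<Lambda>1" "0 \<le> \<Lambda>2"
    and s: "s \<in> {t0..T}" and t: "t \<in> {t0..T}"
  shows "norm (flow_deriv t0 T N s t x *v h) \<le> exp (\<Lambda>1 * (T - t0)) * norm h"
    "norm (flow_deriv t0 T N s t x *v h - flow_deriv t0 T N s t y *v h)
       \<le> (T - t0) * \<Lambda>2 * exp (3 * \<Lambda>1 * (T - t0)) * norm h * norm (x - y)"
proof -
  note f = admissible_drift_caratheodory[OF N]
  have second: "norm ((N t x' - N t x) - (N t y' - N t y))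
      \<le> \<Lambda>1 * norm ((x' - x) - (y' - y)) + \<Lambda>2 * norm (y' - y) * norm (x - y)"
    if "t \<in> {t0<..<T}" for t x' x y' y
    using N that by (intro C2_second_difference) (auto simp: admissible_drift_def)
  have lip: "norm (ode_flow t0 T N s t (x + h) - ode_flow t0 T N s t x) \<le> exp (\<Lambda>1 * (T - t0)) * norm h" for x h
  proof -
    have "norm (ode_flow t0 T N s t (x + h) - ode_flow t0 T N s t x) \<le> exp (\<Lambda>1 * \<bar>t - s\<bar>) * norm h"
      using ode_flow_lipschitz[OF f \<Lambda>(1) s t, of "x + h" x] by simp
    also have "\<dots> \<le> exp (\<Lambda>1 * (T - t0)) * norm h"
      using s t \<Lambda> by (intro mult_right_mono) (auto intro!: mult_left_mono)
    finally show ?thesis .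
  qed
  obtain D where D: "\<And>x. (ode_flow t0 T N s t has_derivative D x) (at x)"
    "\<And>x h. norm (D x h) \<le> exp (\<Lambda>1 * (T - t0)) * norm h"
    "\<And>x y h. norm (D x h - D y h) \<le> (T - t0) * \<Lambda>2 * exp (3 * \<Lambda>1 * (T - t0)) * norm h * norm (x - y)"
    using second_differences_imp_derivative[of "ode_flow t0 T N s t", OF lip
        ode_flow_second_difference[OF f \<Lambda> s t second]] by blast
  have "flow_deriv t0 T N s t x *v h = D x h" for x h
    unfolding flow_deriv_def frechet_derivative_at[OF D(1)[of x], symmetric]
    by (rule matrix_works) (simp add: has_derivative_linear[OF D(1)] linear_matrix_vector_mul_eq)
  then show "norm (flow_deriv t0 T N s t x *v h) \<le> exp (\<Lambda>1 * (T - t0)) * norm h"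
    "norm (flow_deriv t0 T N s t x *v h - flow_deriv t0 T N s t y *v h)
       \<le> (T - t0) * \<Lambda>2 * exp (3 * \<Lambda>1 * (T - t0)) * norm h * norm (x - y)"
    using D(2,3) by simp_all
qed

section \<open>Spectral norm, smallest eigenvalue and pseudoinverse\<close>

lemma blinfun_apply_mat_op [simp]: "blinfun_apply (mat_op A) = (*v) A" for A :: "real^'n^'m"
  unfolding mat_op_def by (rule bounded_linear_Blinfun_apply) (rule matrix_vector_mul_bounded_linear)

lemma norm_matrix_vector_mul_le: "norm (A *v x) \<le> spectral_norm A * norm x" for A :: "real^'n^'m"
  using norm_blinfun[of "mat_op A" x] by (simp add: spectral_norm_def)

lemma spectral_norm_nonneg: "0 \<le> spectral_norm A"
  by (simp add: spectral_norm_def)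

lemma inner_transpose: "(transpose A *v x) \<bullet> y = x \<bullet> (A *v y)" for A :: "real^'n^'m"
  by (simp add: dot_lmul_matrix)

text \<open>
  \<open>\<bar>A\<^sup>T y\<bar>\<^sup>2 = y \<bullet> A A\<^sup>T y \<le> \<bar>y\<bar> c \<bar>A\<^sup>T y\<bar>\<close>.
\<close>

lemma norm_transpose_mult_le:
  fixes A :: "real^'n^'m"
  assumes "\<And>x. norm (A *v x) \<le> c * norm x"
  shows "norm (transpose A *v y) \<le> c * norm y"
proof (cases "transpose A *v y = 0")
  case True
  have "0 \<le> c * norm (axis undefined (1::real) :: real^'n)" using assms order_trans[OF norm_ge_zero] by blast
  then have "0 \<le> c" by (simp add: norm_axis_1)
  with True show ?thesis by simp
next
  case False
  let ?z = "transpose A *v y"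
  have "norm ?z * norm ?z = ?z \<bullet> ?z" by (simp add: norm_eq_sqrt_inner)
  also have "\<dots> = y \<bullet> (A *v ?z)" by (rule inner_transpose)
  also have "\<dots> \<le> norm y * (c * norm ?z)"
    using norm_cauchy_schwarz[of y "A *v ?z"] mult_left_mono[OF assms[of ?z], of "norm y"] by simp
  finally have "norm ?z * norm ?z \<le> (c * norm y) * norm ?z" by (simp add: mult_ac)
  then show ?thesis using False by (simp only: mult_le_cancel_right) simp
qed

text \<open>
  Eigenvectors of a symmetric matrix for different eigenvalues are orthogonal, and orthogonal
  families are finite.
\<close>

lemma finite_eigenvalues:
  fixes A :: "real^'n^'n"
  assumes sym: "transpose A = A"
  shows "finite {l. \<exists>v. v \<noteq> 0 \<and> A *v v = l *\<^sub>R v}" (is "finite ?S")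
proof -
  have "\<forall>l\<in>?S. \<exists>v. v \<noteq> 0 \<and> A *v v = l *\<^sub>R v" by blast
  then obtain e where "\<forall>l\<in>?S. e l \<noteq> 0 \<and> A *v e l = l *\<^sub>R e l" by (rule bchoice[THEN exE])
  then have e: "\<And>l. l \<in> ?S \<Longrightarrow> e l \<noteq> 0 \<and> A *v e l = l *\<^sub>R e l" by (rule bspec)
  have orth: "e l \<bullet> e m = 0" if "l \<in> ?S" "m \<in> ?S" "l \<noteq> m" for l m
  proof -
    have "l * (e l \<bullet> e m) = (A *v e l) \<bullet> e m" using e[OF that(1)] by simp
    also have "\<dots> = e l \<bullet> (A *v e m)" using inner_transpose[of A "e l" "e m"] by (simp only: sym)
    also have "\<dots> = m * (e l \<bullet> e m)" using e[OF that(2)] by simp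
    finally show ?thesis using that(3) by simp
  qed
  have inj: "inj_on e ?S"
  proof (rule inj_onI, rule ccontr)
    fix l m assume "l \<in> ?S" "m \<in> ?S" "e l = e m" "l \<noteq> m"
    with orth[of l m] e[of l] show False by simp
  qed
  have "pairwise orthogonal (e ` ?S)"
    unfolding pairwise_def orthogonal_def using orth by blast
  then have "finite (e ` ?S)" by (rule pairwise_orthogonal_imp_finite)
  then show ?thesis using inj by (rule finite_imageD)
qed

text \<open>
  A minimiser \<open>v\<close> of the quadratic form on the unit sphere is an eigenvector: the form
  \<open>q w = w \<bullet> A w - m \<bar>w\<bar>\<^sup>2\<close> is nonnegative and vanishes at \<open>v\<close>, so its derivative at \<open>v\<close> in the
  direction of \<open>g = A v - m v\<close> must vanish, and this derivative is \<open>2 \<bar>g\<bar>\<^sup>2\<close>.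
\<close>

lemma ex_minimal_eigenvalue:
  fixes A :: "real^'n^'n"
  assumes sym: "transpose A = A"
  obtains m v where "v \<noteq> 0" "A *v v = m *\<^sub>R v" "\<And>w. m * (w \<bullet> w) \<le> w \<bullet> (A *v w)"
proof -
  have "\<exists>v\<in>sphere (0 :: real^'n) 1. \<forall>w\<in>sphere 0 1. v \<bullet> (A *v v) \<le> w \<bullet> (A *v w)"
    by (rule continuous_attains_inf) (auto intro!: continuous_intros)
  then obtain v where v: "norm v = 1" and min: "\<And>w. norm w = 1 \<Longrightarrow> v \<bullet> (A *v v) \<le> w \<bullet> (A *v w)"
    by (auto simp: dist_norm)
  define m where "m = v \<bullet> (A *v v)"
  have ge: "m * (w \<bullet> w) \<le> w \<bullet> (A *v w)" for w
  proof (cases "w = 0")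
    case False
    have "m \<le> (w /\<^sub>R norm w) \<bullet> (A *v (w /\<^sub>R norm w))"
      unfolding m_def using False by (intro min) simp
    also have "\<dots> = (w \<bullet> (A *v w)) / (norm w)\<^sup>2"
      by (simp add: matrix_vector_mult_scaleR power2_eq_square field_simps)
    finally show ?thesis using False by (simp add: field_simps power2_norm_eq_inner)
  qed simp
  define g where "g = A *v v - m *\<^sub>R v"
  define q where "q = (\<lambda>w. w \<bullet> (A *v w) - m * (w \<bullet> w))"
  have expand: "q (v + t *\<^sub>R w) = q v + 2 * t * (w \<bullet> g) + t\<^sup>2 * q w" for t w
  proof -
    have "v \<bullet> (A *v w) = w \<bullet> (A *v v)"
      using inner_transpose[of A w v] sym by (simp add: inner_commute)
    then show ?thesis
      by (simp add: q_def g_def matrix_vector_mult_scaleR matrix_vector_right_distrib algebra_simps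
          inner_simps power2_eq_square inner_commute)
  qed
  have qv: "q v = 0" using v by (simp add: q_def m_def norm_eq_1)
  \<comment> \<open>A step so short that the quadratic term is at most half of the linear one.\<close>
  define t where "t = (g \<bullet> g) / (q g + 1)"
  have q0: "0 \<le> q w" for w using ge[of w] by (simp add: q_def)
  have "0 \<le> - 2 * t * (g \<bullet> g) + t\<^sup>2 * q g"
    using expand[of "- t" g] q0[of "v + (- t) *\<^sub>R g"] qv by simp
  moreover have "t\<^sup>2 * q g \<le> t * (g \<bullet> g)"
  proof -
    have "t * q g \<le> g \<bullet> g"
      using q0[of g] inner_ge_zero[of g] by (simp add: t_def divide_simps mult_left_mono algebra_simps)
    moreover have "0 \<le> t" using q0[of g] inner_ge_zero[of g] by (simp add: t_def)
    ultimately show ?thesis by (simp add: power2_eq_square mult.assoc mult_left_mono)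
  qed
  ultimately have "t * (g \<bullet> g) \<le> 0" by simp
  then have "(g \<bullet> g) * (g \<bullet> g) \<le> 0" using q0[of g]
    by (simp add: t_def divide_simps mult_le_0_iff zero_le_mult_iff split: if_splits)
  then have "g = 0" by (metis inner_eq_zero_iff mult_eq_0_iff order_antisym zero_le_square)
  then have "A *v v = m *\<^sub>R v" by (simp add: g_def)
  with v ge that[of v m] show thesis by force
qed

lemma lambda_min_coercive:
  fixes A :: "real^'n^'n"
  assumes sym: "transpose A = A" and c: "c \<le> lambda_min A"
  shows "c * (w \<bullet> w) \<le> w \<bullet> (A *v w)"
proof -
  obtain m v where v: "v \<noteq> 0" "A *v v = m *\<^sub>R v" and m: "\<And>w. m * (w \<bullet> w) \<le> w \<bullet> (A *v w)"
    using ex_minimal_eigenvalue[OF sym] by blast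
  have "lambda_min A \<le> m"
    unfolding lambda_min_def by (rule Min_le[OF finite_eigenvalues[OF sym]]) (use v in blast)
  then have "c * (w \<bullet> w) \<le> m * (w \<bullet> w)" using c by (intro mult_right_mono) auto
  with m[of w] show ?thesis by linarith
qed

lemma lambda_min_ge:
  fixes A :: "real^'n^'n"
  assumes sym: "transpose A = A" and c: "\<And>w. c * (w \<bullet> w) \<le> w \<bullet> (A *v w)"
  shows "c \<le> lambda_min A"
proof -
  let ?S = "{l. \<exists>v. v \<noteq> 0 \<and> A *v v = l *\<^sub>R v}"
  obtain m v where "v \<noteq> 0" "A *v v = m *\<^sub>R v" using ex_minimal_eigenvalue[OF sym] by blast
  then have "?S \<noteq> {}" by blast
  then have "lambda_min A \<in> ?S"
    unfolding lambda_min_def by (rule Min_in[OF finite_eigenvalues[OF sym]])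
  then obtain w where w: "w \<noteq> 0" "A *v w = lambda_min A *\<^sub>R w" by blast
  then have "c * (w \<bullet> w) \<le> lambda_min A * (w \<bullet> w)" using c[of w] by simp
  then show ?thesis using w(1) by simp
qed

lemma pseudo_inverse_eqI:
  fixes A :: "real^'n^'n"
  assumes AX: "A ** X = mat 1" and XA: "X ** A = mat 1"
  shows "pseudo_inverse A = X"
  unfolding pseudo_inverse_def
proof (rule the_equality)
  show "A ** X ** A = A \<and> X ** A ** X = X \<and> transpose (A ** X) = A ** X \<and> transpose (X ** A) = X ** A"
    by (simp add: AX XA transpose_mat)
  fix Y assume "A ** Y ** A = A \<and> Y ** A ** Y = Y \<and> transpose (A ** Y) = A ** Y \<and> transpose (Y ** A) = Y ** A"
  then have "X ** (A ** Y ** A) ** X = X ** A ** X" by simp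
  then have "(X ** A) ** Y ** (A ** X) = (X ** A) ** X" by (simp only: matrix_mul_assoc)
  then show "Y = X" by (simp add: AX XA)
qed

lemma coercive_pseudo_inverse:
  fixes A :: "real^'n^'n"
  assumes c: "0 < c" and coercive: "\<And>w. c * (w \<bullet> w) \<le> w \<bullet> (A *v w)"
  shows "A *v (pseudo_inverse A *v w) = w" "pseudo_inverse A *v (A *v w) = w"
    "norm (pseudo_inverse A *v w) \<le> norm w / c"
proof -
  have "v = 0" if "A *v v = 0" for v
  proof -
    have "c * (v \<bullet> v) \<le> 0" using coercive[of v] that by simp
    then have "v \<bullet> v \<le> 0" using c by (simp add: mult_le_0_iff)
    then show ?thesis by (metis inner_eq_zero_iff inner_ge_zero order_antisym)
  qed
  then obtain X where XA: "X ** A = mat 1" using matrix_left_invertible_ker by metis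
  then have AX: "A ** X = mat 1" using matrix_left_right_inverse by blast
  have P: "pseudo_inverse A = X" by (rule pseudo_inverse_eqI[OF AX XA])
  show 1: "A *v (pseudo_inverse A *v w) = w" "pseudo_inverse A *v (A *v w) = w"
    unfolding P by (simp_all add: matrix_vector_mul_assoc AX XA)
  let ?v = "pseudo_inverse A *v w"
  have "c * (norm ?v * norm ?v) \<le> ?v \<bullet> w"
    using coercive[of ?v] unfolding 1 by (simp add: norm_eq_sqrt_inner)
  also have "\<dots> \<le> norm ?v * norm w" by (rule norm_cauchy_schwarz)
  finally have "norm ?v * (c * norm ?v) \<le> norm ?v * norm w" by (simp add: mult_ac)
  then have "c * norm ?v \<le> norm w \<or> norm ?v = 0" by (simp only: mult_le_cancel_left) (smt (verit) norm_ge_zero)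
  then show "norm ?v \<le> norm w / c" using c by (auto simp: field_simps)
qed

text \<open>
  Convergence and integrability of matrix-valued functions refer to the Frobenius norm, while all
  estimates of the integrand of the Gramian are for the operator norm.
\<close>

lemma norm_matrix_le:
  fixes A :: "real^'n^'m"
  assumes "\<And>x. norm (A *v x) \<le> c * norm x"
  shows "norm A \<le> real CARD('m) * real CARD('n) * c"
proof -
  have entry: "\<bar>A $ i $ j\<bar> \<le> c" for i j
  proof -
    have "\<bar>(A *v axis j 1) $ i\<bar> \<le> norm (A *v axis j 1)" by (rule component_le_norm_cart)
    also have "\<dots> \<le> c" using assms[of "axis j 1"] by simp
    finally show ?thesis by (simp add: matrix_vector_mult_basis column_def)
  qed
  have row: "norm (A $ i) \<le> real CARD('n) * c" for i
    using order_trans[OF norm_le_l1_cart sum_bounded_above[of UNIV "\<lambda>j. \<bar>A $ i $ j\<bar>" c]] entry by simp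
  have "norm A \<le> (\<Sum>i\<in>UNIV. norm (A $ i))" unfolding norm_vec_def by (rule L2_set_le_sum) simp
  also have "\<dots> \<le> real CARD('m) * (real CARD('n) * c)"
    using sum_bounded_above[of UNIV "\<lambda>i. norm (A $ i)" "real CARD('n) * c"] row by simp
  finally show ?thesis by (simp add: mult_ac)
qed

lemma bounded_linear_matrix_vector_mul_left: "bounded_linear (\<lambda>A :: real^'n^'m. A *v w)"
  unfolding linear_conv_bounded_linear[symmetric]
  by (rule linearI) (simp_all add: matrix_vector_mult_add_rdistrib scaleR_matrix_vector_assoc)

lemma transpose_diff: "transpose A - transpose A' = transpose (A - A' :: real^'n^'m)"
  by (simp add: transpose_def vec_eq_iff)

text \<open>
  \<open>A A\<^sup>T - A' A'\<^sup>T = A (A - A')\<^sup>T + (A - A') A'\<^sup>T\<close>.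
\<close>

lemma gramian_integrand_diff:
  fixes A A' :: "real^'n^'m"
  assumes A: "\<And>w. norm (A *v w) \<le> b * norm w" and A': "\<And>w. norm (A' *v w) \<le> b * norm w"
    and diff: "\<And>w. norm ((A - A') *v w) \<le> c * norm w" and bc: "0 \<le> b" "0 \<le> c"
  shows "norm (A *v (transpose A *v w) - A' *v (transpose A' *v w)) \<le> 2 * b * c * norm w"
proof -
  have "norm (A *v (transpose (A - A') *v w)) \<le> b * (c * norm w)"
    by (rule order_trans[OF A mult_left_mono[OF norm_transpose_mult_le[OF diff] bc(1)]])
  moreover have "norm ((A - A') *v (transpose A' *v w)) \<le> c * (b * norm w)"
    by (rule order_trans[OF diff mult_left_mono[OF norm_transpose_mult_le[OF A'] bc(2)]])
  moreover have "A *v (transpose A *v w) - A' *v (transpose A' *v w)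
      = A *v (transpose (A - A') *v w) + (A - A') *v (transpose A' *v w)"
    by (simp add: matrix_vector_mult_diff_rdistrib matrix_vector_mult_diff_distrib
        flip: transpose_diff del: transpose_matrix_vector)
  ultimately show ?thesis
    using norm_triangle_mono[of "A *v (transpose (A - A') *v w)" "b * (c * norm w)"
        "(A - A') *v (transpose A' *v w)" "c * (b * norm w)"] by (simp add: algebra_simps)
qed

section \<open>Essential suprema\<close>

text \<open>
  The essential supremum is an extended real; on a set of positive measure a bounded nonnegative
  function has a real one.
\<close>

lemma ess_sup_bounded:
  fixes g :: "'a::euclidean_space \<Rightarrow> real"
  assumes S: "S \<in> sets lebesgue" "\<not> negligible S" and g: "g \<in> borel_measurable (lebesgue_on S)"
    and g0: "\<And>x. 0 \<le> g x" and c: "AE x in lebesgue_on S. g x \<le> c"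
  shows "0 \<le> ess_sup S g" "ess_sup S g \<le> c" "AE x in lebesgue_on S. g x \<le> ess_sup S g"
proof -
  let ?M = "lebesgue_on S" and ?E = "esssup (lebesgue_on S) (\<lambda>x. ereal (g x))"
  have m: "(\<lambda>x. ereal (g x)) \<in> borel_measurable ?M" using g by simp
  have "?E \<le> ereal c" by (rule esssup_I[OF m]) (use c in simp)
  moreover have "emeasure ?M (space ?M) \<noteq> 0"
    using S by (simp add: emeasure_restrict_space negligible_iff_null_sets null_setsI space_restrict_space null_sets_def)
  then have "esssup ?M (\<lambda>x. 0 :: ereal) = 0" by (rule esssup_const)
  then have "0 \<le> ?E" using esssup_mono[of "\<lambda>x. 0 :: ereal" ?M "\<lambda>x. ereal (g x)"] g0 by simp
  ultimately obtain r where r: "?E = ereal r" "0 \<le> r" "r \<le> c" by (cases ?E) auto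
  have e: "ess_sup S g = r" by (simp add: ess_sup_def r)
  show "0 \<le> ess_sup S g" "ess_sup S g \<le> c" using r e by auto
  show "AE x in ?M. g x \<le> ess_sup S g"
    using esssup_AE[of "\<lambda>x. ereal (g x)" ?M] by (simp add: r e)
qed

lemma Linf_normI:
  assumes S: "S \<in> sets lebesgue" "\<not> negligible S" and f: "f \<in> borel_measurable (lebesgue_on S)"
    and c: "AE x in lebesgue_on S. norm (f x) \<le> c"
  shows "Linf_norm S f \<le> c"
  unfolding Linf_norm_def by (rule ess_sup_bounded(2)[OF S _ _ c]) (use f in auto)

lemma Linf_norm_bound:
  assumes S: "S \<in> sets lebesgue" "\<not> negligible S" and f: "f \<in> Linf S"
  shows "0 \<le> Linf_norm S f" "AE x in lebesgue_on S. norm (f x) \<le> Linf_norm S f"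
proof -
  obtain c where "f \<in> borel_measurable (lebesgue_on S)" "AE x in lebesgue_on S. norm (f x) \<le> c"
    using f by (auto simp: Linf_def)
  then show "0 \<le> Linf_norm S f" "AE x in lebesgue_on S. norm (f x) \<le> Linf_norm S f"
    unfolding Linf_norm_def by (intro ess_sup_bounded[OF S, where c = c]; simp)+
qed

lemma Linf_diff:
  fixes f g :: "'a::euclidean_space \<Rightarrow> 'b::euclidean_space"
  assumes "f \<in> Linf S" "g \<in> Linf S"
  shows "(\<lambda>x. f x - g x) \<in> Linf S"
proof -
  obtain c d where "AE x in lebesgue_on S. norm (f x) \<le> c" "AE x in lebesgue_on S. norm (g x) \<le> d"
    using assms by (auto simp: Linf_def)
  then have "AE x in lebesgue_on S. norm (f x - g x) \<le> c + d"
    by eventually_elim (rule order_trans[OF norm_triangle_ineq4 add_mono])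
  then show ?thesis using assms by (auto simp: Linf_def)
qed

lemma Linf_norm_triangle:
  fixes f g h :: "'a::euclidean_space \<Rightarrow> 'b::euclidean_space"
  assumes S: "S \<in> sets lebesgue" "\<not> negligible S" and f: "f \<in> Linf S" and g: "g \<in> Linf S" and h: "h \<in> Linf S"
  shows "Linf_norm S (\<lambda>x. f x - h x) \<le> Linf_norm S (\<lambda>x. f x - g x) + Linf_norm S (\<lambda>x. g x - h x)"
proof (rule Linf_normI[OF S])
  show "(\<lambda>x. f x - h x) \<in> borel_measurable (lebesgue_on S)" using Linf_diff[OF f h] by (simp add: Linf_def)
  show "AE x in lebesgue_on S. norm (f x - h x) \<le> Linf_norm S (\<lambda>x. f x - g x) + Linf_norm S (\<lambda>x. g x - h x)"
    using Linf_norm_bound(2)[OF S Linf_diff[OF f g]] Linf_norm_bound(2)[OF S Linf_diff[OF g h]]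
  proof eventually_elim
    case (elim x)
    then show ?case using norm_triangle_ineq[of "f x - g x" "g x - h x"] by simp
  qed
qed

lemma Linf_norm_eq_0_imp_ae_eq:
  fixes f g :: "'a::euclidean_space \<Rightarrow> 'b::euclidean_space"
  assumes S: "S \<in> sets lebesgue" "\<not> negligible S" and f: "f \<in> Linf S" and g: "g \<in> Linf S"
    and "Linf_norm S (\<lambda>x. f x - g x) \<le> 0"
  shows "ae_eq S f g"
  unfolding ae_eq_def using Linf_norm_bound(2)[OF S Linf_diff[OF f g]]
  by eventually_elim (use assms(5) in \<open>smt (verit) norm_ge_zero norm_eq_zero right_minus_eq\<close>)

lemma ae_eq_imp_Linf_norm_eq_0:
  fixes f g :: "'a::euclidean_space \<Rightarrow> 'b::euclidean_space"
  assumes S: "S \<in> sets lebesgue" "\<not> negligible S" and f: "f \<in> Linf S" and g: "g \<in> Linf S" and "ae_eq S f g"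
  shows "Linf_norm S (\<lambda>x. f x - g x) = 0"
proof (rule antisym[OF Linf_normI[OF S] Linf_norm_bound(1)[OF S Linf_diff[OF f g]]])
  show "(\<lambda>x. f x - g x) \<in> borel_measurable (lebesgue_on S)" using Linf_diff[OF f g] by (simp add: Linf_def)
  show "AE x in lebesgue_on S. norm (f x - g x) \<le> 0" using assms(5) unfolding ae_eq_def by simp
qed

lemma Linf_norm_commute: "Linf_norm S (\<lambda>x. f x - g x) = Linf_norm S (\<lambda>x. g x - f x)"
  by (simp add: Linf_norm_def norm_minus_commute)

text \<open>
  Outside one negligible set all the countably many bounds on differences hold pointwise, so the
  sequence converges there at the same rate.
\<close>

lemma Linf_complete:
  fixes u :: "nat \<Rightarrow> 'a::euclidean_space \<Rightarrow> 'b::euclidean_space"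
  assumes S: "S \<in> sets lebesgue" "\<not> negligible S" and u: "\<And>n. u n \<in> Linf S" and d: "d \<longlonglongrightarrow> 0"
    and cauchy: "\<And>n k. Linf_norm S (\<lambda>x. u (n + k) x - u n x) \<le> d n"
  obtains w where "w \<in> Linf S" "\<And>n. Linf_norm S (\<lambda>x. w x - u n x) \<le> d n"
    "AE x in lebesgue_on S. (\<lambda>n. u n x) \<longlonglongrightarrow> w x"
proof -
  have "AE x in lebesgue_on S. \<forall>n k. norm (u (n + k) x - u n x) \<le> d n"
  proof (intro AE_all_countable[THEN iffD2] allI)
    fix n k
    show "AE x in lebesgue_on S. norm (u (n + k) x - u n x) \<le> d n"
      using Linf_norm_bound(2)[OF S Linf_diff[OF u[of "n + k"] u[of n]]]
      by eventually_elim (rule order_trans[OF _ cauchy])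
  qed
  then have ae: "AE x in lebesgue_on S. (\<lambda>n. u n x) \<longlonglongrightarrow> lim (\<lambda>n. u n x) \<and>
      (\<forall>n. norm (lim (\<lambda>n. u n x) - u n x) \<le> d n)"
  proof eventually_elim
    case (elim x)
    have "Cauchy (\<lambda>n. u n x)"
    proof (rule CauchyI')
      fix e :: real assume "e > 0"
      then obtain M where M: "\<And>n. n \<ge> M \<Longrightarrow> d n < e"
        using order_tendstoD(2)[OF d] unfolding eventually_sequentially by blast
      have "dist (u m x) (u n x) < e" if "m \<ge> M" "m < n" for m n
        using elim[rule_format, of m "n - m"] M[OF that(1)] that by (simp add: dist_norm norm_minus_commute)
      then show "\<exists>M. \<forall>m\<ge>M. \<forall>n>m. dist (u m x) (u n x) < e" by blast
    qed
    then have L: "(\<lambda>n. u n x) \<longlonglongrightarrow> lim (\<lambda>n. u n x)"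
      using Cauchy_convergent convergent_LIMSEQ_iff by blast
    moreover have "norm (lim (\<lambda>n. u n x) - u n x) \<le> d n" for n
    proof (rule Lim_norm_ubound)
      show "(\<lambda>k. u (n + k) x - u n x) \<longlonglongrightarrow> lim (\<lambda>n. u n x) - u n x"
        using LIMSEQ_ignore_initial_segment[OF L, of n] by (intro tendsto_intros) (simp add: add.commute)
    qed (use elim in auto)
    ultimately show ?case by blast
  qed
  define w where "w = (\<lambda>x. lim (\<lambda>n. u n x))"
  have um: "u n \<in> borel_measurable (lebesgue_on S)" for n using u[of n] by (simp add: Linf_def)
  have wm: "w \<in> borel_measurable (lebesgue_on S)"
    unfolding w_def using um by (rule borel_measurable_lim_metric)
  obtain c where "AE x in lebesgue_on S. norm (u 0 x) \<le> c" using u[of 0] by (auto simp: Linf_def)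
  then have "AE x in lebesgue_on S. norm (w x) \<le> d 0 + c" using ae
  proof eventually_elim
    case (elim x)
    have "norm (w x) \<le> norm (w x - u 0 x) + norm (u 0 x)"
      using norm_triangle_ineq[of "w x - u 0 x" "u 0 x"] by simp
    also have "norm (w x - u 0 x) \<le> d 0" using elim by (simp add: w_def)
    finally show ?case using elim by simp
  qed
  then have wL: "w \<in> Linf S" using wm by (auto simp: Linf_def)
  show thesis
  proof (rule that[OF wL])
    show "Linf_norm S (\<lambda>x. w x - u n x) \<le> d n" for n
      by (rule Linf_normI[OF S]) (use wm um ae in \<open>auto simp: w_def elim: eventually_mono\<close>)
    show "AE x in lebesgue_on S. (\<lambda>n. u n x) \<longlonglongrightarrow> w x"
      using ae by eventually_elim (simp add: w_def)
  qed
qed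

section \<open>Fixed points of maps with a contractive iterate\<close>

text \<open>
  Writing \<open>n = q m + r\<close> with \<open>r < m\<close>, the \<open>n\<close>-th iterates of any two points of \<open>F\<close> have distance at
  most \<open>d n = \<rho>\<^sub>m\<^sup>q R D\<close>, where \<open>R\<close> bounds the Lipschitz constants of the first \<open>m\<close> iterates. As this
  is uniform on \<open>F\<close>, Picard sequences are Cauchy, and both uniqueness and convergence follow by
  comparing with the iterates of the fixed point.
\<close>

lemma contractive_iterate_fixed_point:
  fixes f :: "('a::euclidean_space \<Rightarrow> 'b::euclidean_space) \<Rightarrow> 'a \<Rightarrow> 'b"
  assumes \<Omega>: "\<Omega> \<in> sets lebesgue" "\<not> negligible \<Omega>"
    and F: "F \<subseteq> Linf \<Omega>" "F \<noteq> {}" "f ` F \<subseteq> F"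
    and diam: "\<And>u v. u \<in> F \<Longrightarrow> v \<in> F \<Longrightarrow> Linf_norm \<Omega> (\<lambda>x. u x - v x) \<le> D"
    and closed: "\<And>u w d. (\<And>n. u n \<in> F) \<Longrightarrow> w \<in> Linf \<Omega> \<Longrightarrow> (d :: nat \<Rightarrow> real) \<longlonglongrightarrow> 0 \<Longrightarrow>
       (\<And>n. Linf_norm \<Omega> (\<lambda>x. w x - u n x) \<le> d n) \<Longrightarrow> w \<in> F"
    and lip: "\<And>u v m. u \<in> F \<Longrightarrow> v \<in> F \<Longrightarrow>
       Linf_norm \<Omega> (\<lambda>x. (f ^^ m) u x - (f ^^ m) v x) \<le> \<rho> m * Linf_norm \<Omega> (\<lambda>x. u x - v x)"
    and \<rho>: "\<And>m. 0 \<le> \<rho> m" and m: "1 \<le> m" "\<rho> m < 1"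
  shows "\<exists>w\<in>F. ae_eq \<Omega> (f w) w \<and> (\<forall>v\<in>F. ae_eq \<Omega> (f v) v \<longrightarrow> ae_eq \<Omega> v w) \<and>
    (\<forall>u\<in>F. (\<lambda>n. Linf_norm \<Omega> (\<lambda>x. (f ^^ n) u x - w x)) \<longlonglongrightarrow> 0)"
proof -
  define \<delta> where "\<delta> = (\<lambda>u v. Linf_norm \<Omega> (\<lambda>x. u x - v x :: 'b))"
  have FL: "u \<in> Linf \<Omega>" if "u \<in> F" for u using F(1) that by blast
  have \<delta>0: "0 \<le> \<delta> u v" if "u \<in> F" "v \<in> F" for u v
    unfolding \<delta>_def by (rule Linf_norm_bound(1)[OF \<Omega> Linf_diff[OF FL FL]]) fact+
  have tri: "\<delta> u w \<le> \<delta> u v + \<delta> v w" if "u \<in> F" "v \<in> F" "w \<in> F" for u v w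
    unfolding \<delta>_def by (rule Linf_norm_triangle[OF \<Omega> FL FL FL]) fact+
  have sym: "\<delta> u v = \<delta> v u" for u v unfolding \<delta>_def by (rule Linf_norm_commute)
  have lip': "\<delta> ((f ^^ m) u) ((f ^^ m) v) \<le> \<rho> m * \<delta> u v" if "u \<in> F" "v \<in> F" for u v m
    unfolding \<delta>_def using lip that by blast
  have ae: "ae_eq \<Omega> u v" if "u \<in> F" "v \<in> F" "\<delta> u v \<le> 0" for u v
    using Linf_norm_eq_0_imp_ae_eq[OF \<Omega> FL FL] that unfolding \<delta>_def by blast
  have iter: "(f ^^ n) u \<in> F" if "u \<in> F" for u n
    using that F(3) by (induction n) auto
  define R where "R = (\<Sum>i<m. \<rho> i)"
  define d where "d = (\<lambda>n. \<rho> m ^ (n div m) * (R * D))"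
  have R: "0 \<le> R" "\<And>i. i < m \<Longrightarrow> \<rho> i \<le> R"
    unfolding R_def using \<rho> by (auto intro!: sum_nonneg member_le_sum)
  have pow: "\<delta> ((f ^^ (q * m)) u) ((f ^^ (q * m)) v) \<le> \<rho> m ^ q * \<delta> u v" if "u \<in> F" "v \<in> F" for q u v
  proof (induction q)
    case (Suc q)
    have "\<delta> ((f ^^ (Suc q * m)) u) ((f ^^ (Suc q * m)) v)
        \<le> \<rho> m * \<delta> ((f ^^ (q * m)) u) ((f ^^ (q * m)) v)"
      using lip'[OF iter[OF that(1)] iter[OF that(2)], where m = m] by (simp add: funpow_add)
    also have "\<dots> \<le> \<rho> m * (\<rho> m ^ q * \<delta> u v)" by (intro mult_left_mono Suc \<rho>)
    finally show ?case by simp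
  qed simp
  have contr: "\<delta> ((f ^^ n) u) ((f ^^ n) v) \<le> d n" if "u \<in> F" "v \<in> F" for n u v
  proof -
    have n: "n = (n div m) * m + n mod m" by simp
    have "\<delta> ((f ^^ n) u) ((f ^^ n) v)
        \<le> \<rho> m ^ (n div m) * \<delta> ((f ^^ (n mod m)) u) ((f ^^ (n mod m)) v)"
      using pow[OF iter[OF that(1)] iter[OF that(2)], of "n div m"]
      by (subst (1 2) n) (simp only: funpow_add o_apply)
    also have "\<delta> ((f ^^ (n mod m)) u) ((f ^^ (n mod m)) v) \<le> \<rho> (n mod m) * \<delta> u v"
      by (rule lip'[OF that])
    also have "\<rho> (n mod m) * \<delta> u v \<le> R * D"
      using R(1) R(2)[of "n mod m"] m \<delta>0[OF that] diam[OF that]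
      by (intro mult_mono) (auto simp: \<delta>_def)
    finally show ?thesis using \<rho>[of m] by (simp add: d_def mult_left_mono)
  qed
  have d: "d \<longlonglongrightarrow> 0"
  proof -
    have "(\<lambda>n. \<rho> m ^ (n div m)) \<longlonglongrightarrow> 0"
      by (rule filterlim_compose[OF LIMSEQ_power_zero filterlim_at_top_div_const_nat]) (use m \<rho>[of m] in auto)
    then show ?thesis unfolding d_def by (rule tendsto_mult_left_zero)
  qed
  obtain u0 where u0: "u0 \<in> F" using F(2) by blast
  define u where "u = (\<lambda>n. (f ^^ n) u0)"
  have uF: "u n \<in> F" for n unfolding u_def by (rule iter[OF u0])
  have "Linf_norm \<Omega> (\<lambda>x. u (n + k) x - u n x) \<le> d n" for n k
    using contr[OF iter[OF u0] u0, of n k] unfolding \<delta>_def u_def by (simp add: funpow_add)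
  then obtain w where wL: "w \<in> Linf \<Omega>" and w: "\<And>n. Linf_norm \<Omega> (\<lambda>x. w x - u n x) \<le> d n"
    by (rule Linf_complete[OF \<Omega> FL[OF uF] d]) (rule that)
  have wF: "w \<in> F" by (rule closed[OF uF wL d w])
  have wu: "\<delta> w (u n) \<le> d n" for n unfolding \<delta>_def by (rule w)
  have fw: "f w \<in> F" using F(3) wF by blast
  have "\<delta> (f w) w \<le> \<rho> 1 * d n + d (Suc n)" for n
  proof -
    have "\<delta> (f w) w \<le> \<delta> (f w) (u (Suc n)) + \<delta> (u (Suc n)) w" by (rule tri[OF fw uF wF])
    also have "\<delta> (f w) (u (Suc n)) \<le> \<rho> 1 * \<delta> w (u n)"
      using lip'[OF wF uF, of 1 n] by (simp add: u_def)
    also have "\<rho> 1 * \<delta> w (u n) \<le> \<rho> 1 * d n" by (intro mult_left_mono wu \<rho>)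
    also have "\<delta> (u (Suc n)) w \<le> d (Suc n)" using wu[of "Suc n"] by (simp add: sym)
    finally show ?thesis by simp
  qed
  moreover have "(\<lambda>n. \<rho> 1 * d n + d (Suc n)) \<longlonglongrightarrow> \<rho> 1 * 0 + 0"
    by (intro tendsto_intros d LIMSEQ_Suc)
  ultimately have fw0: "\<delta> (f w) w \<le> 0"
    using LIMSEQ_le_const[of "\<lambda>n. \<rho> 1 * d n + d (Suc n)" 0 "\<delta> (f w) w"] by auto
  have fixed: "\<delta> ((f ^^ n) v) v \<le> 0" if v: "v \<in> F" and "\<delta> (f v) v \<le> 0" for v n
  proof (induction n)
    case 0
    show ?case unfolding \<delta>_def using Linf_normI[OF \<Omega>, of "\<lambda>_. 0 :: 'b" 0] by simp
  next
    case (Suc n)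
    have fv: "f v \<in> F" using F(3) v by blast
    have "\<delta> ((f ^^ Suc n) v) v \<le> \<delta> ((f ^^ n) (f v)) ((f ^^ n) v) + \<delta> ((f ^^ n) v) v"
      using tri[OF iter[OF fv] iter[OF v] v, of n n] by (simp add: funpow_swap1)
    also have "\<delta> ((f ^^ n) (f v)) ((f ^^ n) v) \<le> \<rho> n * \<delta> (f v) v" by (rule lip'[OF fv v])
    also have "\<rho> n * \<delta> (f v) v \<le> 0" using that(2) \<rho>[of n] by (simp add: mult_nonneg_nonpos)
    finally show ?case using Suc by simp
  qed
  have to_w: "\<delta> ((f ^^ n) v) w \<le> d n" if v: "v \<in> F" for v n
  proof -
    have "\<delta> ((f ^^ n) v) w \<le> \<delta> ((f ^^ n) v) ((f ^^ n) w) + \<delta> ((f ^^ n) w) w"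
      by (rule tri[OF iter[OF v] iter[OF wF] wF])
    then show ?thesis using contr[OF v wF, of n] fixed[OF wF fw0, of n] by simp
  qed
  show ?thesis
  proof (intro bexI[OF _ wF] conjI ballI impI)
    show "ae_eq \<Omega> (f w) w" by (rule ae[OF fw wF fw0])
    fix v assume v: "v \<in> F"
    show "(\<lambda>n. Linf_norm \<Omega> (\<lambda>x. (f ^^ n) v x - w x)) \<longlonglongrightarrow> 0"
      using to_w[OF v] \<delta>0[OF iter[OF v] wF] unfolding \<delta>_def
      by (intro tendsto_sandwich[OF _ _ tendsto_const d] always_eventually) auto
    assume "ae_eq \<Omega> (f v) v"
    then have "\<delta> (f v) v \<le> 0"
      unfolding \<delta>_def using ae_eq_imp_Linf_norm_eq_0[OF \<Omega> FL FL] F(3) v by (simp add: image_subset_iff)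
    have "\<delta> v w \<le> d n" for n
    proof -
      have "\<delta> v w \<le> \<delta> v ((f ^^ n) v) + \<delta> ((f ^^ n) v) w" by (rule tri[OF v iter[OF v] wF])
      then show ?thesis using fixed[OF v \<open>\<delta> (f v) v \<le> 0\<close>, of n] to_w[OF v, of n] by (simp add: sym)
    qed
    then have "\<delta> v w \<le> 0" by (intro LIMSEQ_le_const[OF d]) auto
    then show "ae_eq \<Omega> v w" by (rule ae[OF v wF])
  qed
qed

section \<open>Sections of the control matrix\<close>

text \<open>
  Fubini's theorem for null sets, in both orders.
\<close>

lemma negligible_imp_ae_section_negligible:
  fixes N :: "('a::euclidean_space \<times> 'b::euclidean_space) set"
  assumes "negligible N"
  shows "\<exists>Y. negligible Y \<and> (\<forall>y. y \<notin> Y \<longrightarrow> negligible {x. (x, y) \<in> N})"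
    and "\<exists>X. negligible X \<and> (\<forall>x. x \<notin> X \<longrightarrow> negligible {y. (x, y) \<in> N})"
proof -
  obtain N' where N': "N' \<in> null_sets lborel" "N \<subseteq> N'"
    using assms unfolding negligible_iff_null_sets null_sets_completion_iff2 by blast
  have ae: "AE p in lborel \<Otimes>\<^sub>M lborel. p \<notin> N'"
    unfolding lborel_prod using N'(1) by (rule AE_not_in)
  have null: "negligible A" if "AE x in lborel. x \<notin> A" for A :: "'c::euclidean_space set"
  proof -
    have "AE x in lebesgue. x \<notin> A" using that by (rule AE_completion)
    then obtain Z where "Z \<in> null_sets lebesgue" "{x \<in> space lebesgue. \<not> x \<notin> A} \<subseteq> Z"
      unfolding eventually_ae_filter by blast
    then show ?thesis using negligible_subset[of Z A] by (simp add: negligible_iff_null_sets)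
  qed
  have exc: "\<exists>Z. negligible Z \<and> (\<forall>x. x \<notin> Z \<longrightarrow> Q x)" if "AE x in lborel. Q x" for Q :: "'c::euclidean_space \<Rightarrow> bool"
    using null[of "{x. \<not> Q x}"] that by auto
  have sub: "negligible {y. (x, y) \<in> N}" if "AE y in lborel. (x, y) \<notin> N'" for x
    using null[of "{y. (x, y) \<in> N'}"] that N'(2) by (auto intro: negligible_subset)
  have sub': "negligible {x. (x, y) \<in> N}" if "AE x in lborel. (x, y) \<notin> N'" for y
    using null[of "{x. (x, y) \<in> N'}"] that N'(2) by (auto intro: negligible_subset)
  have "AE x in lborel. AE y in lborel. (x, y) \<notin> N'" using lborel_pair.AE_pair[OF ae] .
  from exc[OF this] show "\<exists>X. negligible X \<and> (\<forall>x. x \<notin> X \<longrightarrow> negligible {y. (x, y) \<in> N})"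
    using sub by blast
  have "N' \<in> sets (lborel \<Otimes>\<^sub>M lborel)" using N'(1) unfolding lborel_prod by auto
  then have "{p \<in> space (lborel \<Otimes>\<^sub>M lborel). (case p of (x, y) \<Rightarrow> (x, y) \<notin> N')} \<in> sets (lborel \<Otimes>\<^sub>M lborel)"
    using sets.Diff[OF sets.top[of "lborel \<Otimes>\<^sub>M lborel"], of N'] by (simp add: set_diff_eq case_prod_unfold)
  then have "AE y in lborel. AE x in lborel. (x, y) \<notin> N'"
    using lborel_pair.AE_commute[of "\<lambda>x y. (x, y) \<notin> N'"] \<open>AE x in lborel. AE y in lborel. (x, y) \<notin> N'\<close>
    by (simp add: case_prod_unfold)
  from exc[OF this] show "\<exists>Y. negligible Y \<and> (\<forall>y. y \<notin> Y \<longrightarrow> negligible {x. (x, y) \<in> N})"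
    using sub' by blast
qed

lemma not_negligible_dense:
  fixes Y :: "'a::euclidean_space set"
  assumes "negligible Y" "open U" "U \<noteq> {}"
  obtains y where "y \<in> U" "y \<notin> Y"
proof -
  have "\<not> U \<subseteq> Y" using assms open_not_negligible negligible_subset by blast
  then show thesis using that by blast
qed

text \<open>
  Joint measurability makes the section at \<open>x\<close> measurable for almost every \<open>x\<close> only. These \<open>x\<close> are
  dense, and continuity in \<open>x\<close> transfers measurability to all sections.
\<close>

lemma measurable_section:
  fixes f :: "'a::euclidean_space \<Rightarrow> 'b::euclidean_space \<Rightarrow> 'c::euclidean_space"
  assumes f: "(\<lambda>(t, x). f t x) \<in> borel_measurable (lebesgue_on (J \<times> UNIV))"
    and J: "open J" and cont: "\<And>t. t \<in> J \<Longrightarrow> continuous_on UNIV (f t)"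
  shows "(\<lambda>t. f t x) \<in> borel_measurable (lebesgue_on J)"
proof -
  have JU: "J \<times> (UNIV :: 'b set) \<in> sets lebesgue" "J \<in> sets lebesgue"
    using J by (auto intro!: sets_completionI_sets borel_open open_Times simp del: sets_completionI_sets)
  then obtain N g where N: "negligible N" and g: "\<And>n. continuous_on UNIV (g n)"
    and lim: "\<And>p. p \<notin> N \<Longrightarrow> (\<lambda>n. g n p) \<longlonglongrightarrow> (if p \<in> J \<times> UNIV then case p of (t, x) \<Rightarrow> f t x else 0)"
    using f measurable_on_iff_borel_measurable[OF JU(1), of "\<lambda>(t, x). f t x"] unfolding measurable_on_def by blast
  obtain Y where Y: "negligible Y" "\<And>y. y \<notin> Y \<Longrightarrow> negligible {t. (t, y) \<in> N}"
    using negligible_imp_ae_section_negligible(1)[OF N] by blast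
  have good: "(\<lambda>t. f t y) \<in> borel_measurable (lebesgue_on J)" if y: "y \<notin> Y" for y
  proof -
    have "(\<lambda>t. f t y) measurable_on J"
      unfolding measurable_on_def
    proof (intro exI[of _ "{t. (t, y) \<in> N}"] exI[of _ "\<lambda>n t. g n (t, y)"] conjI allI impI)
      show "negligible {t. (t, y) \<in> N}" by (rule Y(2)[OF y])
      show "continuous_on UNIV (\<lambda>t. g n (t, y))" for n
        by (intro continuous_on_compose2[OF g] continuous_intros) auto
      show "(\<lambda>n. g n (t, y)) \<longlonglongrightarrow> (if t \<in> J then f t y else 0)" if "t \<notin> {t. (t, y) \<in> N}" for t
        using lim[of "(t, y)"] that by auto
    qed
    then show ?thesis using measurable_on_iff_borel_measurable[OF JU(2)] by blast
  qed
  have "\<exists>y. y \<notin> Y \<and> dist y x < inverse (real (Suc n))" for n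
    using not_negligible_dense[OF Y(1) open_ball, of x "inverse (real (Suc n))"] by (auto simp: dist_commute)
  then obtain y where y: "\<And>n. y n \<notin> Y" "\<And>n. dist (y n) x < inverse (real (Suc n))" by metis
  have "(\<lambda>n. dist (y n) x) \<longlonglongrightarrow> 0"
  proof (rule Lim_null_comparison[OF _ LIMSEQ_inverse_real_of_nat])
    show "\<forall>\<^sub>F n in sequentially. norm (dist (y n) x) \<le> inverse (real (Suc n))"
      using y(2) by (intro always_eventually allI) (simp add: less_imp_le del: of_nat_Suc)
  qed
  then have yx: "y \<longlonglongrightarrow> x" by (simp add: tendsto_dist_iff[of y])
  show ?thesis
  proof (rule borel_measurable_LIMSEQ_metric[OF good[OF y(1)]])
    fix t assume "t \<in> space (lebesgue_on J)"
    then have "continuous_on UNIV (f t)" by (intro cont) simp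
    from continuous_on_tendsto_compose[OF this yx] show "(\<lambda>n. f t (y n)) \<longlonglongrightarrow> f t x" by simp
  qed
qed

lemma bounded_linear_mat_op: "bounded_linear (mat_op :: real^'n^'m \<Rightarrow> _)"
  unfolding linear_conv_bounded_linear[symmetric]
  by (rule linearI) (auto intro!: blinfun_eqI simp: blinfun.add_left blinfun.scaleR_left
      matrix_vector_mult_add_rdistrib scaleR_matrix_vector_assoc)

lemma control_matrix_section_measurable:
  assumes B: "admissible_control_matrix t0 T L B"
  shows "(\<lambda>t. B t x) \<in> borel_measurable (lebesgue_on {t0<..<T})"
proof (rule measurable_section)
  show "(\<lambda>(t, x). B t x) \<in> borel_measurable (lebesgue_on ({t0<..<T} \<times> UNIV))"
    using B by (simp add: admissible_control_matrix_def Linf_def)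
  fix t assume t: "t \<in> {t0<..<T}"
  have "(\<lambda>x. mat_op (B t x)) differentiable (at x)" for x
    using B t by (auto simp: admissible_control_matrix_def C1_def)
  then have cont: "continuous_on UNIV (\<lambda>x. mat_op (B t x))"
    by (simp add: differentiable_imp_continuous_within continuous_on_eq_continuous_within)
  have "continuous_on UNIV (\<lambda>x. B t x $ i $ j)" for i j
  proof -
    have "continuous_on UNIV (\<lambda>x. blinfun_apply (mat_op (B t x)) (axis j 1) $ i)"
      by (intro continuous_intros cont)
    then show ?thesis by (simp add: matrix_vector_mult_basis column_def)
  qed
  then show "continuous_on UNIV (B t)" by (intro continuous_on_vec_lambda[where f = "\<lambda>i x. B t x $ i", simplified]
     continuous_on_vec_lambda[where f = "\<lambda>j x. B t x $ i $ j" for i, simplified])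
qed simp

lemma control_matrix_lipschitz:
  assumes B: "admissible_control_matrix t0 T L B" and t: "t \<in> {t0<..<T}"
  shows "norm (B t x *v w - B t y *v w) \<le> L * norm (x - y) * norm w"
proof -
  have "norm (mat_op (B t x) - mat_op (B t y)) \<le> L * norm (x - y)"
    using B t by (intro fderiv_bound_imp_lipschitz) (auto simp: admissible_control_matrix_def C1_def)
  then have "norm (blinfun_apply (mat_op (B t x) - mat_op (B t y)) w) \<le> L * norm (x - y) * norm w"
    by (meson mult_right_mono norm_blinfun norm_ge_zero order_trans)
  then show ?thesis by (simp add: blinfun.diff_left)
qed

text \<open>
  The essential supremum over \<open>(t, x)\<close> bounds \<open>B t x\<close> for almost all \<open>(t, x)\<close>. By continuity in \<open>x\<close>
  the bound holds for almost every \<open>t\<close> and all \<open>x\<close>, in particular along trajectories, whose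
  graphs are null sets of the product space.
\<close>

lemma control_matrix_bound:
  fixes B :: "real \<Rightarrow> real^'d \<Rightarrow> real^'k^'d"
  assumes B: "admissible_control_matrix t0 T L B" and tT: "t0 < T"
  shows "0 \<le> control_matrix_norm t0 T B"
    "\<exists>Z. negligible Z \<and> (\<forall>t\<in>{t0<..<T} - Z. \<forall>x w. norm (B t x *v w) \<le> control_matrix_norm t0 T B * norm w)"
proof -
  let ?S = "{t0<..<T} \<times> (UNIV :: (real^'d) set)" and ?\<beta> = "control_matrix_norm t0 T B"
  define g where "g = (\<lambda>(t, x). spectral_norm (B t x))"
  have op: "open ?S" by (intro open_Times) auto
  then have S: "?S \<in> sets lebesgue" by (simp add: borel_open)
  have "?S \<noteq> {}" using tT by auto
  with op have S': "\<not> negligible ?S" by (rule open_not_negligible)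
  note S = S S'
  obtain c where Bm: "(\<lambda>(t, x). B t x) \<in> borel_measurable (lebesgue_on ?S)"
    and c: "AE p in lebesgue_on ?S. norm ((\<lambda>(t, x). B t x) p) \<le> c"
    using B unfolding admissible_control_matrix_def Linf_def by blast
  obtain K where K: "\<And>A :: real^'k^'d. norm (mat_op A) \<le> norm A * K" "0 < K"
    using bounded_linear.pos_bounded[OF bounded_linear_mat_op] by blast
  have g0: "0 \<le> g p" for p by (simp add: g_def spectral_norm_nonneg split: prod.split)
  have "continuous_on UNIV (spectral_norm :: real^'k^'d \<Rightarrow> real)"
    unfolding spectral_norm_def using bounded_linear_mat_op
    by (intro continuous_on_norm linear_continuous_on)
  then have "(spectral_norm :: real^'k^'d \<Rightarrow> real) \<in> borel_measurable borel" by (rule borel_measurable_continuous_onI)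
  from measurable_compose[OF Bm this]
  have gm: "g \<in> borel_measurable (lebesgue_on ?S)" by (simp add: g_def case_prod_unfold)
  have gb: "AE p in lebesgue_on ?S. g p \<le> c * K"
    using c
  proof eventually_elim
    case (elim p)
    have "g p \<le> norm ((\<lambda>(t, x). B t x) p) * K" by (simp add: g_def spectral_norm_def K split: prod.split)
    also have "\<dots> \<le> c * K" using elim K(2) by (intro mult_right_mono) auto
    finally show ?case .
  qed
  have \<beta>: "?\<beta> = ess_sup ?S g" by (simp add: control_matrix_norm_def g_def)
  show "0 \<le> ?\<beta>" unfolding \<beta> by (rule ess_sup_bounded(1)[OF S gm g0 gb])
  have "\<exists>N. negligible N \<and> (\<forall>p\<in>?S - N. g p \<le> ?\<beta>)"
    using ess_sup_bounded(3)[OF S gm g0 gb] unfolding \<beta> by (simp only: AE_lebesgue_on_iff_negligible[OF S(1)])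
  then obtain N where N: "negligible N" and le: "\<And>p. p \<in> ?S - N \<Longrightarrow> g p \<le> ?\<beta>"
    by metis
  obtain Z where Z: "negligible Z" "\<And>t. t \<notin> Z \<Longrightarrow> negligible {x. (t, x) \<in> N}"
    using negligible_imp_ae_section_negligible(2)[OF N] by blast
  have "norm (B t x *v w) \<le> ?\<beta> * norm w" if t: "t \<in> {t0<..<T} - Z" for t x w
  proof (rule ccontr)
    assume "\<not> ?thesis"
    then have x: "?\<beta> * norm w < norm (B t x *v w)" by simp
    let ?U = "{x. ?\<beta> * norm w < norm (B t x *v w)}"
    have "(\<lambda>x. mat_op (B t x)) differentiable (at x)" for x
      using B t by (auto simp: admissible_control_matrix_def C1_def)
    then have cont: "continuous_on UNIV (\<lambda>x. mat_op (B t x))"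
      by (simp add: differentiable_imp_continuous_within continuous_on_eq_continuous_within)
    have "continuous_on UNIV (\<lambda>x. norm (blinfun_apply (mat_op (B t x)) w))"
      by (intro continuous_intros cont)
    then have "continuous_on UNIV (\<lambda>x. norm (B t x *v w))" by simp
    then have "open ?U" by (intro open_Collect_less continuous_on_const)
    moreover have "negligible {x. (t, x) \<in> N}" using Z(2) t by simp
    moreover have "?U \<noteq> {}" using x by blast
    ultimately obtain z where z: "z \<in> ?U" "z \<notin> {x. (t, x) \<in> N}"
      using not_negligible_dense by metis
    then have "spectral_norm (B t z) \<le> ?\<beta>" using le[of "(t, z)"] t z(2) by (simp add: g_def)
    then have "norm (B t z *v w) \<le> ?\<beta> * norm w"
      using norm_matrix_vector_mul_le[of "B t z" w] by (meson mult_right_mono norm_ge_zero order_trans)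
    then show False using z(1) by simp
  qed
  then show "\<exists>Z. negligible Z \<and> (\<forall>t\<in>{t0<..<T} - Z. \<forall>x w. norm (B t x *v w) \<le> ?\<beta> * norm w)"
    using Z(1) by blast
qed

section \<open>The coefficients of the iteration\<close>

lemma continuous_on_zseq: "continuous_on {0..1} (zseq p m)"
proof (induction m)
  case (Suc m)
  then have "continuous_on {0..1} (\<lambda>y. integral {0..y} (zseq p m))"
    by (intro indefinite_integral_continuous_1 integrable_continuous_interval)
  then show ?case by (auto intro!: continuous_intros)
qed simp

lemma integral_one_minus: "integral {0..1::real} (\<lambda>r. (1 - r) * c) = c / 2"
proof -
  have "((\<lambda>r. (1 - r) * c) has_integral (1 - 1\<^sup>2 / 2) * c - (0 - 0\<^sup>2 / 2) * c) {0..1::real}"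
    by (rule fundamental_theorem_of_calculus)
      (auto intro!: derivative_eq_intros simp flip: has_real_derivative_iff_has_vector_derivative)
  from integral_unique[OF this] show ?thesis by (simp add: power2_eq_square)
qed

text \<open>
  If \<open>c \<le> z\<^sub>m \<le> d\<close> then \<open>z\<^sub>m\<^sub>+\<^sub>1\<close> is at least \<open>p\<close> times the second integral, which is at least
  \<open>c / 2\<close>, and at most \<open>(1 - p) d + p d / 2\<close>. The lower bound yields positivity and the upper bound
  convergence to 0.
\<close>

lemma zseq_bounds:
  assumes p: "0 < p" "p < 1" and y: "y \<in> {0..1}"
  shows "(p / 2) ^ m \<le> zseq p m y" "zseq p m y \<le> (1 - p / 2) ^ m"
proof -
  have "\<forall>y\<in>{0..1}. (p / 2) ^ m \<le> zseq p m y \<and> zseq p m y \<le> (1 - p / 2) ^ m"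
  proof (induction m)
    case (Suc m)
    define c d where "c = (p / 2) ^ m" and "d = (1 - p / 2) ^ m"
    have cd: "0 \<le> c" "0 \<le> d" using p by (auto simp: c_def d_def)
    have z: "c \<le> zseq p m r" "zseq p m r \<le> d" if "r \<in> {0..1}" for r
      using Suc that by (auto simp: c_def d_def)
    note cont = continuous_on_zseq[of p m]
    have int: "(\<lambda>r. (1 - r) * zseq p m r) integrable_on {0..1}"
      by (intro integrable_continuous_interval continuous_intros cont)
    have int': "(\<lambda>r. (1 - r) * k) integrable_on {0..1}" for k :: real
      by (intro integrable_continuous_interval continuous_intros)
    let ?I = "integral {0..1} (\<lambda>r. (1 - r) * zseq p m r)"
    have I: "c / 2 \<le> ?I" "?I \<le> d / 2"
      unfolding integral_one_minus[symmetric]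
      by (rule integral_le[OF int' int] integral_le[OF int int']; use z in \<open>auto intro!: mult_left_mono\<close>)+
    show ?case
    proof
      fix y :: real assume y: "y \<in> {0..1}"
      let ?Z = "integral {0..y} (zseq p m)"
      have zi: "zseq p m integrable_on {0..y}"
        using y by (intro integrable_continuous_interval continuous_on_subset[OF cont]) auto
      have "0 \<le> ?Z"
        using y by (intro integral_nonneg zi) (auto intro: order_trans[OF cd(1) z(1)])
      moreover have "?Z \<le> d"
      proof -
        have "?Z \<le> integral {0..y} (\<lambda>_. d)" using y z by (intro integral_le zi) auto
        also have "\<dots> = y * d" using y by simp
        also have "\<dots> \<le> d" using y cd by (simp add: mult_left_le_one_le)
        finally show ?thesis .
      qed
      ultimately have "0 \<le> (1 - p) * ?Z" "(1 - p) * ?Z \<le> (1 - p) * d"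
        using p by (auto intro!: mult_left_mono)
      moreover have "p * (c / 2) \<le> p * ?I" "p * ?I \<le> p * (d / 2)"
        using p I by (auto intro!: mult_left_mono)
      moreover have "p * (c / 2) = (p / 2) ^ Suc m" "(1 - p) * d + p * (d / 2) = (1 - p / 2) ^ Suc m"
        by (simp_all add: c_def d_def algebra_simps)
      ultimately show "(p / 2) ^ Suc m \<le> zseq p (Suc m) y \<and> zseq p (Suc m) y \<le> (1 - p / 2) ^ Suc m"
        unfolding zseq.simps(2) by linarith
    qed
  qed simp
  then show "(p / 2) ^ m \<le> zseq p m y" "zseq p m y \<le> (1 - p / 2) ^ m" using y by auto
qed

lemma zseq_nonneg: "0 < p \<Longrightarrow> p < 1 \<Longrightarrow> y \<in> {0..1} \<Longrightarrow> 0 \<le> zseq p m y"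
  using zseq_bounds(1)[of p y m] by (meson order_trans zero_le_power half_gt_zero less_imp_le)

lemma gam_pos: "0 < p \<Longrightarrow> p < 1 \<Longrightarrow> 0 < gam p m"
  using zseq_bounds(1)[of p 1 m] by (simp add: gam_def) (meson less_le_trans zero_less_power half_gt_zero)

lemma gam_tendsto_0:
  assumes p: "0 < p" "p < 1"
  shows "gam p \<longlonglongrightarrow> 0"
proof (rule tendsto_sandwich)
  show "\<forall>\<^sub>F m in sequentially. 0 \<le> gam p m" using gam_pos[OF p] by (simp add: less_imp_le)
  show "\<forall>\<^sub>F m in sequentially. gam p m \<le> (1 - p / 2) ^ m" using zseq_bounds(2)[OF p] by (simp add: gam_def)
  show "(\<lambda>m. (1 - p / 2) ^ m) \<longlonglongrightarrow> 0" by (rule LIMSEQ_power_zero) (use p in auto)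
qed simp

lemma zseq_le_gam:
  assumes p: "0 < p" "p < 1" and y: "y \<in> {0..1}"
  shows "zseq p m y \<le> gam p m"
proof (cases m)
  case (Suc n)
  have i: "zseq p n integrable_on {0..y}" "zseq p n integrable_on {0..1}"
    using y by (auto intro!: integrable_continuous_interval continuous_on_subset[OF continuous_on_zseq])
  have "integral {0..y} (zseq p n) \<le> integral {0..1} (zseq p n)"
    using y i by (intro integral_subset_le) (auto intro!: zseq_nonneg p)
  then show ?thesis using p by (simp add: Suc gam_def)
qed (simp add: gam_def)

text \<open>
  Integration by parts against \<open>1 - y\<close>. This is where the weight in the recursion for \<open>z\<^sub>m\<close> comes
  from.
\<close>

lemma integral_indefinite_integral:
  fixes z :: "real \<Rightarrow> real"
  assumes z: "continuous_on {0..1} z"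
  shows "integral {0..1} (\<lambda>y. integral {0..y} z) = integral {0..1} (\<lambda>r. (1 - r) * z r)"
proof -
  let ?Z = "\<lambda>y. integral {0..y} z"
  have Z: "continuous_on {0..1} ?Z"
    by (intro indefinite_integral_continuous_1 integrable_continuous_interval z)
  have d: "(?Z has_real_derivative z y) (at y within {0..1})" if "y \<in> {0..1}" for y
    using integral_has_vector_derivative[OF z that] by (simp add: has_real_derivative_iff_has_vector_derivative)
  have "((\<lambda>y. (1 - y) * z y - ?Z y) has_integral (1 - 1) * ?Z 1 - (1 - 0) * ?Z 0) {0..1}"
  proof (rule fundamental_theorem_of_calculus)
    fix y :: real assume "y \<in> {0..1}"
    from d[OF this] have "((\<lambda>y. (1 - y) * ?Z y) has_real_derivative (1 - y) * z y - ?Z y) (at y within {0..1})"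
      by (auto intro!: derivative_eq_intros)
    then show "((\<lambda>y. (1 - y) * ?Z y) has_vector_derivative (1 - y) * z y - ?Z y) (at y within {0..1})"
      by (simp add: has_real_derivative_iff_has_vector_derivative)
  qed simp
  then have "integral {0..1} (\<lambda>y. (1 - y) * z y - ?Z y) = 0" by (simp add: integral_unique)
  moreover have "integral {0..1} (\<lambda>y. (1 - y) * z y - ?Z y) = integral {0..1} (\<lambda>y. (1 - y) * z y) - integral {0..1} ?Z"
    by (intro Henstock_Kurzweil_Integration.integral_diff integrable_continuous_interval continuous_intros z Z)
  ultimately show ?thesis by simp
qed

lemma integral_rescale:
  fixes z :: "real \<Rightarrow> real"
  assumes z: "continuous_on {0..1} z" and ab: "a < b" and t: "t \<in> {a..b}"
  shows "integral {a..t} (\<lambda>s. z ((s - a) / (b - a))) = (b - a) * integral {0..(t - a) / (b - a)} z"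
proof -
  let ?Z = "\<lambda>y. integral {0..y} z" and ?h = "\<lambda>s. (s - a) / (b - a)"
  have im: "?h ` {a..t} \<subseteq> {0..1}" using ab t by (auto simp: field_simps)
  have "((\<lambda>s. z (?h s)) has_integral (b - a) * ?Z (?h t) - (b - a) * ?Z (?h a)) {a..t}"
  proof (rule fundamental_theorem_of_calculus)
    fix s assume s: "s \<in> {a..t}"
    then have hs: "?h s \<in> {0..1}" using im by blast
    have "(?Z has_real_derivative z (?h s)) (at (?h s) within {0..1})"
      using integral_has_vector_derivative[OF z hs] by (simp add: has_real_derivative_iff_has_vector_derivative)
    then have "(?Z has_real_derivative z (?h s)) (at (?h s) within ?h ` {a..t})"
      by (rule DERIV_subset[OF _ im])
    moreover have "(?h has_real_derivative 1 / (b - a)) (at s within {a..t})"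
      using ab by (auto intro!: derivative_eq_intros)
    ultimately have "((\<lambda>s. ?Z (?h s)) has_real_derivative z (?h s) * (1 / (b - a))) (at s within {a..t})"
      by (rule DERIV_image_chain[unfolded o_def])
    then have "((\<lambda>s. (b - a) * ?Z (?h s)) has_real_derivative (b - a) * (z (?h s) * (1 / (b - a)))) (at s within {a..t})"
      by (rule DERIV_cmult)
    then show "((\<lambda>s. (b - a) * ?Z (?h s)) has_vector_derivative z (?h s)) (at s within {a..t})"
      using ab by (simp add: has_real_derivative_iff_has_vector_derivative)
  qed (use t in auto)
  then show ?thesis by (simp add: integral_unique)
qed

section \<open>Flow, Gramian and synthesis of a control system\<close>

text \<open>
  With \<open>\<Delta> = T - t0\<close>, \<open>\<beta> = \<parallel>B\<parallel>\<^sub>\<infinity>\<close> and \<open>r = \<bar>y\<bar>\<close>: \<open>g\<close> bounds the derivative of the flow, \<open>\<zeta>\<close> the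
  feasible controls, \<open>b\<close> the matrices \<open>P u t\<close>; \<open>l\<close> is the Lipschitz constant of \<open>P u t\<close> in the
  state, and \<open>\<alpha>\<close> that of the state in the control. The two products are the coefficients of the
  Volterra term and of the Gramian term; each is doubled because both terms carry the weight
  \<open>1/2\<close> in the recursion for \<open>p = 1/2\<close>, and 1 is added to make the constant positive.
\<close>

definition contraction_constant :: "real \<Rightarrow> real \<Rightarrow> real \<Rightarrow> real \<Rightarrow> real \<Rightarrow> real \<Rightarrow> real \<Rightarrow> real" where
  "contraction_constant \<Delta> \<beta> L \<Lambda>1 \<Lambda>2 C r =
    (let g = exp (\<Lambda>1 * \<Delta>); \<zeta> = C * \<beta> * g * r; b = g * \<beta>;
         l = \<Delta> * \<Lambda>2 * exp (3 * \<Lambda>1 * \<Delta>) * \<beta> + g * L;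
         \<alpha> = \<beta> * exp ((\<Lambda>1 + L * \<zeta>) * \<Delta>)
     in 1 + 2 * \<bar>l * C * r * (\<alpha> * \<Delta>)\<bar> + 2 * \<bar>l * C * r * (2 * b\<^sup>2 * C * (\<alpha> * \<Delta> * \<Delta>))\<bar>)"

lemma contraction_constant_pos: "0 < contraction_constant \<Delta> \<beta> L \<Lambda>1 \<Lambda>2 C r"
  unfolding contraction_constant_def Let_def by (intro add_pos_nonneg) auto

text \<open>
  The end time \<open>\<tau>\<close> of the flow may be any time of the interval, which covers both end points.
\<close>

locale control_system =
  fixes t0 T \<Lambda>1 \<Lambda>2 L C :: real
    and N :: "real \<Rightarrow> real^'d \<Rightarrow> real^'d" and B :: "real \<Rightarrow> real^'d \<Rightarrow> real^'k^'d"
    and x0 y :: "real^'d" and \<tau> :: real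
  assumes t0T: "t0 < T" and drift: "admissible_drift t0 T \<Lambda>1 \<Lambda>2 N"
    and control: "admissible_control_matrix t0 T L B"
    and nonneg: "0 \<le> \<Lambda>1" "0 \<le> \<Lambda>2" "0 \<le> L" and C: "0 < C" and \<tau>: "\<tau> \<in> {t0..T}"
begin

abbreviation "J \<equiv> {t0<..<T}"
abbreviation "\<beta> \<equiv> control_matrix_norm t0 T B"
abbreviation "state \<equiv> trajectory t0 T N B x0"
abbreviation "G \<equiv> gramian t0 T N B x0 \<tau>"
abbreviation "S \<equiv> synthesis t0 T N B x0 \<tau> y"
abbreviation "coercive_controls \<equiv> coercivity_class t0 T N B x0 \<tau> C"
abbreviation "feasible \<equiv> feasible_set t0 T N B \<Lambda>1 x0 \<tau> C y"

text \<open>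
  \<open>P u t\<close> maps an impulse of the control at time \<open>t\<close> to its first-order effect at time \<open>\<tau>\<close>. The
  Gramian and the synthesis map depend on the control through \<open>P\<close> only.
\<close>

definition "growth = exp (\<Lambda>1 * (T - t0))"
definition "\<zeta> = C * \<beta> * growth * norm y"
definition "P u t = flow_deriv t0 T N t \<tau> (state u t) ** B t (state u t)"
definition "P_bound = growth * \<beta>"
definition "P_lip = (T - t0) * \<Lambda>2 * exp (3 * \<Lambda>1 * (T - t0)) * \<beta> + growth * L"

lemma J_sets: "J \<in> sets lebesgue" "\<not> negligible J"
  using t0T open_not_negligible[of J] by auto

lemma \<beta>_nonneg: "0 \<le> \<beta>"
  by (rule control_matrix_bound(1)[OF control t0T])

lemma constants_nonneg: "0 < growth" "0 \<le> P_bound" "0 \<le> P_lip" "0 \<le> \<zeta>"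
  using \<beta>_nonneg nonneg t0T C by (auto simp: growth_def P_bound_def P_lip_def \<zeta>_def)

lemma AE_J_iff: "(AE t in lebesgue_on J. Q t) \<longleftrightarrow> (\<exists>Z. negligible Z \<and> (\<forall>t\<in>J - Z. Q t))"
  by (rule AE_lebesgue_on_iff_negligible) simp

lemma rhs_caratheodory:
  assumes u: "u \<in> borel_measurable (lebesgue_on J)" and U: "AE t in lebesgue_on J. norm (u t) \<le> U"
    and U0: "0 \<le> U"
  shows "caratheodory t0 T (\<Lambda>1 + L * U) (\<lambda>t x. N t x + B t x *v u t)"
proof -
  have "(\<lambda>t. B t x *v u t) \<in> borel_measurable (lebesgue_on J)" for x
  proof (rule measurable_compose_continuous[where f = "\<lambda>t w. B t x *v w" and x = u, OF _ u])
    fix w :: "real^'k"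
    have "(\<lambda>A :: real^'k^'d. A *v w) \<in> borel_measurable borel"
      by (intro borel_measurable_continuous_onI linear_continuous_on bounded_linear_matrix_vector_mul_left)
    from measurable_compose[OF control_matrix_section_measurable[OF control] this]
    show "(\<lambda>t. B t x *v w) \<in> borel_measurable (lebesgue_on J)" by simp
  next
    show "continuous_on UNIV (\<lambda>w. B t x *v w)" for t
      by (intro linear_continuous_on matrix_vector_mul_bounded_linear)
  qed
  moreover have "(\<lambda>t. N t x) \<in> borel_measurable (lebesgue_on J)" for x
    using drift by (simp add: admissible_drift_def Linf_def)
  ultimately have meas: "(\<lambda>t. N t x + B t x *v u t) \<in> borel_measurable (lebesgue_on J)" for x
    by (intro borel_measurable_add)
  obtain M Z1 where Z1: "negligible Z1" "\<And>t. t \<in> J - Z1 \<Longrightarrow> norm (N t 0) \<le> M"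
    using admissible_drift_caratheodory[OF drift] unfolding caratheodory_def by blast
  obtain Z2 where Z2: "negligible Z2" "\<And>t x w. t \<in> J - Z2 \<Longrightarrow> norm (B t x *v w) \<le> \<beta> * norm w"
    using control_matrix_bound(2)[OF control t0T] by blast
  obtain Z3 where Z3: "negligible Z3" "\<And>t. t \<in> J - Z3 \<Longrightarrow> norm (u t) \<le> U"
    using U unfolding AE_J_iff by blast
  have "norm (N t 0 + B t 0 *v u t) \<le> M + \<beta> * U"
    and "norm ((N t x + B t x *v u t) - (N t z + B t z *v u t)) \<le> (\<Lambda>1 + L * U) * norm (x - z)"
    if t: "t \<in> J - (Z1 \<union> Z2 \<union> Z3)" for t x z
  proof -
    have "norm (B t 0 *v u t) \<le> \<beta> * U"
      using Z2(2)[of t 0 "u t"] Z3(2)[of t] t \<beta>_nonneg by (meson DiffD1 DiffD2 DiffI UnCI mult_left_mono order_trans)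
    then show "norm (N t 0 + B t 0 *v u t) \<le> M + \<beta> * U"
      using Z1(2)[of t] t by (intro norm_triangle_le add_mono) auto
    have "norm (B t x *v u t - B t z *v u t) \<le> L * norm (x - z) * norm (u t)"
      using t by (intro control_matrix_lipschitz[OF control]) auto
    also have "\<dots> \<le> L * norm (x - z) * U"
      using Z3(2)[of t] t nonneg by (intro mult_left_mono) auto
    finally have "norm (B t x *v u t - B t z *v u t) \<le> L * U * norm (x - z)" by (simp add: mult_ac)
    moreover have "norm (N t x - N t z) \<le> \<Lambda>1 * norm (x - z)"
      using t by (intro admissible_drift_lipschitz[OF drift]) auto
    ultimately have "norm ((N t x - N t z) + (B t x *v u t - B t z *v u t)) \<le> \<Lambda>1 * norm (x - z) + L * U * norm (x - z)"
      by (intro norm_triangle_le add_mono)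
    then show "norm ((N t x + B t x *v u t) - (N t z + B t z *v u t)) \<le> (\<Lambda>1 + L * U) * norm (x - z)"
      by (simp add: algebra_simps)
  qed
  then show ?thesis
    unfolding caratheodory_def using meas Z1(1) Z2(1) Z3(1)
    by (intro conjI allI exI[of _ "Z1 \<union> Z2 \<union> Z3"] exI[of _ "M + \<beta> * U"] ballI) auto
qed

lemma state_equation:
  assumes u: "u \<in> Linf J"
  shows "continuous_on {t0..T} (state u)"
    "(\<lambda>t. N t (state u t) + B t (state u t) *v u t) integrable_on {t0..T}"
    "t \<in> {t0..T} \<Longrightarrow> state u t = x0 + integral {t0..t} (\<lambda>t. N t (state u t) + B t (state u t) *v u t)"
proof -
  have f: "caratheodory t0 T (\<Lambda>1 + L * Linf_norm J u) (\<lambda>t x. N t x + B t x *v u t)"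
    using u Linf_norm_bound[OF J_sets u] by (intro rhs_caratheodory) (auto simp: Linf_def)
  have t0: "t0 \<in> {t0..T}" using t0T by simp
  note eq = ode_flow_integral_equation[OF f t0, where x = x0]
  show "continuous_on {t0..T} (state u)" using eq(1) by (simp add: trajectory_def[abs_def])
  show "(\<lambda>t. N t (state u t) + B t (state u t) *v u t) integrable_on {t0..T}"
    using eq(2) by (simp add: trajectory_def[abs_def])
  show "t \<in> {t0..T} \<Longrightarrow> state u t = x0 + integral {t0..t} (\<lambda>t. N t (state u t) + B t (state u t) *v u t)"
    using eq(3)[of t] by (simp add: trajectory_def[abs_def])
qed

text \<open>
  The difference of the right-hand sides splits into the drift, the change of \<open>B\<close> with the state
  (which multiplies the bounded control \<open>u\<close>), and \<open>B\<close> applied to \<open>u - v\<close>, which is the forcing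
  term.
\<close>

lemma state_diff:
  assumes u: "u \<in> Linf J" and v: "v \<in> Linf J" and U: "AE t in lebesgue_on J. norm (u t) \<le> U" "0 \<le> U"
    and k: "continuous_on {t0..T} k" "\<And>t. t \<in> {t0..T} \<Longrightarrow> 0 \<le> k t"
    and uv: "AE t in lebesgue_on J. norm (u t - v t) \<le> k t" and t: "t \<in> {t0..T}"
  shows "norm (state u t - state v t) \<le> \<beta> * exp ((\<Lambda>1 + L * U) * (T - t0)) * integral {t0..t} k"
proof -
  define g where "g = (\<lambda>u t. N t (state u t) + B t (state u t) *v u t)"
  have gi: "g u integrable_on {t0..T}" "g v integrable_on {t0..T}"
    unfolding g_def by (rule state_equation(2)[OF u] state_equation(2)[OF v])+
  have st: "state u t = x0 + integral {t0..t} (g u)" "state v t = x0 + integral {t0..t} (g v)"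
    if "t \<in> {t0..T}" for t
    unfolding g_def using state_equation(3)[OF u that] state_equation(3)[OF v that] .
  have t0: "t0 \<in> {t0..T}" using t0T by simp
  obtain Z1 where Z1: "negligible Z1" "\<And>t x w. t \<in> J - Z1 \<Longrightarrow> norm (B t x *v w) \<le> \<beta> * norm w"
    using control_matrix_bound(2)[OF control t0T] by blast
  obtain Z2 where Z2: "negligible Z2" "\<And>t. t \<in> J - Z2 \<Longrightarrow> norm (u t) \<le> U"
    using U(1) unfolding AE_J_iff by blast
  obtain Z3 where Z3: "negligible Z3" "\<And>t. t \<in> J - Z3 \<Longrightarrow> norm (u t - v t) \<le> k t"
    using uv unfolding AE_J_iff by blast
  have Z: "negligible (Z1 \<union> Z2 \<union> Z3)" using Z1(1) Z2(1) Z3(1) by (simp add: negligible_Un)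
  have ki: "k integrable_on {t0..T}" using k(1) by (rule integrable_continuous_interval)
  have "norm (state u t - state v t)
      \<le> (norm (0 :: real^'d) + integral {min t0 t..max t0 t} (\<lambda>t. \<beta> * k t)) * exp ((\<Lambda>1 + L * U) * \<bar>t - t0\<bar>)"
  proof (rule gronwall_increment[where E = "\<lambda>t. state u t - state v t" and g = "\<lambda>t. g u t - g v t",
        OF _ _ _ _ _ Z t0 t])
    show "continuous_on {t0..T} (\<lambda>t. state u t - state v t)"
      by (intro continuous_intros state_equation u v)
    show "(\<lambda>t. g u t - g v t) integrable_on {t0..T}" by (intro integrable_diff gi)
    show "(\<lambda>t. \<beta> * k t) integrable_on {t0..T}" by (intro integrable_on_mult_right ki)
    show "0 \<le> \<beta> * k r" if "r \<in> {t0..T}" for r using that k(2) \<beta>_nonneg by simp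
    show "0 \<le> \<Lambda>1 + L * U" using nonneg U(2) by simp
    show "state u r - state v r = 0 + (integral {t0..r} (\<lambda>t. g u t - g v t) - integral {t0..t0} (\<lambda>t. g u t - g v t))"
      if r: "r \<in> {t0..T}" for r
    proof -
      have "integral {t0..r} (\<lambda>t. g u t - g v t) = integral {t0..r} (g u) - integral {t0..r} (g v)"
        using r by (intro Henstock_Kurzweil_Integration.integral_diff integrable_subinterval_real[OF gi(1)]
            integrable_subinterval_real[OF gi(2)]) auto
      then show ?thesis using st[OF r] by simp
    qed
    show "norm (g u r - g v r) \<le> (\<Lambda>1 + L * U) * norm (state u r - state v r) + \<beta> * k r"
      if r: "r \<in> J - (Z1 \<union> Z2 \<union> Z3)" for r
    proof -
      let ?x = "state u r" and ?z = "state v r"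
      have 1: "norm (N r ?x - N r ?z) \<le> \<Lambda>1 * norm (?x - ?z)"
        using r by (intro admissible_drift_lipschitz[OF drift]) auto
      have "norm (B r ?x *v u r - B r ?z *v u r) \<le> L * norm (?x - ?z) * norm (u r)"
        using r by (intro control_matrix_lipschitz[OF control]) auto
      also have "\<dots> \<le> L * norm (?x - ?z) * U"
        using Z2(2)[of r] r nonneg by (intro mult_left_mono) auto
      finally have 2: "norm (B r ?x *v u r - B r ?z *v u r) \<le> L * norm (?x - ?z) * U" .
      have "norm (B r ?z *v (u r - v r)) \<le> \<beta> * norm (u r - v r)" using r by (intro Z1(2)) auto
      also have "\<dots> \<le> \<beta> * k r" using Z3(2)[of r] r \<beta>_nonneg by (intro mult_left_mono) auto
      finally have 3: "norm (B r ?z *v (u r - v r)) \<le> \<beta> * k r" .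
      have split: "g u r - g v r = (N r ?x - N r ?z) + (B r ?x *v u r - B r ?z *v u r) + B r ?z *v (u r - v r)"
        by (simp add: g_def matrix_vector_mult_diff_distrib)
      have "norm (g u r - g v r) \<le> \<Lambda>1 * norm (?x - ?z) + L * norm (?x - ?z) * U + \<beta> * k r"
        unfolding split by (intro norm_triangle_le add_mono 1 2 3)
      also have "\<dots> = (\<Lambda>1 + L * U) * norm (?x - ?z) + \<beta> * k r" by (simp add: distrib_right)
      finally show ?thesis .
    qed
  qed
  also have "\<dots> = \<beta> * integral {t0..t} k * exp ((\<Lambda>1 + L * U) * (t - t0))"
    using t by (simp add: min_absorb1 max_absorb2)
  also have "\<dots> \<le> \<beta> * integral {t0..t} k * exp ((\<Lambda>1 + L * U) * (T - t0))"
  proof (rule mult_left_mono)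
    show "exp ((\<Lambda>1 + L * U) * (t - t0)) \<le> exp ((\<Lambda>1 + L * U) * (T - t0))"
      using t nonneg U(2) by (simp add: mult_left_mono)
    have "0 \<le> integral {t0..t} k"
      using t k(2) by (intro integral_nonneg integrable_subinterval_real[OF ki]) auto
    then show "0 \<le> \<beta> * integral {t0..t} k" using \<beta>_nonneg by simp
  qed
  finally show ?thesis by (simp add: mult_ac)
qed

text \<open>
  The exceptional set depends on \<open>B\<close> only, so the estimates can be applied to all controls
  simultaneously.
\<close>

lemma P_estimates:
  obtains Z where "negligible Z"
    "\<And>u t w. t \<in> J - Z \<Longrightarrow> norm (P u t *v w) \<le> P_bound * norm w"
    "\<And>u v t w. t \<in> J - Z \<Longrightarrow>
       norm ((P u t - P v t) *v w) \<le> P_lip * norm (state u t - state v t) * norm w"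
proof -
  obtain Z where Z: "negligible Z" and B: "\<And>t x w. t \<in> J - Z \<Longrightarrow> norm (B t x *v w) \<le> \<beta> * norm w"
    using control_matrix_bound(2)[OF control t0T] by blast
  define \<kappa> where "\<kappa> = (T - t0) * \<Lambda>2 * exp (3 * \<Lambda>1 * (T - t0))"
  have \<kappa>: "0 \<le> \<kappa>" using t0T nonneg by (simp add: \<kappa>_def)
  have D: "norm (flow_deriv t0 T N t \<tau> x *v h) \<le> growth * norm h"
    "norm (flow_deriv t0 T N t \<tau> x *v h - flow_deriv t0 T N t \<tau> z *v h) \<le> \<kappa> * norm h * norm (x - z)"
    if "t \<in> J" for t x z h
    using flow_deriv_bounds[OF drift nonneg(1,2) _ \<tau>, of t] that by (auto simp: growth_def \<kappa>_def)
  show thesis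
  proof (rule that[OF Z])
    fix u t and w :: "real^'k" assume t: "t \<in> J - Z"
    have "norm (P u t *v w) \<le> growth * norm (B t (state u t) *v w)"
      unfolding P_def matrix_vector_mul_assoc[symmetric] using t by (intro D) auto
    also have "\<dots> \<le> growth * (\<beta> * norm w)"
      using B[OF t] constants_nonneg(1) by (intro mult_left_mono) auto
    finally show "norm (P u t *v w) \<le> P_bound * norm w" by (simp add: P_bound_def)
  next
    fix u v t and w :: "real^'k" assume t: "t \<in> J - Z"
    let ?x = "state u t" and ?z = "state v t" and ?D = "flow_deriv t0 T N t \<tau>"
    have "norm (?D ?x *v (B t ?x *v w) - ?D ?z *v (B t ?x *v w)) \<le> \<kappa> * norm (B t ?x *v w) * norm (?x - ?z)"
      using t by (intro D) auto
    also have "\<dots> \<le> \<kappa> * (\<beta> * norm w) * norm (?x - ?z)"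
      using B[OF t] \<kappa> by (intro mult_right_mono mult_left_mono) auto
    finally have 1: "norm (?D ?x *v (B t ?x *v w) - ?D ?z *v (B t ?x *v w)) \<le> \<kappa> * (\<beta> * norm w) * norm (?x - ?z)" .
    have "norm (?D ?z *v (B t ?x *v w - B t ?z *v w)) \<le> growth * norm (B t ?x *v w - B t ?z *v w)"
      using t by (intro D) auto
    also have "\<dots> \<le> growth * (L * norm (?x - ?z) * norm w)"
      using t constants_nonneg(1) by (intro mult_left_mono control_matrix_lipschitz[OF control]) auto
    finally have 2: "norm (?D ?z *v (B t ?x *v w - B t ?z *v w)) \<le> growth * (L * norm (?x - ?z) * norm w)" .
    have split: "(P u t - P v t) *v w = (?D ?x *v (B t ?x *v w) - ?D ?z *v (B t ?x *v w))
        + ?D ?z *v (B t ?x *v w - B t ?z *v w)"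
      unfolding P_def matrix_vector_mult_diff_rdistrib matrix_vector_mult_diff_distrib
        matrix_vector_mul_assoc[symmetric] by simp
    have "norm ((P u t - P v t) *v w)
        \<le> \<kappa> * (\<beta> * norm w) * norm (?x - ?z) + growth * (L * norm (?x - ?z) * norm w)"
      unfolding split by (intro norm_triangle_le add_mono 1 2)
    also have "\<dots> = (\<kappa> * \<beta> + growth * L) * norm (?x - ?z) * norm w" by (simp add: distrib_right)
    also have "\<dots> = P_lip * norm (?x - ?z) * norm w" unfolding P_lip_def \<kappa>_def ..
    finally show "norm ((P u t - P v t) *v w) \<le> P_lip * norm (?x - ?z) * norm w" .
  qed
qed

lemma gramian_eq: "G u = (LINT t:{t0..T}|lebesgue. P u t ** transpose (P u t))"
  unfolding gramian_def P_def Let_def matrix_transpose_mul by (simp only: matrix_mul_assoc)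

lemma gramian_symmetric: "transpose (G u) = G u"
proof (cases "set_integrable lebesgue {t0..T} (\<lambda>t. P u t ** transpose (P u t))")
  case True
  have "bounded_linear (transpose :: real^'d^'d \<Rightarrow> real^'d^'d)"
    unfolding linear_conv_bounded_linear[symmetric]
    by (rule linearI) (simp_all add: transpose_def vec_eq_iff)
  from integral_bounded_linear[OF this True[unfolded set_integrable_def]]
  show ?thesis
    by (simp add: gramian_eq set_lebesgue_integral_def transpose_scalar matrix_transpose_mul)
next
  case False
  then show ?thesis
    by (simp add: gramian_eq set_lebesgue_integral_def set_integrable_def not_integrable_integral_eq)
      (simp add: transpose_def vec_eq_iff)
qed

lemma coercive_gramian:
  assumes "u \<in> coercive_controls"
  shows "inverse C * (w \<bullet> w) \<le> w \<bullet> (G u *v w)"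
  using assms by (intro lambda_min_coercive gramian_symmetric) (simp add: coercivity_class_def)

text \<open>
  A Bochner integral without integrability is 0, and the zero matrix is not coercive.
\<close>

lemma coercive_imp_integrable:
  assumes u: "u \<in> coercive_controls"
  shows "set_integrable lebesgue {t0..T} (\<lambda>t. P u t ** transpose (P u t))"
proof (rule ccontr)
  assume "\<not> ?thesis"
  then have "G u = 0"
    by (simp add: gramian_eq set_lebesgue_integral_def set_integrable_def not_integrable_integral_eq)
  then have "inverse C \<le> 0"
    using coercive_gramian[OF u, of "axis undefined 1"] by (simp add: inner_axis_axis)
  then show False using C by simp
qed

lemma gramian_apply:
  assumes "set_integrable lebesgue {t0..T} (\<lambda>t. P u t ** transpose (P u t))"
  shows "(\<lambda>t. P u t *v (transpose (P u t) *v w)) integrable_on {t0..T}"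
    "G u *v w = integral {t0..T} (\<lambda>t. P u t *v (transpose (P u t) *v w))"
proof -
  have i: "(\<lambda>t. P u t ** transpose (P u t)) integrable_on {t0..T}"
    and G: "G u = integral {t0..T} (\<lambda>t. P u t ** transpose (P u t))"
    unfolding gramian_eq using set_lebesgue_integral_eq_integral[OF assms] by auto
  have eq: "(\<lambda>A :: real^'d^'d. A *v w) \<circ> (\<lambda>t. P u t ** transpose (P u t)) = (\<lambda>t. P u t *v (transpose (P u t) *v w))"
    by (simp add: fun_eq_iff matrix_vector_mul_assoc del: transpose_matrix_vector)
  show "(\<lambda>t. P u t *v (transpose (P u t) *v w)) integrable_on {t0..T}"
    using integrable_linear[OF i bounded_linear_matrix_vector_mul_left, of w] unfolding eq .
  show "G u *v w = integral {t0..T} (\<lambda>t. P u t *v (transpose (P u t) *v w))"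
    using integral_linear[OF i bounded_linear_matrix_vector_mul_left, of w] unfolding eq G by simp
qed

lemma gramian_diff:
  assumes u: "u \<in> coercive_controls" and v: "v \<in> coercive_controls"
    and d: "d integrable_on {t0..T}" "\<And>t. t \<in> {t0..T} \<Longrightarrow> norm (state u t - state v t) \<le> d t"
  shows "norm (G u *v w - G v *v w) \<le> 2 * P_bound * P_lip * norm w * integral {t0..T} d"
proof -
  obtain Z where Z: "negligible Z" and Pb: "\<And>u t w. t \<in> J - Z \<Longrightarrow> norm (P u t *v w) \<le> P_bound * norm w"
    and Pl: "\<And>u v t w. t \<in> J - Z \<Longrightarrow> norm ((P u t - P v t) *v w) \<le> P_lip * norm (state u t - state v t) * norm w"
    using P_estimates by blast
  note Gu = gramian_apply[OF coercive_imp_integrable[OF u], of w]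
    and Gv = gramian_apply[OF coercive_imp_integrable[OF v], of w]
  have split: "G u *v w - G v *v w = integral {t0..T} (\<lambda>t. P u t *v (transpose (P u t) *v w) - P v t *v (transpose (P v t) *v w))"
    unfolding Gu(2) Gv(2) by (rule Henstock_Kurzweil_Integration.integral_diff[OF Gu(1) Gv(1), symmetric])
  have "norm (G u *v w - G v *v w) \<le> integral {t0..T} (\<lambda>t. 2 * P_bound * P_lip * norm w * d t)"
    unfolding split
  proof (rule integral_norm_bound_integral_ae[OF integrable_diff[OF Gu(1) Gv(1)] _ Z])
    show "(\<lambda>t. 2 * P_bound * P_lip * norm w * d t) integrable_on {t0..T}"
      by (rule integrable_on_mult_right[OF d(1)])
    fix t assume t: "t \<in> J - Z"
    then have dt: "norm (state u t - state v t) \<le> d t" by (intro d(2)) auto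
    then have d0: "0 \<le> d t" by (rule order_trans[OF norm_ge_zero])
    have "norm ((P u t - P v t) *v w) \<le> (P_lip * d t) * norm w" for w
      using Pl[OF t, of u v w] mult_right_mono[OF mult_left_mono[OF dt constants_nonneg(3)] norm_ge_zero[of w]]
      by linarith
    from gramian_integrand_diff[OF Pb[OF t] Pb[OF t] this constants_nonneg(2)] constants_nonneg(3) d0
    show "norm (P u t *v (transpose (P u t) *v w) - P v t *v (transpose (P v t) *v w)) \<le> 2 * P_bound * P_lip * norm w * d t"
      by (simp add: mult_ac)
  qed
  then show ?thesis by simp
qed

lemma synthesis_eq: "S u t = transpose (P u t) *v (pseudo_inverse (G u) *v y)"
  unfolding synthesis_def P_def Let_def matrix_transpose_mul matrix_vector_mul_assoc ..

lemma coercive_inverse_bound: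
  assumes "u \<in> coercive_controls"
  shows "norm (pseudo_inverse (G u) *v w) \<le> C * norm w"
  using coercive_pseudo_inverse(3)[OF _ coercive_gramian[OF assms], of w] C by (simp add: field_simps)

lemma synthesis_bound:
  assumes u: "u \<in> coercive_controls"
  shows "AE t in lebesgue_on J. norm (S u t) \<le> \<zeta>"
proof -
  obtain Z where Z: "negligible Z" and Pb: "\<And>u t w. t \<in> J - Z \<Longrightarrow> norm (P u t *v w) \<le> P_bound * norm w"
    by (rule P_estimates) (rule that)
  have "norm (S u t) \<le> \<zeta>" if t: "t \<in> J - Z" for t
  proof -
    have "norm (S u t) \<le> P_bound * norm (pseudo_inverse (G u) *v y)"
      unfolding synthesis_eq by (rule norm_transpose_mult_le[OF Pb[OF t]])
    also have "\<dots> \<le> P_bound * (C * norm y)"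
      by (intro mult_left_mono coercive_inverse_bound[OF u] constants_nonneg)
    finally show ?thesis by (simp add: P_bound_def \<zeta>_def mult_ac)
  qed
  with Z show ?thesis unfolding AE_J_iff by blast
qed

text \<open>
  With \<open>a\<close> and \<open>b\<close> the inverse Gramians of \<open>u\<close> and \<open>v\<close> applied to \<open>y\<close>, the difference splits into
  \<open>(P u t - P v t)\<^sup>T a\<close> and \<open>(P v t)\<^sup>T (a - b)\<close>, and the resolvent identity
  \<open>a - b = G(u)\<^sup>-\<^sup>1 (G v - G u) b\<close> reduces the latter to the difference of the Gramians.
\<close>

lemma synthesis_diff:
  assumes u: "u \<in> coercive_controls" and v: "v \<in> coercive_controls"
    and d: "d integrable_on {t0..T}" "\<And>t. t \<in> {t0..T} \<Longrightarrow> norm (state u t - state v t) \<le> d t"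
  shows "AE t in lebesgue_on J. norm (S u t - S v t)
    \<le> P_lip * C * norm y * (d t + 2 * P_bound\<^sup>2 * C * integral {t0..T} d)"
proof -
  obtain Z where Z: "negligible Z" and Pb: "\<And>u t w. t \<in> J - Z \<Longrightarrow> norm (P u t *v w) \<le> P_bound * norm w"
    and Pl: "\<And>u v t w. t \<in> J - Z \<Longrightarrow> norm ((P u t - P v t) *v w) \<le> P_lip * norm (state u t - state v t) * norm w"
    using P_estimates by blast
  define a where "a = pseudo_inverse (G u) *v y"
  define b where "b = pseudo_inverse (G v) *v y"
  have Ci: "0 < inverse C" using C by simp
  have ab: "norm a \<le> C * norm y" "norm b \<le> C * norm y"
    unfolding a_def b_def by (rule coercive_inverse_bound[OF u] coercive_inverse_bound[OF v])+
  have split: "a - b = pseudo_inverse (G u) *v (G v *v b - G u *v b)"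
    unfolding matrix_vector_mult_diff_distrib coercive_pseudo_inverse(2)[OF Ci coercive_gramian[OF u]]
    unfolding b_def coercive_pseudo_inverse(1)[OF Ci coercive_gramian[OF v]] by (simp add: a_def)
  have "norm (a - b) \<le> C * norm (G v *v b - G u *v b)"
    unfolding split by (rule coercive_inverse_bound[OF u])
  also have "norm (G v *v b - G u *v b) \<le> 2 * P_bound * P_lip * norm b * integral {t0..T} d"
    using gramian_diff[OF u v d, of b] by (simp add: norm_minus_commute)
  also have "\<dots> \<le> 2 * P_bound * P_lip * (C * norm y) * integral {t0..T} d"
  proof (intro mult_right_mono mult_left_mono ab)
    show "0 \<le> integral {t0..T} d"
      by (intro integral_nonneg d(1)) (rule order_trans[OF norm_ge_zero d(2)])
  qed (use constants_nonneg in auto)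
  finally have diff: "norm (a - b) \<le> C * (2 * P_bound * P_lip * (C * norm y) * integral {t0..T} d)"
    using C by simp
  have "norm (S u t - S v t) \<le> P_lip * C * norm y * (d t + 2 * P_bound\<^sup>2 * C * integral {t0..T} d)"
    if t: "t \<in> J - Z" for t
  proof -
    have "norm (transpose (P u t - P v t) *v a) \<le> P_lip * norm (state u t - state v t) * norm a"
      by (rule norm_transpose_mult_le[OF Pl[OF t]])
    also have "\<dots> \<le> P_lip * d t * (C * norm y)"
      using d(2)[of t] t constants_nonneg ab order_trans[OF norm_ge_zero d(2)[of t]]
      by (intro mult_mono mult_left_mono) auto
    finally have 1: "norm (transpose (P u t - P v t) *v a) \<le> P_lip * d t * (C * norm y)" .
    have "norm (transpose (P v t) *v (a - b)) \<le> P_bound * norm (a - b)"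
      by (rule norm_transpose_mult_le[OF Pb[OF t]])
    also have "\<dots> \<le> P_bound * (C * (2 * P_bound * P_lip * (C * norm y) * integral {t0..T} d))"
      by (intro mult_left_mono diff constants_nonneg)
    finally have 2: "norm (transpose (P v t) *v (a - b))
        \<le> P_bound * (C * (2 * P_bound * P_lip * (C * norm y) * integral {t0..T} d))" .
    have split: "S u t - S v t = transpose (P u t - P v t) *v a + transpose (P v t) *v (a - b)"
      by (simp add: synthesis_eq a_def[symmetric] b_def[symmetric] matrix_vector_mult_diff_rdistrib
          matrix_vector_mult_diff_distrib flip: transpose_diff del: transpose_matrix_vector)
    have "norm (S u t - S v t) \<le> P_lip * d t * (C * norm y)
        + P_bound * (C * (2 * P_bound * P_lip * (C * norm y) * integral {t0..T} d))"
      unfolding split by (intro norm_triangle_le add_mono 1 2)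
    also have "\<dots> = P_lip * C * norm y * (d t + 2 * P_bound\<^sup>2 * C * integral {t0..T} d)"
      by (simp add: power2_eq_square algebra_simps)
    finally show ?thesis .
  qed
  with Z show ?thesis unfolding AE_J_iff by blast
qed

section \<open>Contraction of the iterated synthesis map\<close>

definition "K = contraction_constant (T - t0) \<beta> L \<Lambda>1 \<Lambda>2 C (norm y)"
definition "state_lip = \<beta> * exp ((\<Lambda>1 + L * \<zeta>) * (T - t0))"

lemma state_lip_nonneg: "0 \<le> state_lip"
  using \<beta>_nonneg by (simp add: state_lip_def)

lemma K_ge:
  "2 * (P_lip * C * norm y * (state_lip * (T - t0))) \<le> K"
  "2 * (P_lip * C * norm y * (2 * P_bound\<^sup>2 * C * (state_lip * (T - t0) * (T - t0)))) \<le> K"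
  unfolding K_def contraction_constant_def Let_def P_lip_def state_lip_def \<zeta>_def P_bound_def growth_def
  by linarith+

lemma feasible_coercive: "u \<in> feasible \<Longrightarrow> u \<in> coercive_controls"
  by (simp add: feasible_set_def)

lemma feasible_Linf: "u \<in> feasible \<Longrightarrow> u \<in> Linf J"
  by (simp add: feasible_set_def)

lemma feasible_bound: "u \<in> feasible \<Longrightarrow> AE t in lebesgue_on J. norm (u t) \<le> \<zeta>"
  using Linf_norm_bound(2)[OF J_sets feasible_Linf, of u]
  by (rule eventually_mono) (auto simp: feasible_set_def \<zeta>_def growth_def)

text \<open>
  The bound \<open>\<zeta>\<close> is exactly what coercivity gives for a synthesised control.
\<close>

lemma synthesis_feasible:
  assumes S: "S ` coercive_controls \<subseteq> coercive_controls" and u: "u \<in> coercive_controls"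
  shows "S u \<in> feasible"
proof -
  have Su: "S u \<in> coercive_controls" using S u by blast
  then have "S u \<in> Linf J" by (simp add: coercivity_class_def)
  moreover have "Linf_norm J (S u) \<le> \<zeta>"
    using \<open>S u \<in> Linf J\<close> by (intro Linf_normI[OF J_sets _ synthesis_bound[OF u]]) (simp add: Linf_def)
  ultimately show ?thesis using Su by (simp add: feasible_set_def \<zeta>_def growth_def)
qed

text \<open>
  The gain over \<open>K\<^sup>m\<close> comes from iterating the integrals, so the bound on \<open>u - v\<close> must be kept as a
  function \<open>z\<close> of the rescaled time and not be replaced by its supremum.
\<close>

lemma contraction_step:
  assumes u: "u \<in> feasible" and v: "v \<in> feasible"
    and z: "continuous_on {0..1} z" "\<And>r. r \<in> {0..1} \<Longrightarrow> 0 \<le> z r" and c: "0 \<le> c"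
    and uv: "AE t in lebesgue_on J. norm (u t - v t) \<le> c * z ((t - t0) / (T - t0))"
  shows "AE t in lebesgue_on J. norm (S u t - S v t) \<le> c * K *
    ((1 - 1/2) * integral {0..(t - t0) / (T - t0)} z + 1/2 * integral {0..1} (\<lambda>r. (1 - r) * z r))"
proof -
  define h where "h = (\<lambda>t. (t - t0) / (T - t0))"
  have h: "h t \<in> {0..1}" if "t \<in> {t0..T}" for t using that t0T by (auto simp: h_def field_simps)
  have hc: "continuous_on {t0..T} h" unfolding h_def using t0T by (intro continuous_intros) auto
  define Z where "Z = (\<lambda>y. integral {0..y} z)"
  have Zc: "continuous_on {0..1} Z"
    unfolding Z_def by (intro indefinite_integral_continuous_1 integrable_continuous_interval z)
  have zi: "z integrable_on {0..y}" if "y \<in> {0..1}" for y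
    using that by (intro integrable_continuous_interval continuous_on_subset[OF z(1)]) auto
  have Z0: "0 \<le> Z y" if "y \<in> {0..1}" for y
    unfolding Z_def using that z(2) by (intro integral_nonneg zi) auto
  define k where "k = (\<lambda>t. c * z (h t))"
  have k: "continuous_on {t0..T} k"
    unfolding k_def using h by (intro continuous_intros continuous_on_compose2[OF z(1) hc]) auto
  have k0: "0 \<le> k t" if "t \<in> {t0..T}" for t unfolding k_def using c z(2)[OF h[OF that]] by simp
  have Ik: "integral {t0..t} k = c * ((T - t0) * Z (h t))" if "t \<in> {t0..T}" for t
    using integral_rescale[OF z(1) t0T that] by (simp add: k_def h_def Z_def)
  define d where "d = (\<lambda>t. state_lip * (T - t0) * c * Z (h t))"
  have d_ge: "norm (state u t - state v t) \<le> d t" if "t \<in> {t0..T}" for t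
    using state_diff[OF feasible_Linf[OF u] feasible_Linf[OF v] feasible_bound[OF u] constants_nonneg(4) k k0 _ that] uv
    unfolding Ik[OF that] by (simp add: d_def state_lip_def k_def h_def mult_ac)
  have d_int: "d integrable_on {t0..T}"
    unfolding d_def using h by (intro integrable_continuous_interval continuous_intros continuous_on_compose2[OF Zc hc]) auto
  have "integral {t0..T} (\<lambda>t. Z (h t)) = (T - t0) * integral {0..1} Z"
    using integral_rescale[OF Zc t0T, of T] t0T by (simp add: h_def)
  also have "integral {0..1} Z = integral {0..1} (\<lambda>r. (1 - r) * z r)"
    unfolding Z_def by (rule integral_indefinite_integral[OF z(1)])
  finally have Id: "integral {t0..T} d = state_lip * (T - t0) * c * ((T - t0) * integral {0..1} (\<lambda>r. (1 - r) * z r))"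
    unfolding d_def by simp
  let ?I = "integral {0..1} (\<lambda>r. (1 - r) * z r)"
  have I0: "0 \<le> ?I"
    using z(2) by (intro integral_nonneg integrable_continuous_interval continuous_intros z(1)) auto
  have final: "P_lip * C * norm y * (d t + 2 * P_bound\<^sup>2 * C * integral {t0..T} d)
      \<le> c * K * ((1 - 1/2) * Z (h t) + 1/2 * ?I)" if t: "t \<in> J" for t
  proof -
    have Zt: "0 \<le> Z (h t)" using t by (intro Z0 h) auto
    have "P_lip * C * norm y * (d t + 2 * P_bound\<^sup>2 * C * integral {t0..T} d)
      = (2 * (P_lip * C * norm y * (state_lip * (T - t0)))) * (c * Z (h t) / 2)
        + (2 * (P_lip * C * norm y * (2 * P_bound\<^sup>2 * C * (state_lip * (T - t0) * (T - t0))))) * (c * ?I / 2)"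
      unfolding Id by (simp add: d_def distrib_left mult_ac)
    also have "\<dots> \<le> K * (c * Z (h t) / 2) + K * (c * ?I / 2)"
      using c Zt I0 by (intro add_mono mult_right_mono K_ge) auto
    also have "\<dots> = c * K * ((1 - 1/2) * Z (h t) + 1/2 * ?I)" by (simp add: distrib_left mult_ac)
    finally show ?thesis .
  qed
  obtain Y where Y: "negligible Y" "\<And>t. t \<in> J - Y \<Longrightarrow> norm (S u t - S v t)
      \<le> P_lip * C * norm y * (d t + 2 * P_bound\<^sup>2 * C * integral {t0..T} d)"
    using synthesis_diff[OF feasible_coercive[OF u] feasible_coercive[OF v] d_int d_ge] unfolding AE_J_iff by blast
  have "norm (S u t - S v t) \<le> c * K * ((1 - 1/2) * Z (h t) + 1/2 * ?I)" if "t \<in> J - Y" for t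
    using order_trans[OF Y(2)[OF that] final] that by blast
  then show ?thesis unfolding AE_J_iff Z_def h_def using Y(1) by blast
qed

lemma iterates_diff:
  assumes S: "S ` coercive_controls \<subseteq> coercive_controls" and u: "u \<in> feasible" and v: "v \<in> feasible"
  shows "(S ^^ m) u \<in> feasible \<and> (S ^^ m) v \<in> feasible \<and> (AE t in lebesgue_on J. norm ((S ^^ m) u t - (S ^^ m) v t)
      \<le> Linf_norm J (\<lambda>t. u t - v t) * K ^ m * zseq (1/2) m ((t - t0) / (T - t0)))"
proof (induction m)
  case 0
  show ?case
    using u v Linf_norm_bound(2)[OF J_sets Linf_diff[OF feasible_Linf[OF u] feasible_Linf[OF v]]] by simp
next
  case (Suc m)
  let ?c = "Linf_norm J (\<lambda>t. u t - v t)"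
  have c: "0 \<le> ?c" by (rule Linf_norm_bound(1)[OF J_sets Linf_diff[OF feasible_Linf[OF u] feasible_Linf[OF v]]])
  have K: "0 \<le> K" unfolding K_def by (rule less_imp_le[OF contraction_constant_pos])
  have "AE t in lebesgue_on J. norm (S ((S ^^ m) u) t - S ((S ^^ m) v) t) \<le> ?c * K ^ m * K *
    ((1 - 1/2) * integral {0..(t - t0) / (T - t0)} (zseq (1/2) m) + 1/2 * integral {0..1} (\<lambda>r. (1 - r) * zseq (1/2) m r))"
    by (rule contraction_step) (use Suc c K in \<open>auto intro: continuous_on_zseq zseq_nonneg\<close>)
  then show ?case
    using Suc synthesis_feasible[OF S feasible_coercive] by (simp add: mult_ac)
qed

lemma iterates_lipschitz:
  assumes S: "S ` coercive_controls \<subseteq> coercive_controls" and u: "u \<in> feasible" and v: "v \<in> feasible"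
  shows "Linf_norm J (\<lambda>t. (S ^^ m) u t - (S ^^ m) v t) \<le> K ^ m * gam (1/2) m * Linf_norm J (\<lambda>t. u t - v t)"
proof (rule Linf_normI[OF J_sets])
  note it = iterates_diff[OF S u v, of m]
  show "(\<lambda>t. (S ^^ m) u t - (S ^^ m) v t) \<in> borel_measurable (lebesgue_on J)"
    using Linf_diff[OF feasible_Linf feasible_Linf] it by (auto simp: Linf_def)
  let ?c = "Linf_norm J (\<lambda>t. u t - v t)"
  have c: "0 \<le> ?c" by (rule Linf_norm_bound(1)[OF J_sets Linf_diff[OF feasible_Linf[OF u] feasible_Linf[OF v]]])
  have K: "0 \<le> K" unfolding K_def by (rule less_imp_le[OF contraction_constant_pos])
  obtain Y where Y: "negligible Y" "\<And>t. t \<in> J - Y \<Longrightarrow> norm ((S ^^ m) u t - (S ^^ m) v t)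
      \<le> ?c * K ^ m * zseq (1/2) m ((t - t0) / (T - t0))"
    using it unfolding AE_J_iff by blast
  have "norm ((S ^^ m) u t - (S ^^ m) v t) \<le> K ^ m * gam (1/2) m * ?c" if t: "t \<in> J - Y" for t
  proof -
    have "(t - t0) / (T - t0) \<in> {0..1}" using t t0T by (auto simp: field_simps)
    then have "zseq (1/2) m ((t - t0) / (T - t0)) \<le> gam (1/2) m" by (intro zseq_le_gam) auto
    then have "?c * K ^ m * zseq (1/2) m ((t - t0) / (T - t0)) \<le> ?c * K ^ m * gam (1/2) m"
      using c K by (intro mult_left_mono) auto
    then show ?thesis using Y(2)[OF t] by (simp add: mult_ac)
  qed
  then show "AE t in lebesgue_on J. norm ((S ^^ m) u t - (S ^^ m) v t) \<le> K ^ m * gam (1/2) m * ?c"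
    unfolding AE_J_iff using Y(1) by blast
qed

text \<open>
  The states, and with them the integrands of the Gramians, converge pointwise and boundedly. By
  dominated convergence the integrand of the limit control is integrable and the Gramians converge,
  so the coercivity inequality passes to the limit.
\<close>

lemma feasible_closed:
  assumes u: "\<And>n. u n \<in> feasible" and w: "w \<in> Linf J" and d: "(d :: nat \<Rightarrow> real) \<longlonglongrightarrow> 0"
    and wu: "\<And>n. Linf_norm J (\<lambda>t. w t - u n t) \<le> d n"
  shows "w \<in> feasible"
proof -
  have wu_ae: "AE t in lebesgue_on J. norm (w t - u n t) \<le> d n" for n
    using Linf_norm_bound(2)[OF J_sets Linf_diff[OF w feasible_Linf[OF u[of n]]]]
    by (rule eventually_mono) (rule order_trans[OF _ wu])
  have d0: "0 \<le> d n" for n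
    using Linf_norm_bound(1)[OF J_sets Linf_diff[OF w feasible_Linf[OF u[of n]]]] wu[of n] by linarith
  have "Linf_norm J w \<le> \<zeta> + d n" for n
  proof (rule Linf_normI[OF J_sets])
    show "w \<in> borel_measurable (lebesgue_on J)" using w by (simp add: Linf_def)
    show "AE t in lebesgue_on J. norm (w t) \<le> \<zeta> + d n"
      using wu_ae[of n] feasible_bound[OF u[of n]]
    proof eventually_elim
      case (elim t)
      then show ?case using norm_triangle_ineq[of "w t - u n t" "u n t"] by simp
    qed
  qed
  moreover have "(\<lambda>n. \<zeta> + d n) \<longlonglongrightarrow> \<zeta> + 0" by (intro tendsto_intros d)
  ultimately have w_norm: "Linf_norm J w \<le> \<zeta>"
    using LIMSEQ_le_const[of "\<lambda>n. \<zeta> + d n" \<zeta>] by auto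
  then have w_bound: "AE t in lebesgue_on J. norm (w t) \<le> \<zeta>"
    using Linf_norm_bound(2)[OF J_sets w] by (auto elim: eventually_mono)
  have state_conv: "norm (state w t - state (u n) t) \<le> state_lip * (T - t0) * d n" if t: "t \<in> {t0..T}" for t n
  proof -
    have "norm (state w t - state (u n) t) \<le> state_lip * integral {t0..t} (\<lambda>_. d n)"
      unfolding state_lip_def
      by (rule state_diff[OF w feasible_Linf[OF u] w_bound constants_nonneg(4) _ d0 wu_ae t]) simp
    also have "integral {t0..t} (\<lambda>_. d n) = (t - t0) * d n" using t by simp
    also have "state_lip * ((t - t0) * d n) \<le> state_lip * ((T - t0) * d n)"
      using t d0[of n] state_lip_nonneg by (intro mult_left_mono mult_right_mono) auto
    finally show ?thesis by (simp add: mult_ac)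
  qed
  obtain Z where Z: "negligible Z" and Pb: "\<And>u t w. t \<in> J - Z \<Longrightarrow> norm (P u t *v w) \<le> P_bound * norm w"
    and Pl: "\<And>u v t w. t \<in> J - Z \<Longrightarrow> norm ((P u t - P v t) *v w) \<le> P_lip * norm (state u t - state v t) * norm w"
    using P_estimates by blast
  define M where "M = (\<lambda>u t. P u t ** transpose (P u t))"
  have M_apply: "M u t *v a = P u t *v (transpose (P u t) *v a)" for u t a
    by (simp only: M_def matrix_vector_mul_assoc)
  define c where "c = real CARD('d) * real CARD('d)"
  have M_bound: "norm (M u t) \<le> c * (P_bound * P_bound)" if t: "t \<in> J - Z" for u t
    unfolding c_def
  proof (rule norm_matrix_le)
    fix a
    have "norm (M u t *v a) \<le> P_bound * norm (transpose (P u t) *v a)" unfolding M_apply by (rule Pb[OF t])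
    also have "\<dots> \<le> P_bound * (P_bound * norm a)"
      by (intro mult_left_mono norm_transpose_mult_le Pb[OF t] constants_nonneg)
    finally show "norm (M u t *v a) \<le> P_bound * P_bound * norm a" by simp
  qed
  have M_conv: "(\<lambda>n. M (u n) t) \<longlonglongrightarrow> M w t" if t: "t \<in> J - Z" for t
  proof -
    define e where "e = (\<lambda>n. c * (2 * P_bound * (P_lip * (state_lip * (T - t0) * d n))))"
    have "norm (M (u n) t - M w t) \<le> e n" for n
      unfolding e_def c_def
    proof (rule norm_matrix_le)
      fix a
      have "norm ((P (u n) t - P w t) *v b) \<le> P_lip * (state_lip * (T - t0) * d n) * norm b" for b
      proof -
        have "norm (state (u n) t - state w t) \<le> state_lip * (T - t0) * d n"
          using state_conv[of t n] t by (simp add: norm_minus_commute)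
        then have "P_lip * norm (state (u n) t - state w t) * norm b \<le> P_lip * (state_lip * (T - t0) * d n) * norm b"
          by (intro mult_right_mono mult_left_mono constants_nonneg) auto
        then show ?thesis using Pl[OF t, of "u n" w b] by linarith
      qed
      moreover have "0 \<le> P_lip * (state_lip * (T - t0) * d n)"
        using constants_nonneg state_lip_nonneg t0T d0[of n] by simp
      ultimately show "norm ((M (u n) t - M w t) *v a) \<le> 2 * P_bound * (P_lip * (state_lip * (T - t0) * d n)) * norm a"
        using gramian_integrand_diff[OF Pb[OF t] Pb[OF t] _ constants_nonneg(2)]
        unfolding matrix_vector_mult_diff_rdistrib M_apply by blast
    qed
    then have le: "\<forall>\<^sub>F n in sequentially. norm (M (u n) t - M w t) \<le> e n" by simp
    have "e \<longlonglongrightarrow> c * (2 * P_bound * (P_lip * (state_lip * (T - t0) * 0)))"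
      unfolding e_def by (intro tendsto_intros d)
    then have "e \<longlonglongrightarrow> 0" by simp
    with le have "(\<lambda>n. M (u n) t - M w t) \<longlonglongrightarrow> 0" by (rule Lim_null_comparison)
    then show ?thesis by (rule LIM_zero_cancel)
  qed
  have Mu: "set_integrable lebesgue {t0..T} (M (u n))" "G (u n) = integral {t0..T} (M (u n))" for n
  proof -
    show s: "set_integrable lebesgue {t0..T} (M (u n))"
      unfolding M_def by (rule coercive_imp_integrable[OF feasible_coercive[OF u]])
    show "G (u n) = integral {t0..T} (M (u n))"
      using set_lebesgue_integral_eq_integral(2)[OF s] by (simp add: gramian_eq M_def)
  qed
  define Y where "Y = Z \<union> {t0, T}"
  have Y: "negligible Y" using Z by (simp add: Y_def negligible_Un)
  have YJ: "t \<in> J - Z" if "t \<in> {t0..T} - Y" for t using that by (auto simp: Y_def)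
  define f where "f = (\<lambda>u t. if t \<in> Y then 0 else M u t)"
  have fi: "f (u n) integrable_on {t0..T}" for n
    by (rule integrable_spike[OF set_lebesgue_integral_eq_integral(1)[OF Mu(1)] Y]) (simp add: f_def)
  have fb: "norm (f v t) \<le> c * (P_bound * P_bound)" if "t \<in> {t0..T}" for v t
    using M_bound[OF YJ] that by (auto simp: f_def c_def)
  have fc: "(\<lambda>n. f (u n) t) \<longlonglongrightarrow> f w t" if "t \<in> {t0..T}" for t
    using M_conv[OF YJ] that by (auto simp: f_def)
  note dom = dominated_convergence[OF fi integrable_const_ivl fb fc]
  have "f w absolutely_integrable_on {t0..T}"
    by (rule absolutely_integrable_integrable_bound[OF fb dom(1) integrable_const_ivl])
  then have Mw: "set_integrable lebesgue {t0..T} (M w)"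
    by (rule absolutely_integrable_spike[OF _ Y]) (simp add: f_def)
  have I_eq: "integral {t0..T} (f v) = integral {t0..T} (M v)" for v
    by (rule integral_spike[OF Y]) (simp add: f_def)
  have "G w = integral {t0..T} (M w)"
    using set_lebesgue_integral_eq_integral(2)[OF Mw] by (simp add: gramian_eq M_def)
  then have G_conv: "(\<lambda>n. G (u n)) \<longlonglongrightarrow> G w"
    using dom(2) by (simp add: I_eq Mu(2))
  have "inverse C * (a \<bullet> a) \<le> a \<bullet> (G w *v a)" for a
  proof (rule LIMSEQ_le_const)
    show "(\<lambda>n. a \<bullet> (G (u n) *v a)) \<longlonglongrightarrow> a \<bullet> (G w *v a)"
      by (intro tendsto_intros bounded_linear.tendsto[OF bounded_linear_matrix_vector_mul_left] G_conv)
    show "\<exists>N. \<forall>n\<ge>N. inverse C * (a \<bullet> a) \<le> a \<bullet> (G (u n) *v a)"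
      using coercive_gramian[OF feasible_coercive[OF u]] by blast
  qed
  then have "inverse C \<le> lambda_min (G w)" by (rule lambda_min_ge[OF gramian_symmetric])
  then show ?thesis using w w_norm by (simp add: feasible_set_def coercivity_class_def \<zeta>_def growth_def)
qed

theorem synthesis_contraction:
  assumes S: "S ` coercive_controls \<subseteq> coercive_controls" and ne: "coercive_controls \<noteq> {}"
  shows "\<exists>p. 0 < p \<and> p < 1 \<and>
          (let \<rho> = (\<lambda>m. K ^ m * gam p m)
           in (\<forall>m\<ge>1. 0 < \<rho> m) \<and> gam p \<longlonglongrightarrow> 0 \<and>
              (\<forall>u\<in>feasible. \<forall>v\<in>feasible. \<forall>m\<ge>1.
                 Linf_norm J (\<lambda>t. (S ^^ m) u t - (S ^^ m) v t) \<le> \<rho> m * Linf_norm J (\<lambda>t. u t - v t)) \<and>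
              ((\<exists>m\<ge>1. \<rho> m < 1) \<longrightarrow>
                 (\<exists>w\<in>feasible. ae_eq J (S w) w \<and> (\<forall>v\<in>feasible. ae_eq J (S v) v \<longrightarrow> ae_eq J v w) \<and>
                    (\<forall>u\<in>feasible. (\<lambda>n. Linf_norm J (\<lambda>t. (S ^^ n) u t - w t)) \<longlonglongrightarrow> 0))))"
proof (intro exI[of _ "1/2 :: real"] conjI, simp, simp, unfold Let_def, intro conjI allI impI ballI)
  have K: "0 < K" unfolding K_def by (rule contraction_constant_pos)
  have pos: "0 < K ^ m * gam (1/2) m" for m using K gam_pos[of "1/2" m] by simp
  show "0 < K ^ m * gam (1/2) m" for m by (rule pos)
  show "gam (1/2) \<longlonglongrightarrow> 0" by (rule gam_tendsto_0) auto
  show "Linf_norm J (\<lambda>t. (S ^^ m) u t - (S ^^ m) v t) \<le> K ^ m * gam (1/2) m * Linf_norm J (\<lambda>t. u t - v t)"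
    if "u \<in> feasible" "v \<in> feasible" for u v m
    by (rule iterates_lipschitz[OF S that])
  assume "\<exists>m\<ge>1. K ^ m * gam (1/2) m < 1"
  then obtain m where m: "1 \<le> m" "K ^ m * gam (1/2) m < 1" by blast
  have map: "S ` feasible \<subseteq> feasible" using synthesis_feasible[OF S feasible_coercive] by blast
  have sub: "feasible \<subseteq> Linf J" using feasible_Linf by blast
  have nonempty: "feasible \<noteq> {}" using ne synthesis_feasible[OF S] by blast
  have diam: "Linf_norm J (\<lambda>t. u t - v t) \<le> \<zeta> + \<zeta>" if "u \<in> feasible" "v \<in> feasible" for u v
  proof (rule Linf_normI[OF J_sets])
    show "(\<lambda>t. u t - v t) \<in> borel_measurable (lebesgue_on J)"
      using Linf_diff[OF feasible_Linf feasible_Linf] that by (auto simp: Linf_def)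
    show "AE t in lebesgue_on J. norm (u t - v t) \<le> \<zeta> + \<zeta>"
      using feasible_bound[OF that(1)] feasible_bound[OF that(2)]
      by eventually_elim (rule order_trans[OF norm_triangle_ineq4 add_mono])
  qed
  show "\<exists>w\<in>feasible. ae_eq J (S w) w \<and> (\<forall>v\<in>feasible. ae_eq J (S v) v \<longrightarrow> ae_eq J v w) \<and>
      (\<forall>u\<in>feasible. (\<lambda>n. Linf_norm J (\<lambda>t. (S ^^ n) u t - w t)) \<longlonglongrightarrow> 0)"
    by (rule contractive_iterate_fixed_point[OF J_sets sub nonempty map diam feasible_closed
        iterates_lipschitz[OF S] less_imp_le[OF pos] m])
qed

end

theorem theorem3p10:
  fixes i :: nat and x0 y :: "real^'d"
    and C \<Delta> \<beta> L \<Lambda>1 \<Lambda>2 :: real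
  assumes "i \<in> {1, 2}" and "C > 0"
    and "\<Delta> > 0" and "\<Lambda>1 > 0" and "\<Lambda>2 > 0" and "L \<ge> 0"
  shows "\<exists>K>0. \<forall>(t0::real) T (N :: real \<Rightarrow> real^'d \<Rightarrow> real^'d) (B :: real \<Rightarrow> real^'d \<Rightarrow> real^'k^'d).
    (let S = synthesis t0 T N B x0 (endpoint t0 T i) y;
         FC = coercivity_class t0 T N B x0 (endpoint t0 T i) C;
         Fy = feasible_set t0 T N B \<Lambda>1 x0 (endpoint t0 T i) C y;
         J = {t0<..<T}
     in T - t0 = \<Delta> \<and> admissible_drift t0 T \<Lambda>1 \<Lambda>2 N \<and> admissible_control_matrix t0 T L B \<and>
        control_matrix_norm t0 T B = \<beta> \<and> FC \<noteq> {} \<and> S ` FC \<subseteq> FC \<longrightarrow>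
        (\<exists>p. 0 < p \<and> p < 1 \<and>
          (let \<rho> = (\<lambda>m. K ^ m * gam p m)
           in (\<forall>m\<ge>1. 0 < \<rho> m) \<and> gam p \<longlonglongrightarrow> 0 \<and>
              (\<forall>u\<in>Fy. \<forall>v\<in>Fy. \<forall>m\<ge>1.
                 Linf_norm J (\<lambda>t. (S ^^ m) u t - (S ^^ m) v t) \<le> \<rho> m * Linf_norm J (\<lambda>t. u t - v t)) \<and>
              ((\<exists>m\<ge>1. \<rho> m < 1) \<longrightarrow>
                 (\<exists>w\<in>Fy. ae_eq J (S w) w \<and> (\<forall>v\<in>Fy. ae_eq J (S v) v \<longrightarrow> ae_eq J v w) \<and>
                    (\<forall>u\<in>Fy. (\<lambda>n. Linf_norm J (\<lambda>t. (S ^^ n) u t - w t)) \<longlonglongrightarrow> 0))))))"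
proof (intro exI[of _ "contraction_constant \<Delta> \<beta> L \<Lambda>1 \<Lambda>2 C (norm y)"] conjI contraction_constant_pos,
    unfold Let_def, intro allI impI, elim conjE, goal_cases)
  case (1 t0 T N B)
  interpret control_system t0 T \<Lambda>1 \<Lambda>2 L C N B x0 y "endpoint t0 T i"
    by unfold_locales (use assms 1(1-3) in \<open>auto simp: endpoint_def\<close>)
  show ?case
    using synthesis_contraction[OF 1(6,5)] unfolding K_def Let_def 1(1,4) .
qed

end
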